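(* Let $N\in\mathbb N$. For $n=1,2,\dots$ let $X(\cdot;n)=\{X_i^j(t;n):1\le i\le j\le N\}$, $t\ge 0$, be a $\mathbb Z^{N(N+1)/2}$-valued random process with càdlàg trajectories and unit steps in each coordinate (that is, $|X_i^j(t;n)-X_i^j(t-;n)|\le 1$ for all $t$, $i$, $j$), and let $\mathcal X(\cdot;n)$ be the interlacing dynamics driven by $X(\cdot;n)$ with some initial condition $\mathcal X(0;n)\in\mathbb{GT}^{(N)}$ (possibly random) which is independent of the increments of $X(\cdot;n)$. Suppose that there exist a sequence $\{a_n(\cdot)\}_{n\in\mathbb N}$ of continuous real-valued functions on $[0,\infty)$ and a sequence $\{b_n\}_{n\in\mathbb N}$ of positive reals such that, as $n\to\infty$: (i) $b_n\to\infty$; (ii) the law of $(X(\cdot;n)-a_n(\cdot))/b_n$ on $D([0,\infty),\mathbb R^{N(N+1)/2})$ converges to the law of a standard $N(N+1)/2$-dimensional Brownian motion; (iii) the law of $(\mathcal X(0;n)-a_n(0))/b_n$ converges to some law $W(0)$. (Here $a_n$ is subtracted from every coordinate.) Then, as $n\to\infty$, the law of $(\mathcal X(\cdot;n)-a_n(\cdot))/b_n$ on $D([0,\infty),\mathbb R^{N(N+1)/2})$ converges to the law of the process $W$ (reflected interlacing Brownian motions) with initial condition $W(0)$.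
   Context: **Interlacing configurations.** $\mathbb{GT}^{(N)}$ is the set of integer arrays $(x_i^j)_{1\le i\le j\le N}$ with $x_{i-1}^j<x_{i-1}^{j-1}\le x_i^j$ for all $2\le i\le j\le N$. $\mathbb{GT}^{(N)}_c$ is the set of real arrays $(x_i^j)_{1\le i\le j\le N}$ with $x_{i-1}^j\le x_{i-1}^{j-1}\le x_i^j$ for all $2\le i\le j\le N$. **Interlacing dynamics.** Let $X$ be a $\mathbb Z^{N(N+1)/2}$-valued process with càdlàg paths and $|X_i^j(t)-X_i^j(t-)|\le1$ for all $t,i,j$ (so there are finitely many jump times on bounded intervals). The interlacing dynamics $\mathcal X(t)$, $t\ge0$, driven by $X$ has initial value $\mathcal X(0)$, a given $\mathbb{GT}^{(N)}$-valued random variable; $\mathcal X$ is constant on every time interval on which $X$ is constant; and at each discontinuity time $t$ of $X$, $\mathcal X(t)$ is determined by $\mathcal X(t-)$ and $X(t)-X(t-)$ by a sequential update. First $\mathcal X_1^1(t)=\mathcal X_1^1(t-)+X_1^1(t)-X_1^1(t-)$. Then for $k=2,\dots,N$ in order, once all $\mathcal X_i^j(t)$ with $j\le k-1$ are determined, for each $i=1,\dots,k$ apply the first of the following steps whose condition holds: 1. (push) If $i>1$ and $\mathcal X_i^k(t-)=\mathcal X_{i-1}^{k-1}(t)-1$, set $\mathcal X_i^k(t)=\mathcal X_i^k(t-)+1$. 2. (push) If $i<k$ and $\mathcal X_i^k(t-)=\mathcal X_i^{k-1}(t)$, set $\mathcal X_i^k(t)=\mathcal X_i^k(t-)-1$.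 3. If $X_i^k(t)-X_i^k(t-)=1$: if $i<k$ and $\mathcal X_i^{k-1}(t)=\mathcal X_i^k(t-)+1$ (blocked), set $\mathcal X_i^k(t)=\mathcal X_i^k(t-)$; otherwise set $\mathcal X_i^k(t)=\mathcal X_i^k(t-)+1$. 4. If $X_i^k(t)-X_i^k(t-)=-1$: if $i>1$ and $\mathcal X_{i-1}^{k-1}(t)=\mathcal X_i^k(t-)$ (blocked), set $\mathcal X_i^k(t)=\mathcal X_i^k(t-)$; otherwise set $\mathcal X_i^k(t)=\mathcal X_i^k(t-)-1$. 5. If $X_i^k(t)-X_i^k(t-)=0$, set $\mathcal X_i^k(t)=\mathcal X_i^k(t-)$. **The process $W$ (Warren).** Let $W(0)$ be a $\mathbb{GT}^{(N)}_c$-valued random variable, and let $B_i^j$, $1\le i\le j\le N$, be independent standard Brownian motions started at $0$, independent of $W(0)$. $W$ is the $\mathbb{GT}^{(N)}_c$-valued continuous process with initial value $W(0)$, defined level by level: $W_1^1=W_1^1(0)+B_1^1$, and for $k\ge2$, $W_i^k$ is the Brownian motion $W_i^k(0)+B_i^k$ reflected on the trajectories of $W_{i-1}^{k-1}$ (from below, if $i>1$) and $W_i^{k-1}$ (from above, if $i<k$). That is, $$W_i^k(t)=W_i^k(0)+B_i^k(t)+L_i^{k,-}(t)-L_i^{k,+}(t),$$ where $L_i^{k,\pm}$ are continuous nondecreasing processes starting at $0$, $L_i^{k,-}$ increases only at times when $W_i^k=W_{i-1}^{k-1}$, $L_i^{k,+}$ increases only at times when $W_i^k=W_i^{k-1}$,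 and $L_1^{k,-}\equiv0$, $L_k^{k,+}\equiv0$. **Function space.** $D([0,\infty),\mathbb R^d)$ is the space of right-continuous functions $[0,\infty)\to\mathbb R^d$ with left limits, with the topology of uniform convergence on compact sets. It carries the $\sigma$-algebra generated by the coordinate evaluations, and convergence of laws means convergence of expectations of all bounded functionals that are continuous in this topology and measurable with respect to this $\sigma$-algebra. *)

theory Defs
  imports "HOL-Probability.Probability"
begin

section \<open>Triangular arrays and interlacing\<close>

text \<open>The entry \<open>x\<^sub>i\<^sup>j\<close> of an array is \<open>x (i, j)\<close>: position first, level second.\<close>

definition tri :: "nat \<Rightarrow> (nat \<times> nat) set" where
  "tri N = {(i, j). 1 \<le> i \<and> i \<le> j \<and> j \<le> N}"

definition GT :: "nat \<Rightarrow> (nat \<times> nat \<Rightarrow> int) set" where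
  "GT N = {x. \<forall>i j. 2 \<le> i \<and> i \<le> j \<and> j \<le> N \<longrightarrow>
     x (i - 1, j) < x (i - 1, j - 1) \<and> x (i - 1, j - 1) \<le> x (i, j)}"

definition GTc :: "nat \<Rightarrow> (nat \<times> nat \<Rightarrow> real) set" where
  "GTc N = {x. \<forall>i j. 2 \<le> i \<and> i \<le> j \<and> j \<le> N \<longrightarrow>
     x (i - 1, j) \<le> x (i - 1, j - 1) \<and> x (i - 1, j - 1) \<le> x (i, j)}"


section \<open>Paths on the half-line\<close>

definition cadlag :: "(real \<Rightarrow> 'a::topological_space) \<Rightarrow> bool" where
  "cadlag f \<longleftrightarrow> (\<forall>t\<ge>0. (f \<longlongrightarrow> f t) (at_right t)) \<and> (\<forall>t>0. \<exists>l. (f \<longlongrightarrow> l) (at_left t))"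

definition left_lim :: "(real \<Rightarrow> 'a::t2_space) \<Rightarrow> real \<Rightarrow> 'a" where
  "left_lim f t = Lim (at_left t) f"

text \<open>The space \<open>D([0,\<infinity>), \<real>\<^sup>I)\<close>, for a finite index set \<open>I\<close>. Paths are extensional, both
  in time and in the coordinate, so that each path has a unique representative.\<close>

definition cadlag_paths :: "'i set \<Rightarrow> (real \<Rightarrow> 'i \<Rightarrow> real) set" where
  "cadlag_paths I = {x \<in> {0..} \<rightarrow>\<^sub>E (I \<rightarrow>\<^sub>E UNIV). \<forall>p\<in>I. cadlag (\<lambda>t. x t p)}"

text \<open>The measurable space of paths, with the \<open>\<sigma>\<close>-algebra generated by the coordinate
  evaluations. (Only the measurable structure is used, not the measure.)\<close>

definition cadlag_space :: "'i set \<Rightarrow> (real \<Rightarrow> 'i \<Rightarrow> real) measure" where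
  "cadlag_space I =
     restrict_space (PiM {0..} (\<lambda>_. PiM I (\<lambda>_. borel))) (cadlag_paths I)"

text \<open>The topology of uniform convergence on compact sets.\<close>

definition ucc_topology :: "'i set \<Rightarrow> (real \<Rightarrow> 'i \<Rightarrow> real) topology" where
  "ucc_topology I = topology (\<lambda>U. U \<subseteq> cadlag_paths I \<and>
     (\<forall>x\<in>U. \<exists>T\<ge>0. \<exists>\<delta>>0. \<forall>y\<in>cadlag_paths I.
        (\<forall>t\<in>{0..T}. \<forall>p\<in>I. \<bar>y t p - x t p\<bar> < \<delta>) \<longrightarrow> y \<in> U))"

lemma openin_ucc_topology:
  "openin (ucc_topology I) U \<longleftrightarrow> U \<subseteq> cadlag_paths I \<and>
     (\<forall>x\<in>U. \<exists>T\<ge>0. \<exists>\<delta>>0. \<forall>y\<in>cadlag_paths I.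
        (\<forall>t\<in>{0..T}. \<forall>p\<in>I. \<bar>y t p - x t p\<bar> < \<delta>) \<longrightarrow> y \<in> U)"
proof -
  define Q :: "(real \<Rightarrow> 'a \<Rightarrow> real) set \<Rightarrow> (real \<Rightarrow> 'a \<Rightarrow> real) \<Rightarrow> real \<Rightarrow> real \<Rightarrow> bool" where
    "Q U x T \<delta> \<longleftrightarrow> (\<forall>y\<in>cadlag_paths I. (\<forall>t\<in>{0..T}. \<forall>p\<in>I. \<bar>y t p - x t p\<bar> < \<delta>) \<longrightarrow> y \<in> U)"
    for U x T \<delta>
  define P where "P U \<longleftrightarrow> U \<subseteq> cadlag_paths I \<and> (\<forall>x\<in>U. \<exists>T\<ge>0. \<exists>\<delta>>0. Q U x T \<delta>)" for U
  have "P (S \<inter> T)" if "P S" "P T" for S T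
    unfolding P_def
  proof (intro conjI ballI)
    show "S \<inter> T \<subseteq> cadlag_paths I" using that by (auto simp: P_def)
    fix x assume x: "x \<in> S \<inter> T"
    obtain a d where a: "a \<ge> 0" "d > 0" "Q S x a d" using x \<open>P S\<close> by (auto simp: P_def)
    obtain b e where b: "b \<ge> 0" "e > 0" "Q T x b e" using x \<open>P T\<close> by (auto simp: P_def)
    have "max a b \<ge> 0" "min d e > 0" using a b by auto
    moreover have "Q (S \<inter> T) x (max a b) (min d e)" using a(3) b(3) unfolding Q_def by fastforce
    ultimately show "\<exists>T'\<ge>0. \<exists>\<delta>>0. Q (S \<inter> T) x T' \<delta>" by blast
  qed
  moreover have "P (\<Union>K)" if "\<forall>S\<in>K. P S" for K
    unfolding P_def
  proof (intro conjI ballI)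
    show "\<Union>K \<subseteq> cadlag_paths I" using that by (auto simp: P_def)
    fix x assume "x \<in> \<Union>K"
    then obtain S where S: "S \<in> K" "x \<in> S" by blast
    with that have "P S" by blast
    with S obtain a d where a: "a \<ge> 0" "d > 0" "Q S x a d" unfolding P_def by blast
    then have "Q (\<Union>K) x a d" using S(1) by (auto simp: Q_def)
    with a show "\<exists>T\<ge>0. \<exists>\<delta>>0. Q (\<Union>K) x T \<delta>" by blast
  qed
  ultimately have "istopology P" by (simp add: istopology_def)
  moreover have "ucc_topology I = topology P"
    unfolding ucc_topology_def P_def Q_def ..
  ultimately show ?thesis by (simp add: topology_inverse' P_def Q_def)
qed

lemma topspace_ucc_topology: "topspace (ucc_topology I) = cadlag_paths I"
proof (rule antisym)
  show "topspace (ucc_topology I) \<subseteq> cadlag_paths I"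
    using openin_topspace[of "ucc_topology I"] unfolding openin_ucc_topology by blast
  have "openin (ucc_topology I) (cadlag_paths I)"
    unfolding openin_ucc_topology by (auto intro!: exI[of _ "0::real"] exI[of _ "1::real"])
  then show "cadlag_paths I \<subseteq> topspace (ucc_topology I)" by (rule openin_subset)
qed

text \<open>Weak convergence of measures on a measurable space \<open>S\<close> carrying a topology \<open>T\<close> on its
  points. The \<open>\<sigma>\<close>-algebra need not contain all open sets (it does not for the path space above),
  hence test functionals are required to be both continuous and measurable.\<close>

definition converges_in_law ::
    "'a topology \<Rightarrow> 'a measure \<Rightarrow> (nat \<Rightarrow> 'a measure) \<Rightarrow> 'a measure \<Rightarrow> bool" where
  "converges_in_law T S \<mu> \<nu> \<longleftrightarrow>
     (\<forall>F::'a \<Rightarrow> real. continuous_map T euclideanreal F \<and> F \<in> borel_measurable S \<and>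
        bounded (F ` topspace T) \<longrightarrow>
        (\<lambda>n. \<integral>x. F x \<partial>\<mu> n) \<longlonglongrightarrow> (\<integral>x. F x \<partial>\<nu>))"


text \<open>Independence of two random elements. The library's \<open>indep_var\<close> requires both to take values
  in the same type.\<close>

definition independent_elements ::
    "'a measure \<Rightarrow> 'b measure \<Rightarrow> ('a \<Rightarrow> 'b) \<Rightarrow> 'c measure \<Rightarrow> ('a \<Rightarrow> 'c) \<Rightarrow> bool" where
  "independent_elements M S X T Y \<longleftrightarrow>
     X \<in> M \<rightarrow>\<^sub>M S \<and> Y \<in> M \<rightarrow>\<^sub>M T \<and>
     prob_space.indep_set M {X -` A \<inter> space M |A. A \<in> sets S} {Y -` A \<inter> space M |A. A \<in> sets T}"


section \<open>Interlacing dynamics\<close>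

text \<open>\<open>interlacing_update y d\<close> is the state after a jump \<open>d\<close> of the driving path, given the
  state \<open>y\<close> just before it. The values at level \<open>0\<close> are irrelevant.\<close>

fun interlacing_update ::
    "(nat \<times> nat \<Rightarrow> int) \<Rightarrow> (nat \<times> nat \<Rightarrow> int) \<Rightarrow> nat \<times> nat \<Rightarrow> int" where
  "interlacing_update y d (i, 0) = y (i, 0)"
| "interlacing_update y d (i, Suc 0) = y (i, Suc 0) + d (i, Suc 0)"
| "interlacing_update y d (i, Suc (Suc m)) =
    (let k = Suc (Suc m);
         old = y (i, k);
         lower = interlacing_update y d (i - 1, Suc m);
         upper = interlacing_update y d (i, Suc m)
     in if i > 1 \<and> old = lower - 1 then old + 1
        else if i < k \<and> old = upper then old - 1
        else if d (i, k) = 1 then (if i < k \<and> upper = old + 1 then old else old + 1)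
        else if d (i, k) = - 1 then (if i > 1 \<and> lower = old then old else old - 1)
        else old)"

text \<open>\<open>y\<close> is the trajectory of the interlacing dynamics driven by the trajectory \<open>x\<close>. As \<open>x\<close> is
  integer-valued and cadlag, \<open>y\<close> is piecewise constant and determined by \<open>x\<close> and \<open>y 0\<close>.\<close>

definition interlacing_dynamics ::
    "nat \<Rightarrow> (real \<Rightarrow> nat \<times> nat \<Rightarrow> int) \<Rightarrow> (real \<Rightarrow> nat \<times> nat \<Rightarrow> int) \<Rightarrow> bool" where
  "interlacing_dynamics N x y \<longleftrightarrow>
     y 0 \<in> GT N \<and>
     (\<forall>J. is_interval J \<and> J \<subseteq> {0..} \<and> (\<forall>p\<in>tri N. (\<lambda>t. x t p) constant_on J) \<longrightarrow>
        (\<forall>p\<in>tri N. (\<lambda>t. y t p) constant_on J)) \<and>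
     (\<forall>t>0. (\<exists>p\<in>tri N. x t p \<noteq> left_lim (\<lambda>s. x s p) t) \<longrightarrow>
        (\<forall>p\<in>tri N. y t p =
           interlacing_update (\<lambda>q. left_lim (\<lambda>s. y s q) t)
             (\<lambda>q. x t q - left_lim (\<lambda>s. x s q) t) p))"

text \<open>Trajectory shifted by \<open>a\<close> and divided by \<open>b\<close>, as an element of the path space.\<close>

definition rescaled_path ::
    "'i set \<Rightarrow> (real \<Rightarrow> real) \<Rightarrow> real \<Rightarrow> (real \<Rightarrow> 'i \<Rightarrow> int) \<Rightarrow> real \<Rightarrow> 'i \<Rightarrow> real" where
  "rescaled_path I a b x = (\<lambda>t\<in>{0..}. \<lambda>p\<in>I. (of_int (x t p) - a t) / b)"


section \<open>Brownian motion and reflected interlacing Brownian motions\<close>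

definition std_brownian_motion1 :: "'a measure \<Rightarrow> ('a \<Rightarrow> real \<Rightarrow> real) \<Rightarrow> bool" where
  "std_brownian_motion1 M B \<longleftrightarrow>
     prob_space M \<and>
     (\<forall>t\<ge>0. (\<lambda>\<omega>. B \<omega> t) \<in> borel_measurable M) \<and>
     (AE \<omega> in M. B \<omega> 0 = 0 \<and> continuous_on {0..} (B \<omega>)) \<and>
     (\<forall>s t. 0 \<le> s \<and> s < t \<longrightarrow>
        distributed M lborel (\<lambda>\<omega>. B \<omega> t - B \<omega> s) (normal_density 0 (sqrt (t - s)))) \<and>
     (\<forall>(\<tau> :: nat \<Rightarrow> real) m. 0 \<le> \<tau> 0 \<and> (\<forall>l<m. \<tau> l \<le> \<tau> (Suc l)) \<longrightarrow>
        prob_space.indep_vars M (\<lambda>_. borel) (\<lambda>l \<omega>. B \<omega> (\<tau> (Suc l)) - B \<omega> (\<tau> l)) {..<m})"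

definition std_brownian_motion ::
    "'a measure \<Rightarrow> 'i set \<Rightarrow> ('a \<Rightarrow> real \<Rightarrow> 'i \<Rightarrow> real) \<Rightarrow> bool" where
  "std_brownian_motion M I B \<longleftrightarrow>
     prob_space M \<and>
     (\<forall>p\<in>I. std_brownian_motion1 M (\<lambda>\<omega> t. B \<omega> t p)) \<and>
     prob_space.indep_vars M (\<lambda>_. PiM {0..} (\<lambda>_. borel)) (\<lambda>p \<omega>. \<lambda>t\<in>{0..}. B \<omega> t p) I"

text \<open>The law of standard Brownian motion on the path space: the canonical process is one.\<close>

definition brownian_law :: "'i set \<Rightarrow> (real \<Rightarrow> 'i \<Rightarrow> real) measure \<Rightarrow> bool" where
  "brownian_law I \<nu> \<longleftrightarrow>
     sets \<nu> = sets (cadlag_space I) \<and> std_brownian_motion \<nu> I (\<lambda>x. x)"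

text \<open>Every point of increase of \<open>L\<close> lies in \<open>A\<close>. The truncation at \<open>0\<close> only serves to remain
  in the time domain.\<close>

definition increases_only_on :: "(real \<Rightarrow> real) \<Rightarrow> real set \<Rightarrow> bool" where
  "increases_only_on L A \<longleftrightarrow>
     (\<forall>t\<ge>0. (\<forall>\<epsilon>>0. L (max 0 (t - \<epsilon>)) < L (t + \<epsilon>)) \<longrightarrow> t \<in> A)"

definition regulator_path :: "(real \<Rightarrow> real) \<Rightarrow> bool" where
  "regulator_path L \<longleftrightarrow> L 0 = 0 \<and> continuous_on {0..} L \<and> mono_on {0..} L"

text \<open>\<open>Lm\<close> and \<open>Lp\<close> are the processes \<open>L\<^sup>-\<close> and \<open>L\<^sup>+\<close> of the reflection equations. Level \<open>1\<close> is
  covered by the general equation, since both regulators vanish there.\<close>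

definition interlacing_RBM ::
    "nat \<Rightarrow> 'a measure \<Rightarrow> ('a \<Rightarrow> real \<Rightarrow> nat \<times> nat \<Rightarrow> real) \<Rightarrow> bool" where
  "interlacing_RBM N M W \<longleftrightarrow>
     prob_space M \<and>
     W \<in> M \<rightarrow>\<^sub>M cadlag_space (tri N) \<and>
     (\<exists>B Lm Lp.
        std_brownian_motion M (tri N) B \<and>
        independent_elements M
          (PiM (tri N) (\<lambda>_. borel)) (\<lambda>\<omega>. W \<omega> 0)
          (PiM ({0..} \<times> tri N) (\<lambda>_. borel)) (\<lambda>\<omega>. \<lambda>(t, p)\<in>{0..} \<times> tri N. B \<omega> t p) \<and>
        (\<forall>p\<in>tri N. \<forall>t\<ge>0. (\<lambda>\<omega>. Lm \<omega> t p) \<in> borel_measurable M \<and>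
                           (\<lambda>\<omega>. Lp \<omega> t p) \<in> borel_measurable M) \<and>
        (AE \<omega> in M.
           (\<forall>t\<ge>0. W \<omega> t \<in> GTc N) \<and>
           (\<forall>p\<in>tri N.
              continuous_on {0..} (\<lambda>t. W \<omega> t p) \<and>
              regulator_path (\<lambda>t. Lm \<omega> t p) \<and> regulator_path (\<lambda>t. Lp \<omega> t p) \<and>
              (\<forall>t\<ge>0. W \<omega> t p = W \<omega> 0 p + B \<omega> t p + Lm \<omega> t p - Lp \<omega> t p)) \<and>
           (\<forall>(i, k)\<in>tri N.
              (if i > 1
               then increases_only_on (\<lambda>t. Lm \<omega> t (i, k)) {t. W \<omega> t (i, k) = W \<omega> t (i - 1, k - 1)}
               else \<forall>t\<ge>0. Lm \<omega> t (i, k) = 0) \<and>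
              (if i < k
               then increases_only_on (\<lambda>t. Lp \<omega> t (i, k)) {t. W \<omega> t (i, k) = W \<omega> t (i, k - 1)}
               else \<forall>t\<ge>0. Lp \<omega> t (i, k) = 0))))"

end

theory Submission
  imports Defs
begin

text \<open>Both the rescaled dynamics and the limit process solve the same reflection problem level by level,
  up to an error \<open>1 / b n\<close>: the difference between a path and its driving path increases only on the
  lower barrier and decreases only on the upper one. Comparing two solutions during an excursion of
  their difference shows, by induction on the level, that solutions with close initial and driving
  data are uniformly close. Hence a continuous functional \<open>F\<close> of the solution is almost constant on
  small neighbourhoods of the data \<open>(W(0), B)\<close>. Countably many such neighbourhoods, centred at
  rational points and rational step paths, carry the limit law. A partition of unity built from
  products of continuous functionals of the starting point and of the driving path reduces the
  convergence of \<open>E F\<close> to that of finitely many such products, which follows from the two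
  convergence hypotheses, independence, and uniqueness of the law of Brownian motion.
  In particular neither existence nor measurability of a Skorokhod map is needed.\<close>

section \<open>Stability of reflected interlacing paths\<close>

text \<open>The discrete dynamics is not a continuous image of its driver: it keeps a distance
  \<open>1 / b n\<close> from the upper barrier and resolves pushes level by level at jump times.
  Reflection is therefore a relation with a gap parameter \<open>m\<close>, satisfied by prelimit
  and limit alike, and stability holds between any two of its solutions. The \<sigma>-algebra of the
  path space is smaller than the Borel sets of its uniform topology, which is not separable, so open
  balls cannot be used freely as events. Neighbourhoods are cut out by functionals that are
  continuous and measurable at once, built from infima over rational times. \<open>F\<close> need
  not be uniformly continuous, so the scale of a neighbourhood depends on its centre. Countably many
  centres suffice because the limit driver is continuous and thus close to rational step paths on
  compact intervals. The starting point is assumed independent of the increments of the driver only,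
  while the initial value of the driver may depend on it. For this reason all comparisons of drivers
  and all path weights read only \<open>z t - z 0\<close>.\<close>

lemma excursion_bound:
  fixes D :: "real \<Rightarrow> real"
  assumes jump: "\<And>s. 0 < s \<Longrightarrow> s \<le> T \<Longrightarrow> \<exists>\<epsilon>>0. \<forall>r. 0 \<le> r \<and> s - \<epsilon> < r \<and> r < s \<longrightarrow> D s \<le> D r + j"
    and exc: "\<And>s t. 0 \<le> s \<Longrightarrow> s \<le> t \<Longrightarrow> t \<le> T \<Longrightarrow> (\<And>r. s < r \<Longrightarrow> r \<le> t \<Longrightarrow> \<kappa> < D r) \<Longrightarrow> D t \<le> D s + g"
    and init: "D 0 \<le> \<kappa>" and t: "0 \<le> t" "t \<le> T" and j: "0 \<le> j"
  shows "D t \<le> \<kappa> + j + g"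
proof -
  \<comment> \<open>The supremum of the times before \<open>t\<close> at which \<open>D\<close> is
    at most \<open>\<kappa>\<close>. It need not be attained, since \<open>D\<close> may jump
    upwards there; that jump costs \<open>j\<close>, and the excursion above \<open>\<kappa>\<close>
    that follows costs \<open>g\<close>.\<close>
  define E where "E = {r. 0 \<le> r \<and> r \<le> t \<and> D r \<le> \<kappa>}"
  define s where "s = Sup E"
  have E0: "0 \<in> E" using init t by (auto simp: E_def)
  have bdd: "bdd_above E" unfolding E_def by (rule bdd_aboveI[of _ t]) auto
  have s0: "0 \<le> s" unfolding s_def by (rule cSup_upper[OF E0 bdd])
  have st: "s \<le> t" unfolding s_def by (rule cSup_least) (use E0 in \<open>auto simp: E_def\<close>)
  have above: "\<kappa> < D r" if "s < r" "r \<le> t" for r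
  proof (rule ccontr)
    assume "\<not> \<kappa> < D r"
    then have "r \<in> E" using that s0 by (auto simp: E_def)
    from cSup_upper[OF this bdd] that show False by (simp add: s_def)
  qed
  have "D t \<le> D s + g" using s0 st t above by (intro exc) auto
  moreover have "D s \<le> \<kappa> + j"
  proof (cases "s \<in> E")
    case True
    then show ?thesis using j by (auto simp: E_def)
  next
    case False
    then have "0 < s" using E0 s0 by (cases "s = 0") auto
    then obtain \<epsilon> where \<epsilon>: "\<epsilon> > 0" "\<And>r. 0 \<le> r \<Longrightarrow> s - \<epsilon> < r \<Longrightarrow> r < s \<Longrightarrow> D s \<le> D r + j"
      using jump[of s] st t by auto
    have "s - \<epsilon> < Sup E" using \<epsilon>(1) by (simp add: s_def)
    then obtain r where r: "r \<in> E" "s - \<epsilon> < r"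
      using less_cSup_iff[OF _ bdd] E0 by blast
    have "r \<le> s" unfolding s_def by (rule cSup_upper[OF r(1) bdd])
    with r False have "r < s" by (cases "r = s") auto
    then have "D s \<le> D r + j" using r by (intro \<epsilon>) (auto simp: E_def)
    then show ?thesis using r by (auto simp: E_def)
  qed
  ultimately show ?thesis by simp
qed

text \<open>This covers the rescaled discrete dynamics, with gap \<open>m = 1 / b\<close>, and the continuous reflection
  equations, with \<open>m = 0\<close>. The regulator \<open>y - z\<close> can only increase when \<open>y\<close> touches its lower barrier, and
  only decrease when it touches its upper one; the last clause bounds the jumps of \<open>y\<close> by \<open>m\<close>.\<close>

definition reflected :: "nat \<Rightarrow> real \<Rightarrow> (real \<Rightarrow> nat \<times> nat \<Rightarrow> real) \<Rightarrow> (real \<Rightarrow> nat \<times> nat \<Rightarrow> real) \<Rightarrow> bool" where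
  "reflected N m z y \<longleftrightarrow> (\<forall>i k. (i, k) \<in> tri N \<longrightarrow>
     (\<forall>t\<ge>0. (1 < i \<longrightarrow> y t (i - 1, k - 1) \<le> y t (i, k)) \<and> (i < k \<longrightarrow> y t (i, k) \<le> y t (i, k - 1) - m)) \<and>
     (\<forall>s t. 0 \<le> s \<and> s \<le> t \<and> (1 < i \<longrightarrow> (\<forall>r\<in>{s<..t}. y r (i - 1, k - 1) < y r (i, k))) \<longrightarrow>
        y t (i, k) - z t (i, k) \<le> y s (i, k) - z s (i, k)) \<and>
     (\<forall>s t. 0 \<le> s \<and> s \<le> t \<and> (i < k \<longrightarrow> (\<forall>r\<in>{s<..t}. y r (i, k) < y r (i, k - 1) - m)) \<longrightarrow>
        y s (i, k) - z s (i, k) \<le> y t (i, k) - z t (i, k)) \<and>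
     (\<forall>s>0. \<forall>\<eta>>m. \<exists>\<epsilon>>0. \<forall>r. 0 \<le> r \<and> s - \<epsilon> < r \<and> r < s \<longrightarrow> \<bar>y s (i, k) - y r (i, k)\<bar> \<le> \<eta>))"

lemma reflectedD:
  assumes "reflected N m z y" "(i, k) \<in> tri N"
  shows "\<And>t. 0 \<le> t \<Longrightarrow> 1 < i \<Longrightarrow> y t (i - 1, k - 1) \<le> y t (i, k)"
    and "\<And>t. 0 \<le> t \<Longrightarrow> i < k \<Longrightarrow> y t (i, k) \<le> y t (i, k - 1) - m"
    and "\<And>s t. 0 \<le> s \<Longrightarrow> s \<le> t \<Longrightarrow> (\<And>r. 1 < i \<Longrightarrow> s < r \<Longrightarrow> r \<le> t \<Longrightarrow> y r (i - 1, k - 1) < y r (i, k)) \<Longrightarrow>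
        y t (i, k) - z t (i, k) \<le> y s (i, k) - z s (i, k)"
    and "\<And>s t. 0 \<le> s \<Longrightarrow> s \<le> t \<Longrightarrow> (\<And>r. i < k \<Longrightarrow> s < r \<Longrightarrow> r \<le> t \<Longrightarrow> y r (i, k) < y r (i, k - 1) - m) \<Longrightarrow>
        y s (i, k) - z s (i, k) \<le> y t (i, k) - z t (i, k)"
    and "\<And>s \<eta>. 0 < s \<Longrightarrow> m < \<eta> \<Longrightarrow> \<exists>\<epsilon>>0. \<forall>r. 0 \<le> r \<and> s - \<epsilon> < r \<and> r < s \<longrightarrow> \<bar>y s (i, k) - y r (i, k)\<bar> \<le> \<eta>"
proof -
  note * = assms(1)[unfolded reflected_def, rule_format, OF assms(2)]
  show "y t (i - 1, k - 1) \<le> y t (i, k)" if "0 \<le> t" "1 < i" for t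
    using * that by simp
  show "y t (i, k) \<le> y t (i, k - 1) - m" if "0 \<le> t" "i < k" for t
    using * that by simp
  show "y t (i, k) - z t (i, k) \<le> y s (i, k) - z s (i, k)"
    if "0 \<le> s" "s \<le> t" "\<And>r. 1 < i \<Longrightarrow> s < r \<Longrightarrow> r \<le> t \<Longrightarrow> y r (i - 1, k - 1) < y r (i, k)" for s t
    by (rule *[THEN conjunct2, THEN conjunct1, rule_format]) (use that in auto)
  show "y s (i, k) - z s (i, k) \<le> y t (i, k) - z t (i, k)"
    if "0 \<le> s" "s \<le> t" "\<And>r. i < k \<Longrightarrow> s < r \<Longrightarrow> r \<le> t \<Longrightarrow> y r (i, k) < y r (i, k - 1) - m" for s t
    by (rule *[THEN conjunct2, THEN conjunct2, THEN conjunct1, rule_format]) (use that in auto)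
  show "\<exists>\<epsilon>>0. \<forall>r. 0 \<le> r \<and> s - \<epsilon> < r \<and> r < s \<longrightarrow> \<bar>y s (i, k) - y r (i, k)\<bar> \<le> \<eta>"
    if "0 < s" "m < \<eta>" for s \<eta>
    by (rule *[THEN conjunct2, THEN conjunct2, THEN conjunct2, THEN spec, THEN mp, THEN spec, THEN mp]) (use that in auto)
qed

text \<open>Excursions are measured from the level \<open>B + \<delta>\<close>: \<open>B\<close>
  covers the distance of the barriers and \<open>\<delta>\<close> the difference of the two gaps.
  Both paths may jump by almost \<open>\<delta>\<close>, which costs \<open>2 * \<delta>\<close>,
  and the driving increments are compared at both ends of the excursion, another
  \<open>2 * \<delta>\<close>. The bound is one-sided; exchanging the two solutions gives the other
  side.\<close>

lemma reflected_step:
  assumes R: "reflected N m z y" and R': "reflected N m' z' y'" and ik: "(i, k) \<in> tri N"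
    and m: "0 \<le> m" "m < \<delta>" "0 \<le> m'" "m' < \<delta>"
    and init: "\<bar>y 0 (i, k) - y' 0 (i, k)\<bar> \<le> \<delta>"
    and drive: "\<And>t. 0 \<le> t \<Longrightarrow> t \<le> T \<Longrightarrow> \<bar>(z t (i, k) - z 0 (i, k)) - (z' t (i, k) - z' 0 (i, k))\<bar> \<le> \<delta>"
    and prev: "\<And>l t. 0 \<le> t \<Longrightarrow> t \<le> T \<Longrightarrow> (l, k - 1) \<in> tri N \<Longrightarrow> \<bar>y t (l, k - 1) - y' t (l, k - 1)\<bar> \<le> B"
    and B: "0 \<le> B" and t: "0 \<le> t" "t \<le> T"
  shows "y t (i, k) - y' t (i, k) \<le> B + 5 * \<delta>"
proof -
  define D where "D t = y t (i, k) - y' t (i, k)" for t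
  have lower: "(i - 1, k - 1) \<in> tri N" if "1 < i" using ik that by (auto simp: tri_def)
  have upper: "(i, k - 1) \<in> tri N" if "i < k" using ik that by (auto simp: tri_def)
  \<comment> \<open>While \<open>y - y'\<close> exceeds the distance of the barriers, \<open>y\<close> is off its lower and \<open>y'\<close> off its upper
    barrier, so the difference of the regulators cannot increase.\<close>
  have "D t \<le> (B + \<delta>) + 2 * \<delta> + 2 * \<delta>"
  proof (rule excursion_bound[where T = T and D = D])
    fix s :: real assume s: "0 < s" "s \<le> T"
    obtain \<epsilon> where e: "\<epsilon> > 0" "\<And>r. 0 \<le> r \<Longrightarrow> s - \<epsilon> < r \<Longrightarrow> r < s \<Longrightarrow> \<bar>y s (i, k) - y r (i, k)\<bar> \<le> \<delta>"
      using reflectedD(5)[OF R ik s(1) m(2)] by blast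
    obtain \<epsilon>' where e': "\<epsilon>' > 0" "\<And>r. 0 \<le> r \<Longrightarrow> s - \<epsilon>' < r \<Longrightarrow> r < s \<Longrightarrow> \<bar>y' s (i, k) - y' r (i, k)\<bar> \<le> \<delta>"
      using reflectedD(5)[OF R' ik s(1) m(4)] by blast
    show "\<exists>\<epsilon>>0. \<forall>r. 0 \<le> r \<and> s - \<epsilon> < r \<and> r < s \<longrightarrow> D s \<le> D r + 2 * \<delta>"
    proof (intro exI[of _ "min \<epsilon> \<epsilon>'"] conjI allI impI)
      fix r assume r: "0 \<le> r \<and> s - min \<epsilon> \<epsilon>' < r \<and> r < s"
      then have "\<bar>y s (i, k) - y r (i, k)\<bar> \<le> \<delta>" "\<bar>y' s (i, k) - y' r (i, k)\<bar> \<le> \<delta>"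
        by (auto intro!: e e')
      then show "D s \<le> D r + 2 * \<delta>" unfolding D_def by linarith
    qed (use e e' in auto)
  next
    fix s t :: real assume st: "0 \<le> s" "s \<le> t" "t \<le> T"
      and *: "\<And>r. s < r \<Longrightarrow> r \<le> t \<Longrightarrow> B + \<delta> < D r"
    have "y t (i, k) - z t (i, k) \<le> y s (i, k) - z s (i, k)"
    proof (rule reflectedD(3)[OF R ik st(1,2)])
      fix r assume r: "1 < i" "s < r" "r \<le> t"
      with reflectedD(1)[OF R' ik, of r] prev[of r "i - 1"] lower * [of r] st m
      show "y r (i - 1, k - 1) < y r (i, k)" unfolding D_def by fastforce
    qed
    moreover have "y' s (i, k) - z' s (i, k) \<le> y' t (i, k) - z' t (i, k)"
    proof (rule reflectedD(4)[OF R' ik st(1,2)])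
      fix r assume r: "i < k" "s < r" "r \<le> t"
      have "\<bar>y r (i, k - 1) - y' r (i, k - 1)\<bar> \<le> B" using r st by (intro prev upper) auto
      moreover have "y r (i, k) \<le> y r (i, k - 1) - m" using reflectedD(2)[OF R ik, of r] r st by auto
      ultimately show "y' r (i, k) < y' r (i, k - 1) - m'"
        using * [of r] r m unfolding D_def by linarith
    qed
    ultimately show "D t \<le> D s + 2 * \<delta>"
      using drive[of s] drive[of t] st unfolding D_def by linarith
  qed (use init B t m in \<open>auto simp: D_def\<close>)
  then show ?thesis by (simp add: D_def)
qed

text \<open>Level 0 carries no entries, so the induction starts with barrier distance 0, and each
  level adds \<open>5 * \<delta>\<close>. The bound is free of \<open>T\<close>, because errors do
  not accumulate in time: every excursion starts afresh.\<close>

lemma reflected_stable: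
  assumes R: "reflected N m z y" and R': "reflected N m' z' y'"
    and m: "0 \<le> m" "m < \<delta>" "0 \<le> m'" "m' < \<delta>"
    and init: "\<And>p. p \<in> tri N \<Longrightarrow> \<bar>y 0 p - y' 0 p\<bar> \<le> \<delta>"
    and drive: "\<And>t p. 0 \<le> t \<Longrightarrow> t \<le> T \<Longrightarrow> p \<in> tri N \<Longrightarrow> \<bar>(z t p - z 0 p) - (z' t p - z' 0 p)\<bar> \<le> \<delta>"
    and t: "0 \<le> t" "t \<le> T" and ik: "(i, k) \<in> tri N"
  shows "\<bar>y t (i, k) - y' t (i, k)\<bar> \<le> 5 * real k * \<delta>"
  using ik t
proof (induction k arbitrary: i t)
  case 0
  then show ?case by (auto simp: tri_def)
next
  case (Suc k)
  have prev: "\<bar>y t (l, Suc k - 1) - y' t (l, Suc k - 1)\<bar> \<le> 5 * real k * \<delta>"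
    if "0 \<le> t" "t \<le> T" "(l, Suc k - 1) \<in> tri N" for l t
    using Suc.IH that by simp
  have "y t (i, Suc k) - y' t (i, Suc k) \<le> 5 * real k * \<delta> + 5 * \<delta>"
    by (rule reflected_step[OF R R' _ m init drive prev, where T = T]) (use Suc.prems m in auto)
  moreover have "y' t (i, Suc k) - y t (i, Suc k) \<le> 5 * real k * \<delta> + 5 * \<delta>"
  proof (rule reflected_step[OF R' R _ m(3,4) m(1,2), where T = T])
    show "\<bar>y' 0 (i, Suc k) - y 0 (i, Suc k)\<bar> \<le> \<delta>"
      using init[OF Suc.prems(1)] by (simp add: abs_minus_commute)
    show "\<bar>(z' t (i, Suc k) - z' 0 (i, Suc k)) - (z t (i, Suc k) - z 0 (i, Suc k))\<bar> \<le> \<delta>"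
      if "0 \<le> t" "t \<le> T" for t
      using drive[OF that Suc.prems(1)] by (subst abs_minus_commute)
    show "\<bar>y' t (l, Suc k - 1) - y t (l, Suc k - 1)\<bar> \<le> 5 * real k * \<delta>"
      if "0 \<le> t" "t \<le> T" "(l, Suc k - 1) \<in> tri N" for l t
      using prev[OF that] by (simp add: abs_minus_commute)
  qed (use Suc.prems m in auto)
  ultimately show ?case by (simp add: algebra_simps abs_le_iff)
qed

text \<open>A time outside \<open>A\<close> is no point of increase, so \<open>L\<close> is constant
  near it by monotonicity; bisection glues these neighbourhoods together. The left end
  \<open>s\<close> may itself lie in \<open>A\<close>.\<close>

lemma no_increase_const:
  assumes L: "regulator_path L" "increases_only_on L A"
    and st: "0 \<le> s" "s \<le> t" and notin: "\<And>r. s < r \<Longrightarrow> r \<le> t \<Longrightarrow> r \<notin> A"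
  shows "L t = L s"
proof (cases "s = t")
  case False
  with st have "s < t" by simp
  have mono: "L u \<le> L v" if "0 \<le> u" "u \<le> v" for u v
    using L(1) that by (auto simp: regulator_path_def mono_on_def)
  have eq: "L t = L u" if u: "s < u" "u \<le> t" for u
    using \<open>u \<le> t\<close>
  proof (rule Bolzano[where P = "\<lambda>a b. s < a \<longrightarrow> b \<le> t \<longrightarrow> L b = L a", THEN mp, THEN mp])
    fix x assume x: "u \<le> x" "x \<le> t"
    then have "x \<notin> A" using u by (intro notin) auto
    moreover have "0 \<le> x" using x u st by linarith
    ultimately obtain \<epsilon> where e: "\<epsilon> > 0" "\<not> L (max 0 (x - \<epsilon>)) < L (x + \<epsilon>)"
      using L(2) unfolding increases_only_on_def by blast
    show "\<exists>d>0. \<forall>a b. a \<le> x \<and> x \<le> b \<and> b - a < d \<longrightarrow> s < a \<longrightarrow> b \<le> t \<longrightarrow> L b = L a"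
    proof (intro exI[of _ \<epsilon>] conjI allI impI)
      fix a b assume ab: "a \<le> x \<and> x \<le> b \<and> b - a < \<epsilon>" "s < a" "b \<le> t"
      have "L b \<le> L (x + \<epsilon>)" using ab st by (intro mono) auto
      moreover have "L (max 0 (x - \<epsilon>)) \<le> L a" using ab st by (intro mono) auto
      moreover have "L a \<le> L b" using ab st by (intro mono) auto
      ultimately show "L b = L a" using e(2) by linarith
    qed (rule e(1))
  qed (use u in auto)
  \<comment> \<open>So far \<open>L\<close> is constant on the half-open interval after
    \<open>s\<close>; continuity from the right adds \<open>s\<close>.\<close>
  have "continuous_on {0..} L" using L by (simp add: regulator_path_def)
  then have "(L \<longlongrightarrow> L s) (at s within {0..})" using st by (auto simp: continuous_on)
  then have "(L \<longlongrightarrow> L s) (at_right s)"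
    by (rule tendsto_within_subset) (use st in auto)
  moreover have "(L \<longlongrightarrow> L t) (at_right s)"
  proof (rule tendsto_eventually)
    show "\<forall>\<^sub>F u in at_right s. L u = L t"
      using eventually_at_right_real[OF \<open>s < t\<close>] by eventually_elim (use eq in auto)
  qed
  ultimately show ?thesis
    using tendsto_unique[OF trivial_limit_at_right_real, of L "L s" s "L t"] by simp
qed simp

text \<open>Away from one barrier the corresponding regulator is constant, so there
  \<open>Y - B\<close> changes only through the other, monotone regulator. The gap is 0, as
  continuous paths may touch both barriers.\<close>

lemma reflected_continuous:
  fixes Y :: "real \<Rightarrow> nat \<times> nat \<Rightarrow> real"
  assumes GT: "\<And>t. 0 \<le> t \<Longrightarrow> Y t \<in> GTc N"
    and cont: "\<And>p. p \<in> tri N \<Longrightarrow> continuous_on {0..} (\<lambda>t. Y t p)"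
    and reg: "\<And>p. p \<in> tri N \<Longrightarrow> regulator_path (\<lambda>t. Lm t p)" "\<And>p. p \<in> tri N \<Longrightarrow> regulator_path (\<lambda>t. Lp t p)"
    and eq: "\<And>p t. p \<in> tri N \<Longrightarrow> 0 \<le> t \<Longrightarrow> Y t p = Y 0 p + B t p + Lm t p - Lp t p"
    and Lm: "\<And>i k. (i, k) \<in> tri N \<Longrightarrow> if i > 1
               then increases_only_on (\<lambda>t. Lm t (i, k)) {t. Y t (i, k) = Y t (i - 1, k - 1)}
               else \<forall>t\<ge>0. Lm t (i, k) = 0"
    and Lp: "\<And>i k. (i, k) \<in> tri N \<Longrightarrow> if i < k
               then increases_only_on (\<lambda>t. Lp t (i, k)) {t. Y t (i, k) = Y t (i, k - 1)}
               else \<forall>t\<ge>0. Lp t (i, k) = 0"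
  shows "reflected N 0 B Y"
  unfolding reflected_def
proof (intro allI impI conjI)
  fix i k assume ik: "(i, k) \<in> tri N"
  then have kN: "k \<le> N" "i \<le> k" "1 \<le> i" by (auto simp: tri_def)
  {
    fix t :: real assume t: "0 \<le> t"
    show "Y t (i - 1, k - 1) \<le> Y t (i, k)" if "1 < i"
      using GT[OF t] kN that by (auto simp: GTc_def)
    show "Y t (i, k) \<le> Y t (i, k - 1) - 0" if "i < k"
      using GT[OF t] kN that unfolding GTc_def mem_Collect_eq by (elim allE[of _ "Suc i"] allE[of _ k]) auto
  }
  have mono: "Lm s (i, k) \<le> Lm t (i, k)" "Lp s (i, k) \<le> Lp t (i, k)" if "0 \<le> s" "s \<le> t" for s t
    using reg[OF ik] that by (auto simp: regulator_path_def mono_on_def)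
  {
    fix s t assume st: "0 \<le> s \<and> s \<le> t \<and> (1 < i \<longrightarrow> (\<forall>r\<in>{s<..t}. Y r (i - 1, k - 1) < Y r (i, k)))"
    have "Lm t (i, k) = Lm s (i, k)"
    proof (cases "1 < i")
      case True
      then show ?thesis
        using st Lm[OF ik] by (intro no_increase_const[OF reg(1)[OF ik]]) force+
    qed (use st Lm[OF ik] in auto)
    then show "Y t (i, k) - B t (i, k) \<le> Y s (i, k) - B s (i, k)"
      using eq[OF ik, of s] eq[OF ik, of t] mono[of s t] st by auto
  }
  {
    fix s t assume st: "0 \<le> s \<and> s \<le> t \<and> (i < k \<longrightarrow> (\<forall>r\<in>{s<..t}. Y r (i, k) < Y r (i, k - 1) - 0))"
    have "Lp t (i, k) = Lp s (i, k)"
    proof (cases "i < k")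
      case True
      then show ?thesis
        using st Lp[OF ik] by (intro no_increase_const[OF reg(2)[OF ik]]) force+
    qed (use st Lp[OF ik] in auto)
    then show "Y s (i, k) - B s (i, k) \<le> Y t (i, k) - B t (i, k)"
      using eq[OF ik, of s] eq[OF ik, of t] mono[of s t] st by auto
  }
  fix s \<eta> :: real assume s: "0 < s" "0 < \<eta>"
  then obtain d where "d > 0" "\<And>r. r \<in> {0..} \<Longrightarrow> dist r s < d \<Longrightarrow> dist (Y r (i, k)) (Y s (i, k)) < \<eta>"
    using cont[OF ik] unfolding continuous_on_iff by (metis atLeast_iff less_imp_le)
  then show "\<exists>\<epsilon>>0. \<forall>r. 0 \<le> r \<and> s - \<epsilon> < r \<and> r < s \<longrightarrow> \<bar>Y s (i, k) - Y r (i, k)\<bar> \<le> \<eta>"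
    by (intro exI[of _ d]) (fastforce simp: dist_real_def abs_minus_commute)
qed

section \<open>Interlacing dynamics as reflected paths\<close>

text \<open>The update rule detached from its recursion: \<open>A\<close> and \<open>B\<close> say
  which barriers exist, \<open>l\<close> and \<open>u\<close> are their old positions,
  \<open>lo\<close> and \<open>up\<close> the new ones. What remains is a finite case analysis in
  integer arithmetic.\<close>

lemma update_rule_bounds:
  fixes lo up l u old d :: int
  assumes new: "new = (if A \<and> old = lo - 1 then old + 1
         else if B \<and> old = up then old - 1
         else if d = 1 then (if B \<and> up = old + 1 then old else old + 1)
         else if d = - 1 then (if A \<and> lo = old then old else old - 1)
         else old)"
    and lo: "A \<Longrightarrow> \<bar>lo - l\<bar> \<le> 1" "A \<Longrightarrow> l \<le> old" and up: "B \<Longrightarrow> \<bar>up - u\<bar> \<le> 1" "B \<Longrightarrow> old < u"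
    and lo_up: "A \<Longrightarrow> B \<Longrightarrow> lo < up" and d: "\<bar>d\<bar> \<le> 1"
  shows "\<bar>new - old\<bar> \<le> 1 \<and> (A \<longrightarrow> lo \<le> new) \<and> (B \<longrightarrow> new < up) \<and>
    (d < new - old \<longrightarrow> A \<and> new = lo) \<and> (new - old < d \<longrightarrow> B \<and> new = up - 1)"
proof -
  have d': "d = 1 \<or> d = -1 \<or> d = 0" using d by linarith
  show ?thesis
  proof (cases A; cases B)
    assume "A" "B"
    then show ?thesis using lo up lo_up d' unfolding new by (smt (z3))
  next
    assume "A" "\<not> B"
    then show ?thesis using lo d' unfolding new by (smt (z3))
  next
    assume "\<not> A" "B"
    then show ?thesis using up d' unfolding new by (smt (z3))
  next
    assume "\<not> A" "\<not> B"
    then show ?thesis using d' unfolding new by (smt (z3))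
  qed
qed

text \<open>The last two clauses are the discrete Skorokhod condition: a push or a block makes the
  state deviate upwards from the driver only if it ends on the lower barrier, and downwards only if
  it ends just below the upper one.\<close>

lemma interlacing_update_step:
  assumes y: "y \<in> GT N" and d: "\<And>p. p \<in> tri N \<Longrightarrow> \<bar>d p\<bar> \<le> 1" and "(i, k) \<in> tri N"
  shows "\<bar>interlacing_update y d (i, k) - y (i, k)\<bar> \<le> 1 \<and>
    (1 < i \<longrightarrow> interlacing_update y d (i - 1, k - 1) \<le> interlacing_update y d (i, k)) \<and>
    (i < k \<longrightarrow> interlacing_update y d (i, k) < interlacing_update y d (i, k - 1)) \<and>
    (d (i, k) < interlacing_update y d (i, k) - y (i, k) \<longrightarrow>
       1 < i \<and> interlacing_update y d (i, k) = interlacing_update y d (i - 1, k - 1)) \<and>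
    (interlacing_update y d (i, k) - y (i, k) < d (i, k) \<longrightarrow>
       i < k \<and> interlacing_update y d (i, k) = interlacing_update y d (i, k - 1) - 1)"
  using \<open>(i, k) \<in> tri N\<close>
proof (induction k arbitrary: i)
  case 0
  then show ?case by (auto simp: tri_def)
next
  case (Suc m)
  show ?case
  proof (cases m)
    case 0
    then show ?thesis using Suc.prems d[OF Suc.prems] by (auto simp: tri_def)
  next
    case (Suc l)
    define lo where "lo = interlacing_update y d (i - 1, m)"
    define up where "up = interlacing_update y d (i, m)"
    have ik: "1 \<le> i" "i \<le> Suc m" "Suc m \<le> N" using Suc.prems by (auto simp: tri_def)
    have new: "interlacing_update y d (i, Suc m) =
        (if i > 1 \<and> y (i, Suc m) = lo - 1 then y (i, Suc m) + 1
         else if i < Suc m \<and> y (i, Suc m) = up then y (i, Suc m) - 1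
         else if d (i, Suc m) = 1 then (if i < Suc m \<and> up = y (i, Suc m) + 1 then y (i, Suc m) else y (i, Suc m) + 1)
         else if d (i, Suc m) = - 1 then (if i > 1 \<and> lo = y (i, Suc m) then y (i, Suc m) else y (i, Suc m) - 1)
         else y (i, Suc m))"
      using Suc by (simp add: Let_def lo_def up_def)
    have lo: "\<bar>lo - y (i - 1, m)\<bar> \<le> 1" "y (i - 1, m) \<le> y (i, Suc m)" if "1 < i"
    proof -
      have "(i - 1, m) \<in> tri N" using ik that by (auto simp: tri_def)
      from Suc.IH[OF this] show "\<bar>lo - y (i - 1, m)\<bar> \<le> 1" by (simp add: lo_def)
      show "y (i - 1, m) \<le> y (i, Suc m)"
        using y ik that unfolding GT_def mem_Collect_eq by (elim allE[of _ i] allE[of _ "Suc m"]) auto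
    qed
    have up: "\<bar>up - y (i, m)\<bar> \<le> 1" "y (i, Suc m) < y (i, m)" if "i < Suc m"
    proof -
      have "(i, m) \<in> tri N" using ik that by (auto simp: tri_def)
      from Suc.IH[OF this] show "\<bar>up - y (i, m)\<bar> \<le> 1" by (simp add: up_def)
      show "y (i, Suc m) < y (i, m)"
        using y ik that unfolding GT_def mem_Collect_eq by (elim allE[of _ "Suc i"] allE[of _ "Suc m"]) auto
    qed
    \<comment> \<open>Both neighbours have already moved, so their old order says too little. Their
      new positions are separated by the new position of the particle between them two levels down,
      by induction.\<close>
    have lo_up: "lo < up" if "1 < i" "i < Suc m"
    proof -
      have "(i - 1, m) \<in> tri N" "(i, m) \<in> tri N" using ik that by (auto simp: tri_def)
      from Suc.IH[OF this(1)] Suc.IH[OF this(2)]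
      have "i - 1 < m \<longrightarrow> interlacing_update y d (i - 1, m) < interlacing_update y d (i - 1, m - 1)"
        "1 < i \<longrightarrow> interlacing_update y d (i - 1, m - 1) \<le> interlacing_update y d (i, m)"
        by blast+
      then show ?thesis using that unfolding lo_def up_def by linarith
    qed
    show ?thesis
      unfolding diff_Suc_1 lo_def[symmetric] up_def[symmetric]
      by (rule update_rule_bounds[OF new]) (use lo up lo_up d[OF Suc.prems] in auto)
  qed
qed

lemma interlacing_update_GT:
  assumes "y \<in> GT N" "\<And>p. p \<in> tri N \<Longrightarrow> \<bar>d p\<bar> \<le> 1"
  shows "interlacing_update y d \<in> GT N"
  unfolding GT_def
proof (intro CollectI allI impI)
  fix i j assume ij: "2 \<le> i \<and> i \<le> j \<and> j \<le> N"
  then have "(i - 1, j) \<in> tri N" "(i, j) \<in> tri N" by (auto simp: tri_def)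
  from interlacing_update_step[OF assms this(1)] interlacing_update_step[OF assms this(2)] ij
  show "interlacing_update y d (i - 1, j) < interlacing_update y d (i - 1, j - 1) \<and>
    interlacing_update y d (i - 1, j - 1) \<le> interlacing_update y d (i, j)"
    by (auto simp: less_eq_Suc_le)
qed

text \<open>The recursion also evaluates neighbours outside the triangle at the two ends of a level;
  the guards \<open>i > 1\<close> and \<open>i < k\<close> discard those values.\<close>

lemma interlacing_update_cong:
  assumes "\<And>p. p \<in> tri N \<Longrightarrow> y p = y' p" "\<And>p. p \<in> tri N \<Longrightarrow> d p = d' p" "(i, k) \<in> tri N"
  shows "interlacing_update y d (i, k) = interlacing_update y' d' (i, k)"
  using assms(3)
proof (induction k arbitrary: i)
  case 0
  then show ?case by (auto simp: tri_def)
next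
  case (Suc m)
  show ?case
  proof (cases m)
    case 0
    then show ?thesis using Suc.prems assms by (auto simp: tri_def)
  next
    case (Suc l)
    have "(i - 1, m) \<in> tri N" if "1 < i" using Suc.prems that by (auto simp: tri_def)
    with Suc.IH have lo: "1 < i \<Longrightarrow> interlacing_update y d (i - 1, m) = interlacing_update y' d' (i - 1, m)"
      by blast
    have "(i, m) \<in> tri N" if "i < Suc m" using Suc.prems that by (auto simp: tri_def)
    with Suc.IH have up: "i < Suc m \<Longrightarrow> interlacing_update y d (i, m) = interlacing_update y' d' (i, m)"
      by blast
    show ?thesis
      using lo up assms(1)[OF Suc.prems] assms(2)[OF Suc.prems] unfolding Suc
      by (cases "1 < i"; cases "i < Suc (Suc l)") (simp_all add: Let_def)
  qed
qed

text \<open>Interlacing of \<open>y\<close> excludes both push conditions, so nothing moves without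
  a driving increment. Hence an interval without jumps can be read as one update with increment
  zero.\<close>

lemma interlacing_update_0:
  assumes "y \<in> GT N" "\<And>p. p \<in> tri N \<Longrightarrow> d p = 0" "(i, k) \<in> tri N"
  shows "interlacing_update y d (i, k) = y (i, k)"
  using assms(3)
proof (induction k arbitrary: i)
  case 0
  then show ?case by (auto simp: tri_def)
next
  case (Suc m)
  show ?case
  proof (cases m)
    case 0
    then show ?thesis using Suc.prems assms by (auto simp: tri_def)
  next
    case (Suc l)
    have ik: "1 \<le> i" "i \<le> Suc m" "Suc m \<le> N" using Suc.prems by (auto simp: tri_def)
    have "interlacing_update y d (i - 1, m) \<le> y (i, Suc m)" if "1 < i"
    proof -
      have "(i - 1, m) \<in> tri N" using ik that by (auto simp: tri_def)
      moreover have "y (i - 1, m) \<le> y (i, Suc m)"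
        using assms(1) ik that unfolding GT_def mem_Collect_eq by (elim allE[of _ i] allE[of _ "Suc m"]) auto
      ultimately show ?thesis using Suc.IH by simp
    qed
    moreover have "y (i, Suc m) < interlacing_update y d (i, m)" if "i < Suc m"
    proof -
      have "(i, m) \<in> tri N" using ik that by (auto simp: tri_def)
      moreover have "y (i, Suc m) < y (i, m)"
        using assms(1) ik that unfolding GT_def mem_Collect_eq by (elim allE[of _ "Suc i"] allE[of _ "Suc m"]) auto
      ultimately show ?thesis using Suc.IH by simp
    qed
    ultimately show ?thesis
      using assms(2)[OF Suc.prems] unfolding Suc by (auto simp: Let_def)
  qed
qed

section \<open>Integer-valued cadlag paths and the local structure of the dynamics\<close>

lemma cadlag_int_right:
  fixes f :: "real \<Rightarrow> int"
  assumes "cadlag f" "0 \<le> t"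
  shows "\<exists>\<epsilon>>0. \<forall>s. t \<le> s \<and> s < t + \<epsilon> \<longrightarrow> f s = f t"
proof -
  have "(f \<longlongrightarrow> f t) (at_right t)" using assms by (auto simp: cadlag_def)
  then have "\<forall>\<^sub>F s in at_right t. f s = f t" by (simp add: tendsto_discrete)
  then obtain b where "b > t" "\<And>s. t < s \<Longrightarrow> s < b \<Longrightarrow> f s = f t"
    unfolding eventually_at_right_field by blast
  then show ?thesis by (intro exI[of _ "b - t"]) (force simp: le_less)
qed

lemma cadlag_int_left:
  fixes f :: "real \<Rightarrow> int"
  assumes "cadlag f" "0 < t"
  shows "\<exists>\<epsilon>>0. \<forall>s. t - \<epsilon> < s \<and> s < t \<longrightarrow> f s = left_lim f t"
proof -
  obtain l where "(f \<longlongrightarrow> l) (at_left t)" using assms by (auto simp: cadlag_def)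
  moreover from this have "left_lim f t = l" unfolding left_lim_def by (intro tendsto_Lim) auto
  ultimately have "\<forall>\<^sub>F s in at_left t. f s = left_lim f t" by (simp add: tendsto_discrete)
  then obtain b where "b < t" "\<And>s. b < s \<Longrightarrow> s < t \<Longrightarrow> f s = left_lim f t"
    unfolding eventually_at_left_field by blast
  then show ?thesis by (intro exI[of _ "t - b"]) auto
qed

lemma left_lim_eqI:
  assumes "\<epsilon> > 0" "\<And>s. t - \<epsilon> < s \<Longrightarrow> s < t \<Longrightarrow> f s = c"
  shows "left_lim f t = c"
proof -
  have "\<forall>\<^sub>F s in at_left t. f s = c"
    unfolding eventually_at_left_field using assms by (intro exI[of _ "t - \<epsilon>"]) auto
  then have "(f \<longlongrightarrow> c) (at_left t)" by (rule tendsto_eventually)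
  then show ?thesis unfolding left_lim_def by (intro tendsto_Lim) auto
qed

lemma finite_tri: "finite (tri N)"
  by (rule finite_subset[of _ "{..N} \<times> {..N}"]) (auto simp: tri_def)

lemma uniform_radius:
  assumes "finite S" "\<And>p. p \<in> S \<Longrightarrow> \<exists>\<epsilon>>0::real. \<forall>s. Q s \<epsilon> \<longrightarrow> P p s"
    and "\<And>s \<epsilon> \<epsilon>'. Q s \<epsilon> \<Longrightarrow> \<epsilon> \<le> \<epsilon>' \<Longrightarrow> Q s \<epsilon>'"
  shows "\<exists>\<epsilon>>0. \<forall>s. Q s \<epsilon> \<longrightarrow> (\<forall>p\<in>S. P p s)"
  using assms(1,2)
proof (induction S)
  case empty
  show ?case by (auto intro: exI[of _ "1::real"])
next
  case (insert p S)
  obtain e where e: "e > 0" "\<forall>s. Q s e \<longrightarrow> (\<forall>p\<in>S. P p s)" using insert by force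
  obtain e' where e': "e' > 0" "\<forall>s. Q s e' \<longrightarrow> P p s" using insert.prems by blast
  have "Q s e \<and> Q s e'" if "Q s (min e e')" for s
    using assms(3)[OF that] by simp
  then show ?case using e e' by (intro exI[of _ "min e e'"]) auto
qed

locale unit_step_dynamics =
  fixes N :: nat and x y :: "real \<Rightarrow> nat \<times> nat \<Rightarrow> int"
  assumes x_cadlag: "\<And>p. p \<in> tri N \<Longrightarrow> cadlag (\<lambda>t. x t p)"
    and x_steps: "\<And>p t. p \<in> tri N \<Longrightarrow> 0 < t \<Longrightarrow> \<bar>x t p - left_lim (\<lambda>s. x s p) t\<bar> \<le> 1"
    and dyn: "interlacing_dynamics N x y"
begin

lemma y_const:
  assumes "is_interval J" "J \<subseteq> {0..}" "\<And>p s t. p \<in> tri N \<Longrightarrow> s \<in> J \<Longrightarrow> t \<in> J \<Longrightarrow> x s p = x t p"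
    and "p \<in> tri N" "s \<in> J" "t \<in> J"
  shows "y s p = y t p"
proof -
  have "\<forall>p\<in>tri N. (\<lambda>t. x t p) constant_on J"
    using assms(3,5) unfolding constant_on_def by blast
  then have "(\<lambda>t. y t p) constant_on J"
    using dyn assms(1,2,4) unfolding interlacing_dynamics_def by blast
  then show ?thesis using assms(5,6) by (auto simp: constant_on_def)
qed

lemma y_const_of:
  assumes "is_interval J" "J \<subseteq> {0..}" "\<And>p s. p \<in> tri N \<Longrightarrow> s \<in> J \<Longrightarrow> x s p = c p"
    and "p \<in> tri N" "s \<in> J" "t \<in> J"
  shows "y s p = y t p"
  by (rule y_const[OF assms(1,2) _ assms(4-6)]) (metis assms(3))

lemma y_0: "y 0 \<in> GT N"
  using dyn by (simp add: interlacing_dynamics_def)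

lemma y_jump:
  assumes "0 < t" "q \<in> tri N" "x t q \<noteq> left_lim (\<lambda>s. x s q) t" "p \<in> tri N"
  shows "y t p = interlacing_update (\<lambda>q. left_lim (\<lambda>s. y s q) t) (\<lambda>q. x t q - left_lim (\<lambda>s. x s q) t) p"
  using dyn assms unfolding interlacing_dynamics_def by blast

text \<open>The integer driver is constant just before \<open>\<tau>\<close> and from
  \<open>\<tau>\<close> on for a while, hence so is \<open>y\<close>; two times near
  \<open>\<tau>\<close> are separated by at most the one jump at \<open>\<tau>\<close>. The
  jump-free case is kept apart, because reading it as an update with zero increments requires
  \<open>y u \<in> GT N\<close>, which is itself derived from this lemma.\<close>

lemma local_step_weak:
  assumes "0 \<le> \<tau>"
  shows "\<exists>\<epsilon>>0. \<forall>u v. 0 \<le> u \<and> u \<le> v \<and> \<tau> - \<epsilon> < u \<and> v < \<tau> + \<epsilon> \<longrightarrow>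
    (\<forall>p\<in>tri N. x v p = x u p \<and> y v p = y u p) \<or>
    (\<forall>p\<in>tri N. y v p = interlacing_update (y u) (\<lambda>q. x v q - x u q) p \<and> \<bar>x v p - x u p\<bar> \<le> 1)"
proof -
  have "\<exists>\<epsilon>>0. \<forall>s. (\<tau> \<le> s \<and> s < \<tau> + \<epsilon>) \<longrightarrow> (\<forall>p\<in>tri N. x s p = x \<tau> p)"
    by (rule uniform_radius[OF finite_tri]) (use cadlag_int_right[OF x_cadlag assms] in auto)
  then obtain e where e: "e > 0" "\<And>s p. \<tau> \<le> s \<Longrightarrow> s < \<tau> + e \<Longrightarrow> p \<in> tri N \<Longrightarrow> x s p = x \<tau> p"
    by blast
  have yr: "y s p = y \<tau> p" if "\<tau> \<le> s" "s < \<tau> + e" "p \<in> tri N" for s p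
    by (rule y_const_of[of "{\<tau>..<\<tau> + e}" "x \<tau>"])
      (use that assms e(1) in \<open>auto simp: is_interval_co intro: e(2)\<close>)
  show ?thesis
  proof (cases "\<tau> = 0")
    case True
    have "x v p = x u p \<and> y v p = y u p" if "0 \<le> u" "u \<le> v" "v < \<tau> + e" "p \<in> tri N" for u v p
      using that True e(2)[of u p] e(2)[of v p] yr[of u p] yr[of v p] by auto
    then show ?thesis using e(1) by (intro exI[of _ e]) auto
  next
    case False
    with assms have pos: "0 < \<tau>" by simp
    define X where "X p = left_lim (\<lambda>s. x s p) \<tau>" for p
    have "\<exists>\<epsilon>>0. \<forall>s. (\<tau> - \<epsilon> < s \<and> s < \<tau>) \<longrightarrow> (\<forall>p\<in>tri N. x s p = X p)"
      unfolding X_def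
      by (rule uniform_radius[OF finite_tri]) (use cadlag_int_left[OF x_cadlag pos] in auto)
    then obtain f' where f': "f' > 0" "\<And>s p. \<tau> - f' < s \<Longrightarrow> s < \<tau> \<Longrightarrow> p \<in> tri N \<Longrightarrow> x s p = X p"
      by blast
    \<comment> \<open>Halving \<open>\<tau>\<close> keeps the left neighbourhood inside the positive
      times, where the constancy clause of the dynamics applies.\<close>
    define f where "f = min f' (\<tau> / 2)"
    have f: "f > 0" "f < \<tau>" "\<And>s p. \<tau> - f < s \<Longrightarrow> s < \<tau> \<Longrightarrow> p \<in> tri N \<Longrightarrow> x s p = X p"
      using f' pos by (auto simp: f_def)
    define Y where "Y p = y (\<tau> - f / 2) p" for p
    have yl: "y s p = Y p" if "\<tau> - f < s" "s < \<tau>" "p \<in> tri N" for s p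
      unfolding Y_def
      by (rule y_const_of[of "{\<tau> - f<..<\<tau>}" X]) (use that f(1,2) in \<open>auto simp: is_interval_oo intro: f(3)\<close>)
    have Ylim: "left_lim (\<lambda>s. y s p) \<tau> = Y p" if "p \<in> tri N" for p
      by (rule left_lim_eqI[OF f(1)]) (use that yl in auto)
    show ?thesis
    proof (intro exI[of _ "min e f"] conjI allI impI)
      fix u v assume uv: "0 \<le> u \<and> u \<le> v \<and> \<tau> - min e f < u \<and> v < \<tau> + min e f"
      show "(\<forall>p\<in>tri N. x v p = x u p \<and> y v p = y u p) \<or>
        (\<forall>p\<in>tri N. y v p = interlacing_update (y u) (\<lambda>q. x v q - x u q) p \<and> \<bar>x v p - x u p\<bar> \<le> 1)"
      proof (cases "\<tau> \<le> u \<or> v < \<tau>")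
        case True
        then show ?thesis using uv e(2) yr f(3) yl by (smt (verit))
      next
        case False
        have xu: "x u p = X p" "y u p = Y p" and xv: "x v p = x \<tau> p" "y v p = y \<tau> p" if "p \<in> tri N" for p
          using False uv that e(2)[of v p] yr[of v p] f(3)[of u p] yl[of u p] by auto
        show ?thesis
        proof (cases "\<forall>p\<in>tri N. x \<tau> p = X p")
          case True
          \<comment> \<open>If the driver does not jump at \<open>\<tau>\<close>, the update clause
            says nothing; instead the driver is constant across \<open>\<tau>\<close> and the
            constancy clause transfers this to \<open>y\<close>.\<close>
          have c: "x s p = X p" if "\<tau> - f < s" "s < \<tau> + e" "p \<in> tri N" for s p
            using f(3)[of s p] e(2)[of s p] that True by (cases "s < \<tau>") auto
          have "y v p = y u p" if "p \<in> tri N" for p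
          proof (rule y_const[of "{\<tau> - f<..<\<tau> + e}"])
            show "x s p = x t p" if "p \<in> tri N" "s \<in> {\<tau> - f<..<\<tau> + e}" "t \<in> {\<tau> - f<..<\<tau> + e}" for p s t
              using c that by simp
          qed (use that uv f in \<open>auto simp: is_interval_oo\<close>)
          then show ?thesis using True xu xv by auto
        next
          case F: False
          then obtain q where "q \<in> tri N" "x \<tau> q \<noteq> X q" by blast
          then have jump: "y \<tau> p = interlacing_update (\<lambda>q. left_lim (\<lambda>s. y s q) \<tau>) (\<lambda>q. x \<tau> q - X q) p"
            if "p \<in> tri N" for p using y_jump[OF pos, of q p] that by (simp add: X_def)
          have "y v p = interlacing_update (y u) (\<lambda>q. x v q - x u q) p \<and> \<bar>x v p - x u p\<bar> \<le> 1"
            if p: "p \<in> tri N" for p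
          proof
            obtain i k where ik: "p = (i, k)" by (cases p)
            show "y v p = interlacing_update (y u) (\<lambda>q. x v q - x u q) p"
              unfolding xv(2)[OF p] jump[OF p] unfolding ik
              by (rule interlacing_update_cong) (use p ik in \<open>auto simp: xu xv Ylim\<close>)
            show "\<bar>x v p - x u p\<bar> \<le> 1" using x_steps[OF p pos] by (simp add: xu xv p X_def)
          qed
          then show ?thesis by blast
        qed
      qed
    qed (use e f in auto)
  qed
qed

text \<open>Each local step preserves interlacing, and bisection propagates this from time 0. The
  local description determines \<open>y\<close> on the triangle only, which is all that
  \<open>GT N\<close> reads; \<open>cong\<close> records this.\<close>

lemma y_GT:
  assumes "0 \<le> t"
  shows "y t \<in> GT N"
proof -
  have cong: "v \<in> GT N" if "u \<in> GT N" "\<And>p. p \<in> tri N \<Longrightarrow> v p = u p" for u v :: "nat \<times> nat \<Rightarrow> int"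
    unfolding GT_def
  proof (intro CollectI allI impI)
    fix i j assume ij: "2 \<le> i \<and> i \<le> j \<and> j \<le> N"
    then have "(i - 1, j) \<in> tri N" "(i, j) \<in> tri N" "(i - 1, j - 1) \<in> tri N" by (auto simp: tri_def)
    then show "v (i - 1, j) < v (i - 1, j - 1) \<and> v (i - 1, j - 1) \<le> v (i, j)"
      using that ij by (auto simp: GT_def)
  qed
  have loc: "\<exists>d>0. \<forall>u v. u \<le> \<tau> \<and> \<tau> \<le> v \<and> v - u < d \<longrightarrow> 0 \<le> u \<longrightarrow> y u \<in> GT N \<longrightarrow> y v \<in> GT N"
    if \<tau>: "0 \<le> \<tau>" for \<tau>
  proof -
    obtain e where e: "e > 0" "\<And>u v. 0 \<le> u \<Longrightarrow> u \<le> v \<Longrightarrow> \<tau> - e < u \<Longrightarrow> v < \<tau> + e \<Longrightarrow>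
      (\<forall>p\<in>tri N. x v p = x u p \<and> y v p = y u p) \<or>
      (\<forall>p\<in>tri N. y v p = interlacing_update (y u) (\<lambda>q. x v q - x u q) p \<and> \<bar>x v p - x u p\<bar> \<le> 1)"
      using local_step_weak[OF \<tau>] by blast
    have "y v \<in> GT N" if "0 \<le> u" "u \<le> v" "\<tau> - e < u" "v < \<tau> + e" "y u \<in> GT N" for u v
      using e(2)[OF that(1-4)]
    proof
      assume "\<forall>p\<in>tri N. x v p = x u p \<and> y v p = y u p"
      then show ?thesis using cong[OF that(5)] by blast
    next
      assume *: "\<forall>p\<in>tri N. y v p = interlacing_update (y u) (\<lambda>q. x v q - x u q) p \<and> \<bar>x v p - x u p\<bar> \<le> 1"
      then have "interlacing_update (y u) (\<lambda>q. x v q - x u q) \<in> GT N"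
        by (intro interlacing_update_GT that) auto
      from cong[OF this] * show ?thesis by blast
    qed
    then show ?thesis using e(1) by (intro exI[of _ e]) auto
  qed
  show ?thesis
  proof (rule Bolzano[where P = "\<lambda>u v. 0 \<le> u \<longrightarrow> y u \<in> GT N \<longrightarrow> y v \<in> GT N", THEN mp, THEN mp, OF assms])
    show "0 \<le> u \<longrightarrow> y u \<in> GT N \<longrightarrow> y w \<in> GT N"
      if "0 \<le> u \<longrightarrow> y u \<in> GT N \<longrightarrow> y v \<in> GT N" "0 \<le> v \<longrightarrow> y v \<in> GT N \<longrightarrow> y w \<in> GT N" "u \<le> v" for u v w
      using that by auto
  qed (use loc y_0 in auto)
qed

text \<open>With interlacing known at all times, both alternatives of the weak form merge into a
  single update.\<close>

lemma local_step:
  assumes "0 \<le> \<tau>"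
  shows "\<exists>\<epsilon>>0. \<forall>u v. 0 \<le> u \<and> u \<le> v \<and> \<tau> - \<epsilon> < u \<and> v < \<tau> + \<epsilon> \<longrightarrow>
    (\<forall>p\<in>tri N. y v p = interlacing_update (y u) (\<lambda>q. x v q - x u q) p \<and> \<bar>x v p - x u p\<bar> \<le> 1)"
proof -
  obtain e where e: "e > 0" "\<And>u v. 0 \<le> u \<Longrightarrow> u \<le> v \<Longrightarrow> \<tau> - e < u \<Longrightarrow> v < \<tau> + e \<Longrightarrow>
    (\<forall>p\<in>tri N. x v p = x u p \<and> y v p = y u p) \<or>
    (\<forall>p\<in>tri N. y v p = interlacing_update (y u) (\<lambda>q. x v q - x u q) p \<and> \<bar>x v p - x u p\<bar> \<le> 1)"
    using local_step_weak[OF assms] by blast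
  have "y v p = interlacing_update (y u) (\<lambda>q. x v q - x u q) p \<and> \<bar>x v p - x u p\<bar> \<le> 1"
    if "0 \<le> u" "u \<le> v" "\<tau> - e < u" "v < \<tau> + e" "p \<in> tri N" for u v p
    using e(2)[OF that(1-4)]
  proof
    assume *: "\<forall>p\<in>tri N. x v p = x u p \<and> y v p = y u p"
    obtain i k where ik: "p = (i, k)" by (cases p)
    have "interlacing_update (y u) (\<lambda>q. x v q - x u q) (i, k) = y u (i, k)"
      by (rule interlacing_update_0[OF y_GT[OF that(1)]]) (use * that(5) ik in auto)
    with * that(5) ik show ?thesis by auto
  qed (use that(5) in blast)
  then show ?thesis using e(1) by blast
qed

text \<open>A Lebesgue number of the cover of \<open>{0..T}\<close> by the local neighbourhoods. It
  allows the dynamics to be run along any sufficiently fine deterministic grid, wherever the jumps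
  may be.\<close>

lemma uniform_step:
  shows "\<exists>\<delta>>0. \<forall>u v. 0 \<le> u \<and> u \<le> v \<and> v \<le> T \<and> v - u < \<delta> \<longrightarrow>
    (\<forall>p\<in>tri N. y v p = interlacing_update (y u) (\<lambda>q. x v q - x u q) p)"
proof -
  define P where "P \<tau> \<epsilon> \<longleftrightarrow> \<epsilon> > 0 \<and> (\<forall>u v. 0 \<le> u \<and> u \<le> v \<and> \<tau> - \<epsilon> < u \<and> v < \<tau> + \<epsilon> \<longrightarrow>
    (\<forall>p\<in>tri N. y v p = interlacing_update (y u) (\<lambda>q. x v q - x u q) p \<and> \<bar>x v p - x u p\<bar> \<le> 1))" for \<tau> \<epsilon>
  have "\<forall>\<tau>\<in>{0..}. \<exists>\<epsilon>. P \<tau> \<epsilon>" using local_step by (auto simp: P_def)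
  then obtain e where eP: "\<And>\<tau>. 0 \<le> \<tau> \<Longrightarrow> P \<tau> (e \<tau>)" by (auto dest!: bchoice)
  then have e: "\<And>\<tau>. 0 \<le> \<tau> \<Longrightarrow> e \<tau> > 0" "\<And>\<tau> u v p. 0 \<le> \<tau> \<Longrightarrow> 0 \<le> u \<Longrightarrow> u \<le> v \<Longrightarrow> \<tau> - e \<tau> < u \<Longrightarrow> v < \<tau> + e \<tau> \<Longrightarrow>
    p \<in> tri N \<Longrightarrow> y v p = interlacing_update (y u) (\<lambda>q. x v q - x u q) p"
    unfolding P_def by blast+
  have "{0..T} \<subseteq> \<Union>((\<lambda>\<tau>. ball \<tau> (e \<tau>)) ` {0..T})" using e(1) by fastforce
  then obtain \<delta> where \<delta>: "0 < \<delta>" "\<And>u. u \<in> {0..T} \<Longrightarrow> \<exists>G\<in>(\<lambda>\<tau>. ball \<tau> (e \<tau>)) ` {0..T}. ball u \<delta> \<subseteq> G"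
    by (rule Heine_Borel_lemma[OF compact_Icc]) auto
  show ?thesis
  proof (intro exI[of _ \<delta>] conjI allI impI ballI)
    fix u v p assume uv: "0 \<le> u \<and> u \<le> v \<and> v \<le> T \<and> v - u < \<delta>" and p: "p \<in> tri N"
    then obtain \<tau> where \<tau>: "\<tau> \<in> {0..T}" "ball u \<delta> \<subseteq> ball \<tau> (e \<tau>)" using \<delta>(2)[of u] by auto
    have "u \<in> ball u \<delta>" "v \<in> ball u \<delta>" using uv \<delta>(1) by (auto simp: dist_real_def)
    then have "u \<in> ball \<tau> (e \<tau>)" "v \<in> ball \<tau> (e \<tau>)" using \<tau>(2) by blast+
    then show "y v p = interlacing_update (y u) (\<lambda>q. x v q - x u q) p"
      using uv \<tau>(1) p by (intro e(2)[of \<tau>]) (auto simp: dist_real_def)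
  qed (rule \<delta>(1))
qed

text \<open>The discrete counterpart of a regulator that acts only at its barrier:
  \<open>y - x\<close> can grow only in a step that ends on the lower barrier and fall only in one
  that ends just below the upper barrier. Monotonicity over a long interval follows by
  bisection.\<close>

lemma y_compensator_mono:
  assumes "0 \<le> s" "s \<le> t" "(i, k) \<in> tri N"
  shows "(\<And>r. 1 < i \<Longrightarrow> s < r \<Longrightarrow> r \<le> t \<Longrightarrow> y r (i - 1, k - 1) < y r (i, k)) \<Longrightarrow>
      y t (i, k) - x t (i, k) \<le> y s (i, k) - x s (i, k)"
    and "(\<And>r. i < k \<Longrightarrow> s < r \<Longrightarrow> r \<le> t \<Longrightarrow> y r (i, k) < y r (i, k - 1) - 1) \<Longrightarrow>
      y s (i, k) - x s (i, k) \<le> y t (i, k) - x t (i, k)"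
proof -
  \<comment> \<open>The barrier is inspected at the right end \<open>v\<close> only, since the
    Skorokhod condition of an update concerns the state after it.\<close>
  have loc: "\<exists>d>0. \<forall>u v. 0 \<le> u \<and> u < v \<and> u \<le> \<tau> \<and> \<tau> \<le> v \<and> v - u < d \<longrightarrow>
      ((1 < i \<longrightarrow> y v (i - 1, k - 1) < y v (i, k)) \<longrightarrow> y v (i, k) - x v (i, k) \<le> y u (i, k) - x u (i, k)) \<and>
      ((i < k \<longrightarrow> y v (i, k) < y v (i, k - 1) - 1) \<longrightarrow> y u (i, k) - x u (i, k) \<le> y v (i, k) - x v (i, k))"
    if \<tau>: "0 \<le> \<tau>" for \<tau>
  proof -
    obtain e where e: "e > 0" "\<And>u v p. 0 \<le> u \<Longrightarrow> u \<le> v \<Longrightarrow> \<tau> - e < u \<Longrightarrow> v < \<tau> + e \<Longrightarrow> p \<in> tri N \<Longrightarrow>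
      y v p = interlacing_update (y u) (\<lambda>q. x v q - x u q) p \<and> \<bar>x v p - x u p\<bar> \<le> 1"
      using local_step[OF \<tau>] by blast
    have "((1 < i \<longrightarrow> y v (i - 1, k - 1) < y v (i, k)) \<longrightarrow> y v (i, k) - x v (i, k) \<le> y u (i, k) - x u (i, k)) \<and>
      ((i < k \<longrightarrow> y v (i, k) < y v (i, k - 1) - 1) \<longrightarrow> y u (i, k) - x u (i, k) \<le> y v (i, k) - x v (i, k))"
      if uv: "0 \<le> u" "u < v" "u \<le> \<tau>" "\<tau> \<le> v" "v - u < e" for u v
    proof -
      have st: "y v p = interlacing_update (y u) (\<lambda>q. x v q - x u q) p \<and> \<bar>x v p - x u p\<bar> \<le> 1"
        if "p \<in> tri N" for p using uv that by (intro e(2)) auto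
      have lo: "(i - 1, k - 1) \<in> tri N" if "1 < i" using assms(3) that by (auto simp: tri_def)
      have up: "(i, k - 1) \<in> tri N" if "i < k" using assms(3) that by (auto simp: tri_def)
      have "(x v (i, k) - x u (i, k) < y v (i, k) - y u (i, k) \<longrightarrow> 1 < i \<and> y v (i, k) = y v (i - 1, k - 1)) \<and>
        (y v (i, k) - y u (i, k) < x v (i, k) - x u (i, k) \<longrightarrow> i < k \<and> y v (i, k) = y v (i, k - 1) - 1)"
        using interlacing_update_step[OF y_GT[OF uv(1)], of "\<lambda>q. x v q - x u q", OF _ assms(3)]
          st st[OF assms(3)] st[OF lo] st[OF up] by auto
      then show ?thesis by linarith
    qed
    then show ?thesis using e(1) by blast
  qed
  show "y t (i, k) - x t (i, k) \<le> y s (i, k) - x s (i, k)"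
    if *: "\<And>r. 1 < i \<Longrightarrow> s < r \<Longrightarrow> r \<le> t \<Longrightarrow> y r (i - 1, k - 1) < y r (i, k)"
  proof (rule Bolzano[where P = "\<lambda>u v. s \<le> u \<longrightarrow> v \<le> t \<longrightarrow> y v (i, k) - x v (i, k) \<le> y u (i, k) - x u (i, k)",
        THEN mp, THEN mp, OF assms(2)])
    fix \<tau> assume \<tau>: "s \<le> \<tau>" "\<tau> \<le> t"
    obtain d where d: "d > 0" "\<And>u v. 0 \<le> u \<Longrightarrow> u < v \<Longrightarrow> u \<le> \<tau> \<Longrightarrow> \<tau> \<le> v \<Longrightarrow> v - u < d \<Longrightarrow>
      (1 < i \<longrightarrow> y v (i - 1, k - 1) < y v (i, k)) \<Longrightarrow> y v (i, k) - x v (i, k) \<le> y u (i, k) - x u (i, k)"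
      using loc[of \<tau>] \<tau> assms(1) by auto
    show "\<exists>d>0. \<forall>u v. u \<le> \<tau> \<and> \<tau> \<le> v \<and> v - u < d \<longrightarrow> s \<le> u \<longrightarrow> v \<le> t \<longrightarrow> y v (i, k) - x v (i, k) \<le> y u (i, k) - x u (i, k)"
    proof (intro exI[of _ d] conjI allI impI)
      fix u v assume uv: "u \<le> \<tau> \<and> \<tau> \<le> v \<and> v - u < d" "s \<le> u" "v \<le> t"
      \<comment> \<open>The case of equal times is separate: \<open>v\<close> could then be
        \<open>s\<close>, where no distance from the barrier is assumed.\<close>
      show "y v (i, k) - x v (i, k) \<le> y u (i, k) - x u (i, k)"
      proof (cases "u = v")
        case False
        then show ?thesis using uv assms(1) * [of v] by (intro d(2)) auto
      qed simp
    qed (rule d(1))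
  qed auto
  show "y s (i, k) - x s (i, k) \<le> y t (i, k) - x t (i, k)"
    if *: "\<And>r. i < k \<Longrightarrow> s < r \<Longrightarrow> r \<le> t \<Longrightarrow> y r (i, k) < y r (i, k - 1) - 1"
  proof (rule Bolzano[where P = "\<lambda>u v. s \<le> u \<longrightarrow> v \<le> t \<longrightarrow> y u (i, k) - x u (i, k) \<le> y v (i, k) - x v (i, k)",
        THEN mp, THEN mp, OF assms(2)])
    fix \<tau> assume \<tau>: "s \<le> \<tau>" "\<tau> \<le> t"
    obtain d where d: "d > 0" "\<And>u v. 0 \<le> u \<Longrightarrow> u < v \<Longrightarrow> u \<le> \<tau> \<Longrightarrow> \<tau> \<le> v \<Longrightarrow> v - u < d \<Longrightarrow>
      (i < k \<longrightarrow> y v (i, k) < y v (i, k - 1) - 1) \<Longrightarrow> y u (i, k) - x u (i, k) \<le> y v (i, k) - x v (i, k)"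
      using loc[of \<tau>] \<tau> assms(1) by auto
    show "\<exists>d>0. \<forall>u v. u \<le> \<tau> \<and> \<tau> \<le> v \<and> v - u < d \<longrightarrow> s \<le> u \<longrightarrow> v \<le> t \<longrightarrow> y u (i, k) - x u (i, k) \<le> y v (i, k) - x v (i, k)"
    proof (intro exI[of _ d] conjI allI impI)
      fix u v assume uv: "u \<le> \<tau> \<and> \<tau> \<le> v \<and> v - u < d" "s \<le> u" "v \<le> t"
      show "y u (i, k) - x u (i, k) \<le> y v (i, k) - x v (i, k)"
      proof (cases "u = v")
        case False
        then show ?thesis using uv assms(1) * [of v] by (intro d(2)) auto
      qed simp
    qed (rule d(1))
  qed auto
qed

lemma y_right_const:
  assumes "0 \<le> t" "p \<in> tri N"
  shows "\<exists>\<epsilon>>0. \<forall>s. t \<le> s \<and> s < t + \<epsilon> \<longrightarrow> y s p = y t p"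
proof -
  have "\<exists>\<epsilon>>0. \<forall>s. (t \<le> s \<and> s < t + \<epsilon>) \<longrightarrow> (\<forall>p\<in>tri N. x s p = x t p)"
    by (rule uniform_radius[OF finite_tri]) (use cadlag_int_right[OF x_cadlag assms(1)] in auto)
  then obtain e' where e': "e' > 0" "\<And>s p. t \<le> s \<Longrightarrow> s < t + e' \<Longrightarrow> p \<in> tri N \<Longrightarrow> x s p = x t p"
    by blast
  show ?thesis
  proof (intro exI[of _ "e'"] conjI allI impI)
    fix s assume s: "t \<le> s \<and> s < t + e'"
    show "y s p = y t p"
      by (rule y_const_of[of "{t..<t + e'}" "x t"]) (use s assms e'(1) in \<open>auto simp: is_interval_co intro: e'(2)\<close>)
  qed (rule e')
qed

lemma y_cadlag:
  assumes p: "p \<in> tri N"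
  shows "cadlag (\<lambda>t. y t p)"
  unfolding cadlag_def
proof (intro conjI allI impI)
  fix t :: real assume "0 \<le> t"
  then obtain e where e: "e > 0" "\<And>s. t \<le> s \<Longrightarrow> s < t + e \<Longrightarrow> y s p = y t p"
    using y_right_const p by blast
  have "\<forall>\<^sub>F s in at_right t. y s p = y t p"
    unfolding eventually_at_right_field
  proof (intro exI[of _ "t + e"] conjI allI impI)
    fix s assume "t < s" "s < t + e"
    then show "y s p = y t p" by (intro e(2)) auto
  qed (use e(1) in simp)
  then show "((\<lambda>t. y t p) \<longlongrightarrow> y t p) (at_right t)" by (rule tendsto_eventually)
next
  fix t :: real assume t: "0 < t"
  define X where "X p = left_lim (\<lambda>s. x s p) t" for p
  have "\<exists>\<epsilon>>0. \<forall>s. (t - \<epsilon> < s \<and> s < t) \<longrightarrow> (\<forall>p\<in>tri N. x s p = X p)"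
    unfolding X_def
    by (rule uniform_radius[OF finite_tri]) (use cadlag_int_left[OF x_cadlag t] in auto)
  then obtain e where e: "e > 0" "\<And>s p. t - e < s \<Longrightarrow> s < t \<Longrightarrow> p \<in> tri N \<Longrightarrow> x s p = X p"
    by blast
  define f where "f = min e t"
  have f: "0 < f" "f \<le> e" "f \<le> t" using e(1) t by (auto simp: f_def)
  have c: "y s p = y (t - f / 2) p" if "t - f < s" "s < t" for s
    by (rule y_const_of[of "{t - f<..<t}" X])
      (use that f p in \<open>auto simp: is_interval_oo intro: e(2)\<close>)
  have "\<forall>\<^sub>F s in at_left t. y s p = y (t - f / 2) p"
    unfolding eventually_at_left_field using f(1) by (intro exI[of _ "t - f"] conjI allI impI c) auto
  then have "((\<lambda>t. y t p) \<longlongrightarrow> y (t - f / 2) p) (at_left t)" by (rule tendsto_eventually)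
  then show "\<exists>l. ((\<lambda>t. y t p) \<longlongrightarrow> l) (at_left t)" ..
qed

text \<open>The shift by \<open>a\<close> cancels in the compensator and in all comparisons with
  barriers. The gap \<open>1 / b\<close> comes from the strict inequality of \<open>GT N\<close>,
  which between integers means a distance of at least 1; the same number bounds the jumps.\<close>

lemma reflected_rescaled:
  assumes a: "continuous_on {0..} a" and b: "b > 0"
  shows "reflected N (1 / b) (rescaled_path (tri N) a b x) (rescaled_path (tri N) a b y)"
  unfolding reflected_def
proof (intro allI impI conjI)
  fix i k assume ik: "(i, k) \<in> tri N"
  have kN: "k \<le> N" "i \<le> k" "1 \<le> i" using ik by (auto simp: tri_def)
  have lo: "(i - 1, k - 1) \<in> tri N" if "1 < i" using ik that by (auto simp: tri_def)
  have up: "(i, k - 1) \<in> tri N" if "i < k" using ik that by (auto simp: tri_def)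
  have val: "rescaled_path (tri N) a b w t p = (of_int (w t p) - a t) / b" if "0 \<le> t" "p \<in> tri N" for w t p
    using that by (simp add: rescaled_path_def)
  have diff: "rescaled_path (tri N) a b y t (i, k) - rescaled_path (tri N) a b x t (i, k)
      = of_int (y t (i, k) - x t (i, k)) / b" if "0 \<le> t" for t
    using that ik by (simp add: val diff_divide_distrib)
  {
    fix t :: real assume t: "0 \<le> t"
    show "rescaled_path (tri N) a b y t (i - 1, k - 1) \<le> rescaled_path (tri N) a b y t (i, k)" if "1 < i"
    proof -
      have "y t (i - 1, k - 1) \<le> y t (i, k)"
        using y_GT[OF t] kN that unfolding GT_def mem_Collect_eq by (elim allE[of _ i] allE[of _ k]) auto
      then show ?thesis
        unfolding val[OF t ik] val[OF t lo[OF that]] using b by (intro divide_right_mono) auto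
    qed
    show "rescaled_path (tri N) a b y t (i, k) \<le> rescaled_path (tri N) a b y t (i, k - 1) - 1 / b" if "i < k"
    proof -
      have "y t (i, k) < y t (i, k - 1)"
        using y_GT[OF t] kN that unfolding GT_def mem_Collect_eq by (elim allE[of _ "Suc i"] allE[of _ k]) auto
      then have "of_int (y t (i, k)) \<le> (of_int (y t (i, k - 1)) - 1 :: real)" by linarith
      then show ?thesis
        unfolding val[OF t ik] val[OF t up[OF that]] diff_divide_distrib[symmetric]
        using b by (intro divide_right_mono) auto
    qed
  }
  {
    fix s t
    assume st: "0 \<le> s \<and> s \<le> t \<and> (1 < i \<longrightarrow> (\<forall>r\<in>{s<..t}.
      rescaled_path (tri N) a b y r (i - 1, k - 1) < rescaled_path (tri N) a b y r (i, k)))"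
    have "y t (i, k) - x t (i, k) \<le> y s (i, k) - x s (i, k)"
    proof (rule y_compensator_mono(1)[OF _ _ ik])
      fix r assume r: "1 < i" "s < r" "r \<le> t"
      then have "rescaled_path (tri N) a b y r (i - 1, k - 1) < rescaled_path (tri N) a b y r (i, k)"
        using st by auto
      then show "y r (i - 1, k - 1) < y r (i, k)"
        using r st b by (simp add: val[OF _ ik] val[OF _ lo[OF r(1)], simplified] divide_less_cancel)
    qed (use st in auto)
    then show "rescaled_path (tri N) a b y t (i, k) - rescaled_path (tri N) a b x t (i, k)
      \<le> rescaled_path (tri N) a b y s (i, k) - rescaled_path (tri N) a b x s (i, k)"
      using st b by (subst (1 2) diff) (auto intro!: divide_right_mono simp del: of_int_diff)
  }
  {
    fix s t
    assume st: "0 \<le> s \<and> s \<le> t \<and> (i < k \<longrightarrow> (\<forall>r\<in>{s<..t}.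
      rescaled_path (tri N) a b y r (i, k) < rescaled_path (tri N) a b y r (i, k - 1) - 1 / b))"
    have "y s (i, k) - x s (i, k) \<le> y t (i, k) - x t (i, k)"
    proof (rule y_compensator_mono(2)[OF _ _ ik])
      fix r assume r: "i < k" "s < r" "r \<le> t"
      then have "rescaled_path (tri N) a b y r (i, k) < rescaled_path (tri N) a b y r (i, k - 1) - 1 / b"
        using st by auto
      then have "of_int (y r (i, k)) < (of_int (y r (i, k - 1)) - 1 :: real)"
        using r st b by (simp add: val[OF _ ik] val[OF _ up[OF r(1)], simplified] divide_less_cancel flip: diff_divide_distrib)
      then show "y r (i, k) < y r (i, k - 1) - 1" by linarith
    qed (use st in auto)
    then show "rescaled_path (tri N) a b y s (i, k) - rescaled_path (tri N) a b x s (i, k)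
      \<le> rescaled_path (tri N) a b y t (i, k) - rescaled_path (tri N) a b x t (i, k)"
      using st b by (subst (1 2) diff) (auto intro!: divide_right_mono simp del: of_int_diff)
  }
  fix s \<eta> :: real assume s: "0 < s" "1 / b < \<eta>"
  \<comment> \<open>The slack of \<open>b * \<eta>\<close> over one unit jump; it pays for the
    oscillation of \<open>a\<close> near \<open>s\<close>.\<close>
  define \<theta> where "\<theta> = b * \<eta> - 1"
  have \<theta>: "\<theta> > 0" using s(2) b by (simp add: \<theta>_def field_simps)
  obtain e where e: "e > 0" "\<And>u v p. 0 \<le> u \<Longrightarrow> u \<le> v \<Longrightarrow> s - e < u \<Longrightarrow> v < s + e \<Longrightarrow> p \<in> tri N \<Longrightarrow>
      y v p = interlacing_update (y u) (\<lambda>q. x v q - x u q) p \<and> \<bar>x v p - x u p\<bar> \<le> 1"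
    using local_step[of s] s by fastforce
  obtain d where d: "d > 0" "\<And>r. r \<in> {0..} \<Longrightarrow> dist r s < d \<Longrightarrow> dist (a r) (a s) < \<theta>"
    using a s(1) \<theta> unfolding continuous_on_iff by (metis atLeast_iff less_imp_le)
  show "\<exists>\<epsilon>>0. \<forall>r. 0 \<le> r \<and> s - \<epsilon> < r \<and> r < s \<longrightarrow>
    \<bar>rescaled_path (tri N) a b y s (i, k) - rescaled_path (tri N) a b y r (i, k)\<bar> \<le> \<eta>"
  proof (intro exI[of _ "min d e"] conjI allI impI)
    fix r assume r: "0 \<le> r \<and> s - min d e < r \<and> r < s"
    have st: "y s p = interlacing_update (y r) (\<lambda>q. x s q - x r q) p \<and> \<bar>x s p - x r p\<bar> \<le> 1"
      if "p \<in> tri N" for p using r s e that by (intro e(2)) auto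
    have 1: "\<bar>y s (i, k) - y r (i, k)\<bar> \<le> 1"
      using interlacing_update_step[OF y_GT, of r "\<lambda>q. x s q - x r q", OF _ _ ik] r st ik by simp
    have "dist (a r) (a s) < \<theta>" using r by (intro d(2)) (auto simp: dist_real_def)
    then have 2: "\<bar>a s - a r\<bar> \<le> \<theta>" by (simp add: dist_real_def)
    have "\<bar>(of_int (y s (i, k)) - a s) - (of_int (y r (i, k)) - a r)\<bar> \<le> b * \<eta>"
      using 1 2 unfolding \<theta>_def by linarith
    then have "\<bar>(of_int (y s (i, k)) - a s) - (of_int (y r (i, k)) - a r)\<bar> / b \<le> \<eta>"
      using b by (simp add: field_simps)
    then show "\<bar>rescaled_path (tri N) a b y s (i, k) - rescaled_path (tri N) a b y r (i, k)\<bar> \<le> \<eta>"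
      using r s ik b by (simp add: val flip: diff_divide_distrib)
  qed (use d e in auto)
qed

end

section \<open>Measurability of the interlacing dynamics\<close>

lemma measurable_interlacing_update:
  assumes y: "\<And>p. p \<in> tri N \<Longrightarrow> (\<lambda>\<omega>. y \<omega> p) \<in> M \<rightarrow>\<^sub>M count_space UNIV"
    and d: "\<And>p. p \<in> tri N \<Longrightarrow> (\<lambda>\<omega>. d \<omega> p) \<in> M \<rightarrow>\<^sub>M count_space UNIV"
    and "(i, k) \<in> tri N"
  shows "(\<lambda>\<omega>. interlacing_update (y \<omega>) (d \<omega>) (i, k)) \<in> M \<rightarrow>\<^sub>M count_space UNIV"
  using assms(3)
proof (induction k arbitrary: i)
  case 0
  then show ?case by (auto simp: tri_def)
next
  case (Suc m)
  note [measurable] = y[OF Suc.prems] d[OF Suc.prems]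
  show ?case
  proof (cases m)
    case 0
    then have "(i, Suc 0) \<in> tri N" using Suc.prems by simp
    note [measurable] = y[OF this] d[OF this]
    show ?thesis using 0 by simp
  next
    case (Suc l)
    have "(i - 1, m) \<in> tri N" if "1 < i" using Suc.prems that by (auto simp: tri_def)
    with Suc.IH have lo: "1 < i \<Longrightarrow> (\<lambda>\<omega>. interlacing_update (y \<omega>) (d \<omega>) (i - 1, m)) \<in> M \<rightarrow>\<^sub>M count_space UNIV"
      by blast
    have "(i, m) \<in> tri N" if "i < Suc m" using Suc.prems that by (auto simp: tri_def)
    with Suc.IH have up: "i < Suc m \<Longrightarrow> (\<lambda>\<omega>. interlacing_update (y \<omega>) (d \<omega>) (i, m)) \<in> M \<rightarrow>\<^sub>M count_space UNIV"
      by blast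
    \<comment> \<open>Outside the triangle nothing is known about measurability, so the neighbours
      get the default 0 there; the guards make its choice irrelevant.\<close>
    define lo' where "lo' \<omega> = (if 1 < i then interlacing_update (y \<omega>) (d \<omega>) (i - 1, m) else 0)" for \<omega>
    define up' where "up' \<omega> = (if i < Suc m then interlacing_update (y \<omega>) (d \<omega>) (i, m) else 0)" for \<omega>
    have [measurable]: "lo' \<in> M \<rightarrow>\<^sub>M count_space UNIV" "up' \<in> M \<rightarrow>\<^sub>M count_space UNIV"
      using lo up unfolding lo'_def up'_def by (cases "1 < i"; cases "i < Suc m"; simp)+
    have eq: "(\<lambda>\<omega>. interlacing_update (y \<omega>) (d \<omega>) (i, Suc m)) = (\<lambda>\<omega>.
        if i > 1 \<and> y \<omega> (i, Suc m) = lo' \<omega> - 1 then y \<omega> (i, Suc m) + 1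
         else if i < Suc m \<and> y \<omega> (i, Suc m) = up' \<omega> then y \<omega> (i, Suc m) - 1
         else if d \<omega> (i, Suc m) = 1 then (if i < Suc m \<and> up' \<omega> = y \<omega> (i, Suc m) + 1 then y \<omega> (i, Suc m) else y \<omega> (i, Suc m) + 1)
         else if d \<omega> (i, Suc m) = - 1 then (if i > 1 \<and> lo' \<omega> = y \<omega> (i, Suc m) then y \<omega> (i, Suc m) else y \<omega> (i, Suc m) - 1)
         else y \<omega> (i, Suc m))"
      unfolding lo'_def up'_def Suc by (rule ext) (simp add: Let_def)
    show ?thesis unfolding eq by measurable
  qed
qed

text \<open>Treats every cell of a grid of mesh \<open>h\<close> as a single update. It depends on
  the driver at finitely many fixed times, hence is measurable, and it is exact for a given path
  once the mesh is fine enough.\<close>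

primrec grid_dynamics ::
  "real \<Rightarrow> (real \<Rightarrow> nat \<times> nat \<Rightarrow> int) \<Rightarrow> (nat \<times> nat \<Rightarrow> int) \<Rightarrow> nat \<Rightarrow> nat \<times> nat \<Rightarrow> int" where
  "grid_dynamics h x y0 0 = y0"
| "grid_dynamics h x y0 (Suc l) =
    interlacing_update (grid_dynamics h x y0 l) (\<lambda>q. x (real (Suc l) * h) q - x (real l * h) q)"

text \<open>The mesh at which the grid run becomes exact depends on the path through
  \<open>\<delta>\<close>, so equality holds only for all large \<open>m\<close>.\<close>

lemma (in unit_step_dynamics) grid_dynamics_eventually:
  assumes t: "0 \<le> t" and p: "p \<in> tri N"
  shows "\<forall>\<^sub>F m in sequentially. grid_dynamics (t / real m) x (y 0) m p = y t p"
proof -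
  obtain \<delta> where \<delta>: "\<delta> > 0" "\<And>u v p. 0 \<le> u \<Longrightarrow> u \<le> v \<Longrightarrow> v \<le> t \<Longrightarrow> v - u < \<delta> \<Longrightarrow> p \<in> tri N \<Longrightarrow>
    y v p = interlacing_update (y u) (\<lambda>q. x v q - x u q) p"
    using uniform_step[of t] by blast
  obtain m0 :: nat where m0: "t / \<delta> < real m0" using reals_Archimedean2 by blast
  show ?thesis
    unfolding eventually_sequentially
  proof (intro exI[of _ m0] allI impI)
    fix m assume "m0 \<le> m"
    with m0 have m: "t / \<delta> < real m" by (meson less_le_trans of_nat_mono)
    then have mpos: "0 < m" using t \<delta> by (cases m) (auto simp: divide_less_0_iff)
    have h: "0 \<le> t / real m" "t / real m < \<delta>" using m t \<delta> mpos by (auto simp: field_simps)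
    have "\<forall>p\<in>tri N. grid_dynamics (t / real m) x (y 0) l p = y (real l * (t / real m)) p" if "l \<le> m" for l
      using that
    proof (induction l)
      case (Suc l)
      show ?case
      proof
        fix p assume p: "p \<in> tri N"
        obtain i k where ik: "p = (i, k)" by (cases p)
        have "real (Suc l) * (t / real m) \<le> real m * (t / real m)"
          using Suc.prems h by (intro mult_right_mono) auto
        then have "real (Suc l) * (t / real m) \<le> t" using mpos by simp
        moreover have "real (Suc l) * (t / real m) - real l * (t / real m) = t / real m"
          by (simp add: algebra_simps add_divide_distrib)
        moreover have "real l * (t / real m) \<le> real (Suc l) * (t / real m)"
          using h by (intro mult_right_mono) auto
        ultimately have "y (real (Suc l) * (t / real m)) p = interlacing_update (y (real l * (t / real m)))
            (\<lambda>q. x (real (Suc l) * (t / real m)) q - x (real l * (t / real m)) q) p"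
          using h p mult_nonneg_nonneg[OF of_nat_0_le_iff h(1), of l] by (intro \<delta>(2)) linarith+
        also have "\<dots> = grid_dynamics (t / real m) x (y 0) (Suc l) p"
          unfolding grid_dynamics.simps ik
          by (rule interlacing_update_cong[symmetric]) (use Suc p ik in auto)
        finally show "grid_dynamics (t / real m) x (y 0) (Suc l) p = y (real (Suc l) * (t / real m)) p" ..
      qed
    qed simp
    from this[of m] p mpos show "grid_dynamics (t / real m) x (y 0) m p = y t p" by simp
  qed
qed

lemma measurable_grid_dynamics:
  assumes x: "\<And>t p. 0 \<le> t \<Longrightarrow> p \<in> tri N \<Longrightarrow> (\<lambda>\<omega>. x \<omega> t p) \<in> M \<rightarrow>\<^sub>M count_space UNIV"
    and y: "\<And>p. p \<in> tri N \<Longrightarrow> (\<lambda>\<omega>. y \<omega> p) \<in> M \<rightarrow>\<^sub>M count_space UNIV"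
    and h: "0 \<le> h" and "p \<in> tri N"
  shows "(\<lambda>\<omega>. grid_dynamics h (x \<omega>) (y \<omega>) l p) \<in> M \<rightarrow>\<^sub>M count_space (UNIV :: int set)"
  using assms(4)
proof (induction l arbitrary: p)
  case 0
  then show ?case using y by simp
next
  case (Suc l)
  obtain i k where ik: "p = (i, k)" by (cases p)
  have "(\<lambda>\<omega>. interlacing_update (grid_dynamics h (x \<omega>) (y \<omega>) l)
      (\<lambda>q. x \<omega> (real (Suc l) * h) q - x \<omega> (real l * h) q) (i, k)) \<in> M \<rightarrow>\<^sub>M count_space UNIV"
  proof (rule measurable_interlacing_update[where N = N])
    fix p assume p: "p \<in> tri N"
    have [measurable]: "(\<lambda>\<omega>. x \<omega> (real (Suc l) * h) p) \<in> M \<rightarrow>\<^sub>M count_space UNIV"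
      "(\<lambda>\<omega>. x \<omega> (real l * h) p) \<in> M \<rightarrow>\<^sub>M count_space UNIV"
      using h p by (intro x mult_nonneg_nonneg; simp)+
    show "(\<lambda>\<omega>. x \<omega> (real (Suc l) * h) p - x \<omega> (real l * h) p) \<in> M \<rightarrow>\<^sub>M count_space UNIV"
      by measurable
  qed (use Suc ik in auto)
  then show ?case by (simp add: ik)
qed

text \<open>Jump times are random, so the dynamics is not directly a function of finitely many
  driver values. As a pointwise limit of grid runs it still inherits measurability from the driver
  and the initial state.\<close>

lemma measurable_interlacing_dynamics:
  assumes dyn: "\<And>\<omega>. \<omega> \<in> space M \<Longrightarrow> unit_step_dynamics N (x \<omega>) (y \<omega>)"
    and x: "\<And>t p. 0 \<le> t \<Longrightarrow> p \<in> tri N \<Longrightarrow> (\<lambda>\<omega>. x \<omega> t p) \<in> M \<rightarrow>\<^sub>M count_space UNIV"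
    and y: "\<And>p. p \<in> tri N \<Longrightarrow> (\<lambda>\<omega>. y \<omega> 0 p) \<in> M \<rightarrow>\<^sub>M count_space UNIV"
    and t: "0 \<le> t" and p: "p \<in> tri N"
  shows "(\<lambda>\<omega>. real_of_int (y \<omega> t p)) \<in> borel_measurable M"
proof (rule borel_measurable_LIMSEQ_real)
  fix m :: nat
  have [measurable]: "(\<lambda>\<omega>. grid_dynamics (t / real m) (x \<omega>) (y \<omega> 0) m p) \<in> M \<rightarrow>\<^sub>M count_space UNIV"
    by (rule measurable_grid_dynamics[OF x y]) (use t p in auto)
  show "(\<lambda>\<omega>. real_of_int (grid_dynamics (t / real m) (x \<omega>) (y \<omega> 0) m p)) \<in> borel_measurable M"
    by measurable
next
  fix \<omega> assume "\<omega> \<in> space M"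
  then interpret unit_step_dynamics N "x \<omega>" "y \<omega>" by (rule dyn)
  have "\<forall>\<^sub>F m in sequentially. real_of_int (grid_dynamics (t / real m) (x \<omega>) (y \<omega> 0) m p) = real_of_int (y \<omega> t p)"
    using grid_dynamics_eventually[OF t p] by eventually_elim simp
  then show "(\<lambda>m. real_of_int (grid_dynamics (t / real m) (x \<omega>) (y \<omega> 0) m p)) \<longlonglongrightarrow> real_of_int (y \<omega> t p)"
    by (rule tendsto_eventually)
qed

section \<open>Rescaled paths as random elements of the path space\<close>

lemma rescaled_path_in_cadlag_paths:
  assumes w: "\<And>p. p \<in> I \<Longrightarrow> cadlag (\<lambda>t. w t p :: int)" and a: "continuous_on {0..} a" and b: "b > 0"
  shows "rescaled_path I a b w \<in> cadlag_paths I"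
  unfolding cadlag_paths_def mem_Collect_eq
proof (intro conjI ballI)
  show "rescaled_path I a b w \<in> {0..} \<rightarrow>\<^sub>E (I \<rightarrow>\<^sub>E UNIV)"
    by (auto simp: rescaled_path_def)
  fix p assume p: "p \<in> I"
  have val: "rescaled_path I a b w t p = (of_int (w t p) - a t) / b" if "0 \<le> t" for t
    using that p by (simp add: rescaled_path_def)
  have a': "(a \<longlongrightarrow> a t) (at t within {0..})" if "0 \<le> t" for t
    using a that by (auto simp: continuous_on)
  show "cadlag (\<lambda>t. rescaled_path I a b w t p)"
    unfolding cadlag_def
  proof (intro conjI allI impI)
    fix t :: real assume t: "0 \<le> t"
    have "((\<lambda>s. w s p) \<longlongrightarrow> w t p) (at_right t)" using w[OF p] t by (auto simp: cadlag_def)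
    then have "((\<lambda>s. real_of_int (w s p)) \<longlongrightarrow> real_of_int (w t p)) (at_right t)"
      by (auto simp: tendsto_discrete intro!: tendsto_eventually elim: eventually_mono)
    moreover have "(a \<longlongrightarrow> a t) (at_right t)"
      by (rule tendsto_within_subset[OF a'[OF t]]) (use t in auto)
    ultimately have "((\<lambda>s. (of_int (w s p) - a s) / b) \<longlongrightarrow> (of_int (w t p) - a t) / b) (at_right t)"
      using b by (intro tendsto_intros) auto
    moreover have "\<forall>\<^sub>F s in at_right t. (of_int (w s p) - a s) / b = rescaled_path I a b w s p"
      unfolding eventually_at_right_field using t val by (intro exI[of _ "t + 1"]) auto
    ultimately show "((\<lambda>s. rescaled_path I a b w s p) \<longlongrightarrow> rescaled_path I a b w t p) (at_right t)"
      using val[OF t] by (auto elim: Lim_transform_eventually)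
  next
    fix t :: real assume t: "0 < t"
    obtain l where "((\<lambda>s. w s p) \<longlongrightarrow> l) (at_left t)" using w[OF p] t by (auto simp: cadlag_def)
    then have "((\<lambda>s. real_of_int (w s p)) \<longlongrightarrow> real_of_int l) (at_left t)"
      by (auto simp: tendsto_discrete intro!: tendsto_eventually elim: eventually_mono)
    moreover have "(a \<longlongrightarrow> a t) (at_left t)"
    proof -
      \<comment> \<open>\<open>a\<close> is continuous only as a function on \<open>{0..}\<close>,
        so the left limit is taken within positive times and then identified with
        \<open>at_left t\<close>.\<close>
      have "(a \<longlongrightarrow> a t) (at t within {0<..<t})"
        by (rule tendsto_within_subset[OF a']) (use t in auto)
      moreover have "at t within {0<..<t} = at_left t"
        by (rule at_within_nhd[of t "{0<..}"]) (use t in auto)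
      ultimately show ?thesis by simp
    qed
    ultimately have "((\<lambda>s. (of_int (w s p) - a s) / b) \<longlongrightarrow> (of_int l - a t) / b) (at_left t)"
      using b by (intro tendsto_intros) auto
    moreover have "\<forall>\<^sub>F s in at_left t. (of_int (w s p) - a s) / b = rescaled_path I a b w s p"
      unfolding eventually_at_left_field using t val by (intro exI[of _ 0]) auto
    ultimately show "\<exists>l. ((\<lambda>s. rescaled_path I a b w s p) \<longlongrightarrow> l) (at_left t)"
      by (auto elim: Lim_transform_eventually)
  qed
qed

lemma measurable_rescaled_path:
  assumes w: "\<And>t p. 0 \<le> t \<Longrightarrow> p \<in> I \<Longrightarrow> (\<lambda>\<omega>. real_of_int (w \<omega> t p)) \<in> borel_measurable M"
    and paths: "\<And>\<omega>. \<omega> \<in> space M \<Longrightarrow> rescaled_path I a b (w \<omega>) \<in> cadlag_paths I"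
  shows "(\<lambda>\<omega>. rescaled_path I a b (w \<omega>)) \<in> M \<rightarrow>\<^sub>M cadlag_space I"
  unfolding cadlag_space_def
proof (rule measurable_restrict_space2)
  show "(\<lambda>\<omega>. rescaled_path I a b (w \<omega>)) \<in> space M \<rightarrow> cadlag_paths I" using paths by auto
  show "(\<lambda>\<omega>. rescaled_path I a b (w \<omega>)) \<in> M \<rightarrow>\<^sub>M PiM {0..} (\<lambda>_. PiM I (\<lambda>_. borel))"
    unfolding rescaled_path_def
  proof (intro measurable_restrict)
    fix t :: real and p assume "t \<in> {0..}" "p \<in> I"
    then have [measurable]: "(\<lambda>\<omega>. real_of_int (w \<omega> t p)) \<in> borel_measurable M" by (intro w) auto
    show "(\<lambda>\<omega>. (real_of_int (w \<omega> t p) - a t) / b) \<in> borel_measurable M" by measurable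
  qed
qed

section \<open>Weak convergence by a partition of unity\<close>

text \<open>Index \<open>i\<close> takes the share \<open>\<phi> i\<close> of what the earlier
  indices have left over; the last product is the unclaimed rest. This turns arbitrary weights in
  \<open>[0, 1]\<close> into a partition of unity without dividing by their sum.\<close>

lemma partition_sum:
  fixes \<phi> :: "nat \<Rightarrow> real"
  shows "(\<Sum>i<k. \<phi> i * (\<Prod>l<i. 1 - \<phi> l)) + (\<Prod>l<k. 1 - \<phi> l) = 1"
  by (induction k) (auto simp: algebra_simps)

text \<open>Where index \<open>i\<close> claims mass, \<open>f\<close> is within
  \<open>\<eta>\<close> of \<open>v i\<close>, and the claimed mass is at most 1; the unclaimed rest
  is weighted with the bound \<open>C\<close>.\<close>

lemma (in prob_space) partition_estimate:
  fixes \<phi> :: "nat \<Rightarrow> 'a \<Rightarrow> real" and f :: "'a \<Rightarrow> real"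
  assumes \<phi>[measurable]: "\<And>l. \<phi> l \<in> borel_measurable M" and \<phi>01: "\<And>l \<omega>. \<omega> \<in> space M \<Longrightarrow> 0 \<le> \<phi> l \<omega> \<and> \<phi> l \<omega> \<le> 1"
    and f[measurable]: "f \<in> borel_measurable M" and C: "\<And>\<omega>. \<omega> \<in> space M \<Longrightarrow> \<bar>f \<omega>\<bar> \<le> C"
    and near: "AE \<omega> in M. \<forall>l<k. 0 < \<phi> l \<omega> \<longrightarrow> \<bar>f \<omega> - v l\<bar> \<le> \<eta>" and \<eta>: "0 \<le> \<eta>"
  shows "\<bar>expectation f - (\<Sum>i<k. v i * expectation (\<lambda>\<omega>. \<phi> i \<omega> * (\<Prod>l<i. 1 - \<phi> l \<omega>)))\<bar>
    \<le> \<eta> + C * expectation (\<lambda>\<omega>. \<Prod>l<k. 1 - \<phi> l \<omega>)"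
proof -
  have P01: "0 \<le> (\<Prod>l<j. 1 - \<phi> l \<omega>) \<and> (\<Prod>l<j. 1 - \<phi> l \<omega>) \<le> 1" if "\<omega> \<in> space M" for j \<omega>
    using \<phi>01[OF that] by (intro conjI prod_nonneg prod_le_1) auto
  have int_f: "integrable M f"
    by (rule integrable_const_bound[of _ C]) (use C in auto)
  have int_P: "integrable M (\<lambda>\<omega>. \<Prod>l<j. 1 - \<phi> l \<omega>)" for j
    by (rule integrable_const_bound[of _ 1]) (use P01 in auto)
  have int_\<psi>: "integrable M (\<lambda>\<omega>. \<phi> i \<omega> * (\<Prod>l<i. 1 - \<phi> l \<omega>))" for i
    by (rule integrable_const_bound[of _ 1])
      (use P01 \<phi>01 in \<open>auto simp: abs_mult intro!: mult_le_one\<close>)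
  have "expectation f - (\<Sum>i<k. v i * expectation (\<lambda>\<omega>. \<phi> i \<omega> * (\<Prod>l<i. 1 - \<phi> l \<omega>)))
      = expectation (\<lambda>\<omega>. f \<omega> - (\<Sum>i<k. v i * (\<phi> i \<omega> * (\<Prod>l<i. 1 - \<phi> l \<omega>))))"
    using int_f int_\<psi> by simp
  also have "\<bar>\<dots>\<bar> \<le> expectation (\<lambda>\<omega>. \<eta> + C * (\<Prod>l<k. 1 - \<phi> l \<omega>))"
  proof (rule integral_abs_bound[THEN order_trans], rule integral_mono_AE)
    show "AE \<omega> in M. \<bar>f \<omega> - (\<Sum>i<k. v i * (\<phi> i \<omega> * (\<Prod>l<i. 1 - \<phi> l \<omega>)))\<bar> \<le> \<eta> + C * (\<Prod>l<k. 1 - \<phi> l \<omega>)"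
      using near AE_space
    proof eventually_elim
      fix \<omega> assume near: "\<forall>l<k. 0 < \<phi> l \<omega> \<longrightarrow> \<bar>f \<omega> - v l\<bar> \<le> \<eta>" and \<omega>: "\<omega> \<in> space M"
      define \<psi> where "\<psi> i = \<phi> i \<omega> * (\<Prod>l<i. 1 - \<phi> l \<omega>)" for i
      define P where "P = (\<Prod>l<k. 1 - \<phi> l \<omega>)"
      have \<psi>0: "0 \<le> \<psi> i" for i using P01[OF \<omega>, of i] \<phi>01[OF \<omega>, of i] by (simp add: \<psi>_def)
      have one: "(\<Sum>i<k. \<psi> i) + P = 1" unfolding \<psi>_def P_def by (rule partition_sum)
      have P: "0 \<le> P" using P01[OF \<omega>] by (simp add: P_def)
      \<comment> \<open>Multiplying \<open>f\<close> by the total mass 1 pairs each constant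
        \<open>v i\<close> with the part of \<open>f\<close> that it approximates.\<close>
      have "f \<omega> - (\<Sum>i<k. v i * \<psi> i) = ((\<Sum>i<k. \<psi> i) + P) * f \<omega> - (\<Sum>i<k. v i * \<psi> i)"
        by (simp add: one)
      also have "\<dots> = (\<Sum>i<k. \<psi> i * (f \<omega> - v i)) + P * f \<omega>"
        by (simp add: algebra_simps sum_subtractf sum_distrib_left)
      finally have "\<bar>f \<omega> - (\<Sum>i<k. v i * \<psi> i)\<bar> \<le> \<bar>\<Sum>i<k. \<psi> i * (f \<omega> - v i)\<bar> + \<bar>P * f \<omega>\<bar>"
        by simp
      also have "\<bar>\<Sum>i<k. \<psi> i * (f \<omega> - v i)\<bar> \<le> (\<Sum>i<k. \<psi> i * \<eta>)"
      proof (rule sum_abs[THEN order_trans], rule sum_mono)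
        fix i assume i: "i \<in> {..<k}"
        show "\<bar>\<psi> i * (f \<omega> - v i)\<bar> \<le> \<psi> i * \<eta>"
        proof (cases "\<phi> i \<omega> = 0")
          case False
          then have "\<bar>f \<omega> - v i\<bar> \<le> \<eta>" using near i \<phi>01[OF \<omega>, of i] by force
          then show ?thesis using \<psi>0[of i] by (simp add: abs_mult mult_left_mono)
        qed (simp add: \<psi>_def)
      qed
      also have "(\<Sum>i<k. \<psi> i * \<eta>) = (\<Sum>i<k. \<psi> i) * \<eta>" by (simp add: sum_distrib_right)
      also have "\<dots> \<le> \<eta>" using one P \<eta> by (intro mult_left_le_one_le sum_nonneg \<psi>0) auto
      also have "\<bar>P * f \<omega>\<bar> \<le> C * P" using mult_right_mono[OF C[OF \<omega>] P] P by (simp add: abs_mult mult.commute)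
      finally show "\<bar>f \<omega> - (\<Sum>i<k. v i * (\<phi> i \<omega> * (\<Prod>l<i. 1 - \<phi> l \<omega>)))\<bar> \<le> \<eta> + C * (\<Prod>l<k. 1 - \<phi> l \<omega>)"
        by (simp add: \<psi>_def P_def)
    qed
  qed (use int_f int_\<psi> int_P in auto)
  also have "expectation (\<lambda>\<omega>. \<eta> + C * (\<Prod>l<k. 1 - \<phi> l \<omega>)) = \<eta> + C * expectation (\<lambda>\<omega>. \<Prod>l<k. 1 - \<phi> l \<omega>)"
    using int_P by (simp add: prob_space)
  finally show ?thesis .
qed

lemma (in prob_space) integrable_prod_complements:
  fixes g :: "nat \<Rightarrow> 'a \<Rightarrow> real"
  assumes [measurable]: "\<And>l. g l \<in> borel_measurable M"
    and g01: "\<And>l \<omega>. \<omega> \<in> space M \<Longrightarrow> 0 \<le> g l \<omega> \<and> g l \<omega> \<le> 1"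
  shows "integrable M (\<lambda>\<omega>. (\<Prod>l\<in>A. g l \<omega>) * (\<Prod>l<k. 1 - g l \<omega>))"
proof (rule integrable_const_bound[of _ 1])
  have "norm ((\<Prod>l\<in>A. g l \<omega>) * (\<Prod>l<k. 1 - g l \<omega>)) \<le> 1" if "\<omega> \<in> space M" for \<omega>
  proof -
    have "0 \<le> (\<Prod>l\<in>A. g l \<omega>)" "(\<Prod>l\<in>A. g l \<omega>) \<le> 1" "0 \<le> (\<Prod>l<k. 1 - g l \<omega>)" "(\<Prod>l<k. 1 - g l \<omega>) \<le> 1"
      using g01[OF that] by (auto intro!: prod_nonneg prod_le_1)
    then show ?thesis by (simp add: abs_mult mult_le_one)
  qed
  then show "AE \<omega> in M. norm ((\<Prod>l\<in>A. g l \<omega>) * (\<Prod>l<k. 1 - g l \<omega>)) \<le> 1" by simp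
qed measurable

text \<open>Expanding the factor \<open>1 - g k\<close> moves the index \<open>k\<close> from the
  complements to the plain product or drops it.\<close>

lemma (in prob_space) expectation_complement_step:
  fixes g :: "nat \<Rightarrow> 'a \<Rightarrow> real"
  assumes "\<And>l. g l \<in> borel_measurable M"
    and "\<And>l \<omega>. \<omega> \<in> space M \<Longrightarrow> 0 \<le> g l \<omega> \<and> g l \<omega> \<le> 1"
    and "finite A" "k \<notin> A"
  shows "expectation (\<lambda>\<omega>. (\<Prod>l\<in>A. g l \<omega>) * (\<Prod>l<Suc k. 1 - g l \<omega>)) =
     expectation (\<lambda>\<omega>. (\<Prod>l\<in>A. g l \<omega>) * (\<Prod>l<k. 1 - g l \<omega>)) -
     expectation (\<lambda>\<omega>. (\<Prod>l\<in>insert k A. g l \<omega>) * (\<Prod>l<k. 1 - g l \<omega>))"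
  using assms(3,4)
  by (subst Bochner_Integration.integral_diff[symmetric, OF integrable_prod_complements integrable_prod_complements])
    (use assms(1,2) in \<open>auto simp: algebra_simps intro!: Bochner_Integration.integral_cong\<close>)

text \<open>A plain product of weights separates into a factor for the starting point and one for
  the driver, while a factor \<open>1 - \<phi> n l\<close> does not. The complements are therefore
  expanded one at a time until only plain products remain.\<close>

lemma tendsto_expectation_complements:
  fixes \<phi> :: "nat \<Rightarrow> nat \<Rightarrow> 'a \<Rightarrow> real" and \<phi>' :: "nat \<Rightarrow> 'b \<Rightarrow> real"
  assumes M: "\<And>n. prob_space (M n)" and \<Omega>: "prob_space \<Omega>"
    and \<phi>: "\<And>n l. \<phi> n l \<in> borel_measurable (M n)" and \<phi>01: "\<And>n l \<omega>. \<omega> \<in> space (M n) \<Longrightarrow> 0 \<le> \<phi> n l \<omega> \<and> \<phi> n l \<omega> \<le> 1"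
    and \<phi>': "\<And>l. \<phi>' l \<in> borel_measurable \<Omega>" and \<phi>'01: "\<And>l \<omega>. \<omega> \<in> space \<Omega> \<Longrightarrow> 0 \<le> \<phi>' l \<omega> \<and> \<phi>' l \<omega> \<le> 1"
    and lim: "\<And>A. finite A \<Longrightarrow> (\<lambda>n. \<integral>\<omega>. (\<Prod>l\<in>A. \<phi> n l \<omega>) \<partial>M n) \<longlonglongrightarrow> (\<integral>\<omega>. (\<Prod>l\<in>A. \<phi>' l \<omega>) \<partial>\<Omega>)"
  shows "finite A \<Longrightarrow> A \<inter> {..<k} = {} \<Longrightarrow>
    (\<lambda>n. \<integral>\<omega>. (\<Prod>l\<in>A. \<phi> n l \<omega>) * (\<Prod>l<k. 1 - \<phi> n l \<omega>) \<partial>M n) \<longlonglongrightarrow> (\<integral>\<omega>. (\<Prod>l\<in>A. \<phi>' l \<omega>) * (\<Prod>l<k. 1 - \<phi>' l \<omega>) \<partial>\<Omega>)"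
proof (induction k arbitrary: A)
  case 0
  then show ?case using lim by simp
next
  case (Suc k)
  have A: "k \<notin> A" "A \<inter> {..<k} = {}" "insert k A \<inter> {..<k} = {}" "finite (insert k A)"
    using Suc.prems by auto
  note step = prob_space.expectation_complement_step[OF _ _ _ Suc.prems(1) A(1)]
  have 1: "(\<integral>\<omega>. (\<Prod>l\<in>A. \<phi> n l \<omega>) * (\<Prod>l<Suc k. 1 - \<phi> n l \<omega>) \<partial>M n) =
     (\<integral>\<omega>. (\<Prod>l\<in>A. \<phi> n l \<omega>) * (\<Prod>l<k. 1 - \<phi> n l \<omega>) \<partial>M n) -
     (\<integral>\<omega>. (\<Prod>l\<in>insert k A. \<phi> n l \<omega>) * (\<Prod>l<k. 1 - \<phi> n l \<omega>) \<partial>M n)" for n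
    by (rule step[where g = "\<phi> n"]) (use M \<phi> \<phi>01 in auto)
  have 2: "(\<integral>\<omega>. (\<Prod>l\<in>A. \<phi>' l \<omega>) * (\<Prod>l<Suc k. 1 - \<phi>' l \<omega>) \<partial>\<Omega>) =
     (\<integral>\<omega>. (\<Prod>l\<in>A. \<phi>' l \<omega>) * (\<Prod>l<k. 1 - \<phi>' l \<omega>) \<partial>\<Omega>) -
     (\<integral>\<omega>. (\<Prod>l\<in>insert k A. \<phi>' l \<omega>) * (\<Prod>l<k. 1 - \<phi>' l \<omega>) \<partial>\<Omega>)"
    by (rule step[where g = "\<phi>'"]) (use \<Omega> \<phi>' \<phi>'01 in auto)
  show ?case
    unfolding 1 2
    by (intro tendsto_diff Suc.IH A Suc.prems(1))
qed

text \<open>The five errors are, on either space, the oscillation of the functional on the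
  neighbourhoods and the contribution of the uncovered mass, and finally the difference of the two
  finite sums. No tightness of the prelimits is assumed.\<close>

lemma tendsto_expectation_partition:
  fixes \<phi> :: "nat \<Rightarrow> nat \<Rightarrow> 'a \<Rightarrow> real" and \<phi>' :: "nat \<Rightarrow> 'b \<Rightarrow> real"
    and f :: "nat \<Rightarrow> 'a \<Rightarrow> real" and f' :: "'b \<Rightarrow> real"
  assumes M: "\<And>n. prob_space (M n)" and \<Omega>: "prob_space \<Omega>"
    and \<phi>: "\<And>n l. \<phi> n l \<in> borel_measurable (M n)" and \<phi>01: "\<And>n l \<omega>. \<omega> \<in> space (M n) \<Longrightarrow> 0 \<le> \<phi> n l \<omega> \<and> \<phi> n l \<omega> \<le> 1"
    and \<phi>': "\<And>l. \<phi>' l \<in> borel_measurable \<Omega>" and \<phi>'01: "\<And>l \<omega>. \<omega> \<in> space \<Omega> \<Longrightarrow> 0 \<le> \<phi>' l \<omega> \<and> \<phi>' l \<omega> \<le> 1"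
    and lim: "\<And>A. finite A \<Longrightarrow> (\<lambda>n. \<integral>\<omega>. (\<Prod>l\<in>A. \<phi> n l \<omega>) \<partial>M n) \<longlonglongrightarrow> (\<integral>\<omega>. (\<Prod>l\<in>A. \<phi>' l \<omega>) \<partial>\<Omega>)"
    and f: "\<And>n. f n \<in> borel_measurable (M n)" and fC: "\<And>n \<omega>. \<omega> \<in> space (M n) \<Longrightarrow> \<bar>f n \<omega>\<bar> \<le> C"
    and f': "f' \<in> borel_measurable \<Omega>" and f'C: "\<And>\<omega>. \<omega> \<in> space \<Omega> \<Longrightarrow> \<bar>f' \<omega>\<bar> \<le> C"
    and \<eta>: "0 < \<eta>"
    and near: "\<And>l. \<forall>\<^sub>F n in sequentially. \<forall>\<omega>\<in>space (M n). 0 < \<phi> n l \<omega> \<longrightarrow> \<bar>f n \<omega> - v l\<bar> \<le> \<eta>"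
    and near': "AE \<omega> in \<Omega>. \<forall>l. 0 < \<phi>' l \<omega> \<longrightarrow> \<bar>f' \<omega> - v l\<bar> \<le> \<eta>"
    and cover: "AE \<omega> in \<Omega>. \<exists>l. \<phi>' l \<omega> = 1"
  shows "\<forall>\<^sub>F n in sequentially. \<bar>(\<integral>\<omega>. f n \<omega> \<partial>M n) - (\<integral>\<omega>. f' \<omega> \<partial>\<Omega>)\<bar> \<le> 5 * \<eta>"
proof -
  interpret \<Omega>: prob_space \<Omega> by fact
  note [measurable] = \<phi>'
  obtain \<omega>0 where "\<omega>0 \<in> space \<Omega>" using \<Omega>.not_empty by blast
  from f'C[OF this] have C0: "0 \<le> C" by linarith
  have P01: "0 \<le> (\<Prod>l<k. 1 - \<phi>' l \<omega>) \<and> (\<Prod>l<k. 1 - \<phi>' l \<omega>) \<le> 1" if "\<omega> \<in> space \<Omega>" for k \<omega>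
    using \<phi>'01[OF that] by (intro conjI prod_nonneg prod_le_1) auto
  \<comment> \<open>Almost every point has some weight equal to 1, which makes the remaining product
    vanish from that index on; dominated convergence then removes the uncovered mass.\<close>
  have "(\<lambda>k. \<integral>\<omega>. (\<Prod>l<k. 1 - \<phi>' l \<omega>) \<partial>\<Omega>) \<longlonglongrightarrow> (\<integral>\<omega>. 0 \<partial>\<Omega>)"
  proof (rule integral_dominated_convergence[where w = "\<lambda>_. 1"])
    show "AE \<omega> in \<Omega>. (\<lambda>k. \<Prod>l<k. 1 - \<phi>' l \<omega>) \<longlonglongrightarrow> 0"
      using cover
    proof eventually_elim
      fix \<omega> assume "\<exists>l. \<phi>' l \<omega> = 1"
      then obtain l where l: "\<phi>' l \<omega> = 1" ..
      have zero: "(\<Prod>l<k. 1 - \<phi>' l \<omega>) = 0" if "l < k" for k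
        by (rule prod_zero) (use that l in auto)
      have "\<forall>\<^sub>F k in sequentially. (\<Prod>l<k. 1 - \<phi>' l \<omega>) = 0"
        using eventually_gt_at_top[of l] by eventually_elim (rule zero)
      then show "(\<lambda>k. \<Prod>l<k. 1 - \<phi>' l \<omega>) \<longlonglongrightarrow> 0" by (rule tendsto_eventually)
    qed
    show "AE \<omega> in \<Omega>. norm (\<Prod>l<k. 1 - \<phi>' l \<omega>) \<le> 1" for k using P01 by auto
  qed auto
  then have "(\<lambda>k. C * (\<integral>\<omega>. (\<Prod>l<k. 1 - \<phi>' l \<omega>) \<partial>\<Omega>)) \<longlonglongrightarrow> 0"
    by (auto intro: tendsto_eq_intros)
  \<comment> \<open>The truncation \<open>k\<close> is chosen on the limit space alone. Convergence
    of expectations carries the smallness of the rest over to large \<open>n\<close>, and only the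
    indices below \<open>k\<close> matter from here.\<close>
  then obtain k where k: "C * (\<integral>\<omega>. (\<Prod>l<k. 1 - \<phi>' l \<omega>) \<partial>\<Omega>) < \<eta>"
    using \<eta> by (metis (no_types, lifting) eventually_happens' order_tendstoD(2) trivial_limit_sequentially)
  note compl = tendsto_expectation_complements[OF M \<Omega> \<phi> \<phi>01 \<phi>' \<phi>'01 lim]
  have "(\<lambda>n. C * (\<integral>\<omega>. (\<Prod>l<k. 1 - \<phi> n l \<omega>) \<partial>M n)) \<longlonglongrightarrow> C * (\<integral>\<omega>. (\<Prod>l<k. 1 - \<phi>' l \<omega>) \<partial>\<Omega>)"
    using compl[of "{}" k] by (intro tendsto_mult) auto
  then have 1: "\<forall>\<^sub>F n in sequentially. C * (\<integral>\<omega>. (\<Prod>l<k. 1 - \<phi> n l \<omega>) \<partial>M n) < \<eta>"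
    using k by (rule order_tendstoD(2))
  define I where "I n = (\<Sum>i<k. v i * (\<integral>\<omega>. \<phi> n i \<omega> * (\<Prod>l<i. 1 - \<phi> n l \<omega>) \<partial>M n))" for n
  define I' where "I' = (\<Sum>i<k. v i * (\<integral>\<omega>. \<phi>' i \<omega> * (\<Prod>l<i. 1 - \<phi>' l \<omega>) \<partial>\<Omega>))"
  have "I \<longlonglongrightarrow> I'"
    unfolding I_def I'_def
    by (intro tendsto_sum tendsto_mult tendsto_const) (use compl[of "{i}" i for i] in simp)
  then have 2: "\<forall>\<^sub>F n in sequentially. dist (I n) I' < \<eta>" using \<eta> by (rule tendstoD)
  have 3: "\<bar>(\<integral>\<omega>. f' \<omega> \<partial>\<Omega>) - I'\<bar> \<le> \<eta> + C * (\<integral>\<omega>. (\<Prod>l<k. 1 - \<phi>' l \<omega>) \<partial>\<Omega>)"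
    unfolding I'_def
    by (rule \<Omega>.partition_estimate) (use \<phi>'01 f' f'C near' \<eta> in auto)
  have "\<forall>\<^sub>F n in sequentially. \<forall>l<k. \<forall>\<omega>\<in>space (M n). 0 < \<phi> n l \<omega> \<longrightarrow> \<bar>f n \<omega> - v l\<bar> \<le> \<eta>"
  proof -
    have "\<forall>\<^sub>F n in sequentially. \<forall>l\<in>{..<k}. \<forall>\<omega>\<in>space (M n). 0 < \<phi> n l \<omega> \<longrightarrow> \<bar>f n \<omega> - v l\<bar> \<le> \<eta>"
      by (intro eventually_ball_finite ballI near) simp
    then show ?thesis by (rule eventually_mono) auto
  qed
  with 1 2 show ?thesis
  proof eventually_elim
    case (elim n)
    interpret M: prob_space "M n" by (rule M)
    have "\<bar>(\<integral>\<omega>. f n \<omega> \<partial>M n) - I n\<bar> \<le> \<eta> + C * (\<integral>\<omega>. (\<Prod>l<k. 1 - \<phi> n l \<omega>) \<partial>M n)"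
      unfolding I_def
      by (rule M.partition_estimate) (use \<phi>01 f fC \<phi> elim \<eta> in auto)
    with 3 k elim show ?case unfolding dist_real_def by linarith
  qed
qed

section \<open>Uniqueness of the law of Brownian motion\<close>

text \<open>The degenerate case \<open>s = t\<close> is included because the grids used below start
  with the time 0 and may meet 0 again as their next point.\<close>

lemma std_brownian_motion1_increment:
  assumes B: "std_brownian_motion1 M B" and st: "0 \<le> s" "s \<le> t"
  shows "distr M borel (\<lambda>\<omega>. B \<omega> t - B \<omega> s) =
    (if s < t then density lborel (normal_density 0 (sqrt (t - s))) else return borel 0)"
proof (cases "s < t")
  case True
  have "distributed M lborel (\<lambda>\<omega>. B \<omega> t - B \<omega> s) (normal_density 0 (sqrt (t - s)))"
    using B st True by (simp add: std_brownian_motion1_def)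
  then have "distr M lborel (\<lambda>\<omega>. B \<omega> t - B \<omega> s) = density lborel (normal_density 0 (sqrt (t - s)))"
    by (rule distributed_distr_eq_density)
  moreover have "distr M lborel (\<lambda>\<omega>. B \<omega> t - B \<omega> s) = distr M borel (\<lambda>\<omega>. B \<omega> t - B \<omega> s)"
    by (rule distr_cong) auto
  ultimately show ?thesis using True by simp
next
  case False
  interpret prob_space M using B by (simp add: std_brownian_motion1_def)
  show ?thesis using False st by simp
qed

lemma std_brownian_motion1_increments:
  fixes \<tau> :: "nat \<Rightarrow> real"
  assumes B: "std_brownian_motion1 M B" and B': "std_brownian_motion1 M' B'"
    and \<tau>: "0 \<le> \<tau> 0" "\<And>l. l < m \<Longrightarrow> \<tau> l \<le> \<tau> (Suc l)"
  shows "distr M (PiM {..<m} (\<lambda>_. borel)) (\<lambda>\<omega>. \<lambda>l\<in>{..<m}. B \<omega> (\<tau> (Suc l)) - B \<omega> (\<tau> l)) =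
    distr M' (PiM {..<m} (\<lambda>_. borel)) (\<lambda>\<omega>. \<lambda>l\<in>{..<m}. B' \<omega> (\<tau> (Suc l)) - B' \<omega> (\<tau> l))"
\<comment> \<open>The characterisation of independence by a product law is applied to a nonempty
  family, so a grid without increments is settled by hand.\<close>
proof (cases "m = 0")
  case True
  interpret M: prob_space M using B by (simp add: std_brownian_motion1_def)
  interpret M': prob_space M' using B' by (simp add: std_brownian_motion1_def)
  have "(\<lambda>l\<in>{..<m}. f l) = (\<lambda>_. undefined)" for f :: "nat \<Rightarrow> real" using True by (auto simp: restrict_def)
  then show ?thesis using True by (simp add: space_PiM)
next
  case False
  have pos: "0 \<le> \<tau> l" if "l \<le> m" for l
    using that by (induction l) (use \<tau> in \<open>auto intro: order_trans\<close>)
  have law: "distr P (PiM {..<m} (\<lambda>_. borel)) (\<lambda>\<omega>. \<lambda>l\<in>{..<m}. W \<omega> (\<tau> (Suc l)) - W \<omega> (\<tau> l)) =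
      PiM {..<m} (\<lambda>l. if \<tau> l < \<tau> (Suc l) then density lborel (normal_density 0 (sqrt (\<tau> (Suc l) - \<tau> l))) else return borel 0)"
    if W: "std_brownian_motion1 P W" for P :: "'c measure" and W
  proof -
    interpret prob_space P using W by (simp add: std_brownian_motion1_def)
    have [measurable]: "(\<lambda>\<omega>. W \<omega> t) \<in> borel_measurable P" if "0 \<le> t" for t
      using W that by (simp add: std_brownian_motion1_def)
    have "indep_vars (\<lambda>_. borel) (\<lambda>l \<omega>. W \<omega> (\<tau> (Suc l)) - W \<omega> (\<tau> l)) {..<m}"
      using W \<tau> by (simp add: std_brownian_motion1_def)
    then have "distr P (PiM {..<m} (\<lambda>_. borel)) (\<lambda>\<omega>. \<lambda>l\<in>{..<m}. W \<omega> (\<tau> (Suc l)) - W \<omega> (\<tau> l)) =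
        PiM {..<m} (\<lambda>l. distr P borel (\<lambda>\<omega>. W \<omega> (\<tau> (Suc l)) - W \<omega> (\<tau> l)))"
      using False pos by (subst (asm) indep_vars_iff_distr_eq_PiM') auto
    also have "\<dots> = PiM {..<m} (\<lambda>l. if \<tau> l < \<tau> (Suc l) then density lborel (normal_density 0 (sqrt (\<tau> (Suc l) - \<tau> l))) else return borel 0)"
      by (intro PiM_cong refl std_brownian_motion1_increment[OF W]) (use \<tau> pos in auto)
    finally show ?thesis .
  qed
  show ?thesis using law[OF B] law[OF B'] by simp
qed

text \<open>Cylinder events concern values, whereas the definition of Brownian motion prescribes
  increments. Since the path almost surely starts at 0, values are partial sums of increments along
  the times of \<open>J\<close> with 0 put in front; hence the shift
  \<open>\<tau> (Suc l) = xs ! l\<close>.\<close>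

lemma std_brownian_motion1_cylinder:
  assumes B: "std_brownian_motion1 M B" and J: "finite J" "J \<subseteq> {0..}" and A: "\<And>t. t \<in> J \<Longrightarrow> A t \<in> sets borel"
  defines "xs \<equiv> sorted_list_of_set J"
  defines "\<tau> \<equiv> (\<lambda>l. (0 # xs) ! l)"
  shows "emeasure (distr M (PiM {0..} (\<lambda>_. borel)) (\<lambda>\<omega>. \<lambda>t\<in>{0..}. B \<omega> t)) (prod_emb {0..} (\<lambda>_. borel) J (Pi\<^sub>E J A)) =
    emeasure (distr M (PiM {..<length xs} (\<lambda>_. borel)) (\<lambda>\<omega>. \<lambda>l\<in>{..<length xs}. B \<omega> (\<tau> (Suc l)) - B \<omega> (\<tau> l)))
      {d \<in> space (PiM {..<length xs} (\<lambda>_. borel)). \<forall>l<length xs. (\<Sum>i<Suc l. d i) \<in> A (xs ! l)}"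
    (is "emeasure ?P ?E = emeasure ?Q ?F")
    and "0 \<le> \<tau> 0" and "\<And>l. l < length xs \<Longrightarrow> \<tau> l \<le> \<tau> (Suc l)"
proof -
  interpret prob_space M using B by (simp add: std_brownian_motion1_def)
  have xs: "set xs = J" "sorted xs" "distinct xs" using J by (auto simp: xs_def)
  show \<tau>0: "0 \<le> \<tau> 0" by (simp add: \<tau>_def)
  have "sorted (0 # xs)" using xs J by auto
  then show mono: "\<tau> l \<le> \<tau> (Suc l)" if "l < length xs" for l
    using that unfolding \<tau>_def by (intro sorted_nth_mono) auto
  have in_J: "xs ! l \<in> J" if "l < length xs" for l using xs that by auto
  have nonneg: "0 \<le> \<tau> l" if "l \<le> length xs" for l
    using in_J[of "l - 1"] J that by (cases l) (auto simp: \<tau>_def)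
  have meas: "(\<lambda>\<omega>. B \<omega> t) \<in> borel_measurable M" if "0 \<le> t" for t
    using B that by (simp add: std_brownian_motion1_def)
  have zero: "AE \<omega> in M. B \<omega> 0 = 0"
    using B by (auto simp: std_brownian_motion1_def elim: AE_mp)
  have mP: "(\<lambda>\<omega>. \<lambda>t\<in>{0..}. B \<omega> t) \<in> M \<rightarrow>\<^sub>M PiM {0..} (\<lambda>_. borel)"
    by (intro measurable_restrict meas) auto
  have mQ: "(\<lambda>\<omega>. \<lambda>l\<in>{..<length xs}. B \<omega> (\<tau> (Suc l)) - B \<omega> (\<tau> l)) \<in> M \<rightarrow>\<^sub>M PiM {..<length xs} (\<lambda>_. borel)"
    by (intro measurable_restrict borel_measurable_diff meas nonneg) auto
  have E: "?E \<in> sets (PiM {0..} (\<lambda>_. borel))"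
    using J A by (intro measurable_prod_emb sets_PiM_I_finite) auto
  have F: "?F \<in> sets (PiM {..<length xs} (\<lambda>_. borel))"
  proof -
    have [measurable]: "(\<lambda>d. \<Sum>i<Suc l. d i) \<in> borel_measurable (PiM {..<length xs} (\<lambda>_. borel :: real measure))"
      if "l < length xs" for l
      using that by (intro borel_measurable_sum measurable_component_singleton) auto
    have "?F = (\<Inter>l\<in>{..<length xs}. {d \<in> space (PiM {..<length xs} (\<lambda>_. borel)). (\<Sum>i<Suc l. d i) \<in> A (xs ! l)}) \<inter> space (PiM {..<length xs} (\<lambda>_. borel))"
      by auto
    also have "\<dots> \<in> sets (PiM {..<length xs} (\<lambda>_. borel))"
    proof (cases "length xs = 0")
      case False
      have "{d \<in> space (PiM {..<length xs} (\<lambda>_. borel)). (\<Sum>i<Suc l. d i) \<in> A (xs ! l)} \<in> sets (PiM {..<length xs} (\<lambda>_. borel))"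
        if "l < length xs" for l
        by (rule measurable_sets_Collect[of "\<lambda>d. \<Sum>i<Suc l. d i" _ borel "\<lambda>r. r \<in> A (xs ! l)", OF _ ])
          (use that A[OF in_J[OF that]] in \<open>auto intro!: borel_measurable_sum measurable_component_singleton\<close>)
      then show ?thesis using False by (intro sets.Int sets.finite_INT) auto
    qed auto
    finally show ?thesis .
  qed
  have "emeasure ?P ?E = emeasure M ((\<lambda>\<omega>. \<lambda>t\<in>{0..}. B \<omega> t) -` ?E \<inter> space M)"
    by (rule emeasure_distr[OF mP E])
  also have "\<dots> = emeasure M ((\<lambda>\<omega>. \<lambda>l\<in>{..<length xs}. B \<omega> (\<tau> (Suc l)) - B \<omega> (\<tau> l)) -` ?F \<inter> space M)"
  proof (rule emeasure_eq_AE)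
    show "AE \<omega> in M. \<omega> \<in> (\<lambda>\<omega>. \<lambda>t\<in>{0..}. B \<omega> t) -` ?E \<inter> space M \<longleftrightarrow>
      \<omega> \<in> (\<lambda>\<omega>. \<lambda>l\<in>{..<length xs}. B \<omega> (\<tau> (Suc l)) - B \<omega> (\<tau> l)) -` ?F \<inter> space M"
      using zero AE_space
    proof eventually_elim
      case (elim \<omega>)
      have "(\<Sum>i<Suc l. (\<lambda>l\<in>{..<length xs}. B \<omega> (\<tau> (Suc l)) - B \<omega> (\<tau> l)) i) = B \<omega> (xs ! l)"
        if "l < length xs" for l
      proof -
        have "(\<Sum>i<Suc l. (\<lambda>l\<in>{..<length xs}. B \<omega> (\<tau> (Suc l)) - B \<omega> (\<tau> l)) i) =
          (\<Sum>i<Suc l. B \<omega> (\<tau> (Suc i)) - B \<omega> (\<tau> i))"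
          using that by (intro sum.cong) auto
        also have "\<dots> = B \<omega> (\<tau> (Suc l)) - B \<omega> (\<tau> 0)" by (rule sum_lessThan_telescope)
        finally show ?thesis using elim by (simp add: \<tau>_def)
      qed
      then have "(\<lambda>l\<in>{..<length xs}. B \<omega> (\<tau> (Suc l)) - B \<omega> (\<tau> l)) \<in> ?F \<longleftrightarrow> (\<forall>l<length xs. B \<omega> (xs ! l) \<in> A (xs ! l))"
        by (auto simp: space_PiM simp del: sum.lessThan_Suc)
      also have "\<dots> \<longleftrightarrow> (\<forall>t\<in>J. B \<omega> t \<in> A t)" unfolding xs(1)[symmetric] by (simp add: all_set_conv_all_nth)
      also have "\<dots> \<longleftrightarrow> (\<lambda>t\<in>{0..}. B \<omega> t) \<in> ?E"
        using J by (auto simp: prod_emb_def PiE_iff subset_iff)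
      finally show ?case using elim by simp
    qed
  qed (rule measurable_sets[OF mP E], rule measurable_sets[OF mQ F])
  also have "\<dots> = emeasure ?Q ?F" by (rule emeasure_distr[OF mQ F, symmetric])
  finally show "emeasure ?P ?E = emeasure ?Q ?F" .
qed

text \<open>Finite measures on an infinite product agree if they agree on finite-dimensional
  cylinders, and those are governed by laws of increments.\<close>

lemma std_brownian_motion1_law_unique:
  assumes B: "std_brownian_motion1 M B" and B': "std_brownian_motion1 M' B'"
  shows "distr M (PiM {0..} (\<lambda>_. borel)) (\<lambda>\<omega>. \<lambda>t\<in>{0..}. B \<omega> t) =
    distr M' (PiM {0..} (\<lambda>_. borel)) (\<lambda>\<omega>. \<lambda>t\<in>{0..}. B' \<omega> t)"
proof (rule measure_eqI_PiM_infinite[where I = "{0..}" and M = "\<lambda>_. borel"])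
  interpret prob_space M using B by (simp add: std_brownian_motion1_def)
  have "(\<lambda>\<omega>. \<lambda>t\<in>{0..}. B \<omega> t) \<in> M \<rightarrow>\<^sub>M PiM {0..} (\<lambda>_. borel)"
    using B by (intro measurable_restrict) (auto simp: std_brownian_motion1_def)
  then show "finite_measure (distr M (PiM {0..} (\<lambda>_. borel)) (\<lambda>\<omega>. \<lambda>t\<in>{0..}. B \<omega> t))"
    by (rule finite_measure_distr)
next
  fix A :: "real \<Rightarrow> real set" and J :: "real set"
  assume J: "finite J" "J \<subseteq> {0..}" and A: "\<And>i. i \<in> J \<Longrightarrow> A i \<in> sets borel"
  note cyl = std_brownian_motion1_cylinder[OF _ J A]
  show "emeasure (distr M (PiM {0..} (\<lambda>_. borel)) (\<lambda>\<omega>. \<lambda>t\<in>{0..}. B \<omega> t)) (prod_emb {0..} (\<lambda>_. borel) J (Pi\<^sub>E J A)) =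
    emeasure (distr M' (PiM {0..} (\<lambda>_. borel)) (\<lambda>\<omega>. \<lambda>t\<in>{0..}. B' \<omega> t)) (prod_emb {0..} (\<lambda>_. borel) J (Pi\<^sub>E J A))"
  proof -
    define xs where "xs = sorted_list_of_set J"
    define \<tau> where "\<tau> l = (0 # xs) ! l" for l
    define F where "F = {d \<in> space (PiM {..<length xs} (\<lambda>_. borel)). \<forall>l<length xs. (\<Sum>i<Suc l. d i) \<in> A (xs ! l)}"
    note cyl' = cyl[folded xs_def, folded \<tau>_def, folded F_def]
    have "distr M (PiM {..<length xs} (\<lambda>_. borel)) (\<lambda>\<omega>. \<lambda>l\<in>{..<length xs}. B \<omega> (\<tau> (Suc l)) - B \<omega> (\<tau> l)) =
        distr M' (PiM {..<length xs} (\<lambda>_. borel)) (\<lambda>\<omega>. \<lambda>l\<in>{..<length xs}. B' \<omega> (\<tau> (Suc l)) - B' \<omega> (\<tau> l))"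
      by (rule std_brownian_motion1_increments[OF B B' cyl'(2,3)[OF B]])
    then show ?thesis by (simp only: cyl'(1)[OF B] cyl'(1)[OF B'])
  qed
qed auto

lemma std_brownian_motion_law_unique:
  assumes B: "std_brownian_motion M I B" and B': "std_brownian_motion M' I B'"
  shows "distr M (PiM {0..} (\<lambda>_. PiM I (\<lambda>_. borel))) (\<lambda>\<omega>. \<lambda>t\<in>{0..}. \<lambda>p\<in>I. B \<omega> t p) =
    distr M' (PiM {0..} (\<lambda>_. PiM I (\<lambda>_. borel))) (\<lambda>\<omega>. \<lambda>t\<in>{0..}. \<lambda>p\<in>I. B' \<omega> t p)"
proof -
  interpret M: prob_space M using B by (simp add: std_brownian_motion_def)
  interpret M': prob_space M' using B' by (simp add: std_brownian_motion_def)
  define Q where "Q = PiM I (\<lambda>_. PiM {0::real..} (\<lambda>_. borel :: real measure))"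
  define P where "P = PiM {0::real..} (\<lambda>_. PiM I (\<lambda>_. borel :: real measure))"
  have m: "(\<lambda>\<omega>. \<lambda>t\<in>{0..}. B \<omega> t p) \<in> M \<rightarrow>\<^sub>M PiM {0..} (\<lambda>_. borel)" if "p \<in> I" for p
    using B that by (intro measurable_restrict) (auto simp: std_brownian_motion_def std_brownian_motion1_def)
  have m': "(\<lambda>\<omega>. \<lambda>t\<in>{0..}. B' \<omega> t p) \<in> M' \<rightarrow>\<^sub>M PiM {0..} (\<lambda>_. borel)" if "p \<in> I" for p
    using B' that by (intro measurable_restrict) (auto simp: std_brownian_motion_def std_brownian_motion1_def)
  have eq: "distr M Q (\<lambda>\<omega>. \<lambda>p\<in>I. \<lambda>t\<in>{0..}. B \<omega> t p) = distr M' Q (\<lambda>\<omega>. \<lambda>p\<in>I. \<lambda>t\<in>{0..}. B' \<omega> t p)"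
  proof (cases "I = {}")
    case True
    then show ?thesis by (simp add: Q_def restrict_def space_PiM)
  next
    case False
    have "distr M Q (\<lambda>\<omega>. \<lambda>p\<in>I. \<lambda>t\<in>{0..}. B \<omega> t p) = PiM I (\<lambda>p. distr M (PiM {0..} (\<lambda>_. borel)) (\<lambda>\<omega>. \<lambda>t\<in>{0..}. B \<omega> t p))"
      using B unfolding Q_def std_brownian_motion_def
      by (subst M.indep_vars_iff_distr_eq_PiM'[symmetric, OF False m]) auto
    also have "\<dots> = PiM I (\<lambda>p. distr M' (PiM {0..} (\<lambda>_. borel)) (\<lambda>\<omega>. \<lambda>t\<in>{0..}. B' \<omega> t p))"
      using B B' by (intro PiM_cong refl std_brownian_motion1_law_unique) (auto simp: std_brownian_motion_def)
    finally have "distr M Q (\<lambda>\<omega>. \<lambda>p\<in>I. \<lambda>t\<in>{0..}. B \<omega> t p) = PiM I (\<lambda>p. distr M' (PiM {0..} (\<lambda>_. borel)) (\<lambda>\<omega>. \<lambda>t\<in>{0..}. B' \<omega> t p))" .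
    moreover have "distr M' Q (\<lambda>\<omega>. \<lambda>p\<in>I. \<lambda>t\<in>{0..}. B' \<omega> t p) = PiM I (\<lambda>p. distr M' (PiM {0..} (\<lambda>_. borel)) (\<lambda>\<omega>. \<lambda>t\<in>{0..}. B' \<omega> t p))"
      using B' unfolding Q_def std_brownian_motion_def
      by (subst M'.indep_vars_iff_distr_eq_PiM'[symmetric, OF False m']) auto
    ultimately show ?thesis by simp
  qed
  \<comment> \<open>Independence of the coordinates describes a family of paths indexed by
    coordinates, whereas path functionals live on families of points indexed by time;
    \<open>tr\<close> exchanges the two arguments.\<close>
  define tr where "tr z = (\<lambda>t\<in>{0..}. \<lambda>p\<in>I. z p t)" for z :: "'b \<Rightarrow> real \<Rightarrow> real"
  have tr: "tr \<in> Q \<rightarrow>\<^sub>M P"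
    unfolding tr_def P_def
  proof (intro measurable_restrict)
    fix t :: real and p assume *: "t \<in> {0..}" "p \<in> I"
    show "(\<lambda>z. z p t) \<in> borel_measurable Q"
      unfolding Q_def
      by (rule measurable_compose[OF measurable_component_singleton[OF *(2)] measurable_component_singleton[OF *(1)]])
  qed
  have Bm: "(\<lambda>\<omega>. \<lambda>p\<in>I. \<lambda>t\<in>{0..}. B \<omega> t p) \<in> M \<rightarrow>\<^sub>M Q"
    unfolding Q_def by (rule measurable_restrict) (rule m)
  have Bm': "(\<lambda>\<omega>. \<lambda>p\<in>I. \<lambda>t\<in>{0..}. B' \<omega> t p) \<in> M' \<rightarrow>\<^sub>M Q"
    unfolding Q_def by (rule measurable_restrict) (rule m')
  have "distr (distr M Q (\<lambda>\<omega>. \<lambda>p\<in>I. \<lambda>t\<in>{0..}. B \<omega> t p)) P tr = distr M P (\<lambda>\<omega>. \<lambda>t\<in>{0..}. \<lambda>p\<in>I. B \<omega> t p)"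
    unfolding distr_distr[OF tr Bm] by (intro distr_cong) (auto simp: tr_def fun_eq_iff)
  moreover have "distr (distr M' Q (\<lambda>\<omega>. \<lambda>p\<in>I. \<lambda>t\<in>{0..}. B' \<omega> t p)) P tr = distr M' P (\<lambda>\<omega>. \<lambda>t\<in>{0..}. \<lambda>p\<in>I. B' \<omega> t p)"
    unfolding distr_distr[OF tr Bm'] by (intro distr_cong) (auto simp: tr_def fun_eq_iff)
  ultimately show ?thesis using eq by (simp add: P_def)
qed

section \<open>Bump functionals\<close>

text \<open>The plateau up to 1 is what the covering of the limit law uses, the support up to 2 is
  what the stability estimate uses; the slope between them gives the Lipschitz constant 1.\<close>

definition bump :: "real \<Rightarrow> real" where
  "bump v = max 0 (min 1 (2 - v))"

lemma bump_bounds: "0 \<le> bump v" "bump v \<le> 1"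
  by (auto simp: bump_def)

lemma bump_eq_1: "v \<le> 1 \<Longrightarrow> bump v = 1"
  by (auto simp: bump_def)

lemma bump_pos: "0 < bump v \<Longrightarrow> v < 2"
  by (auto simp: bump_def max_def min_def split: if_splits)

lemma bump_lipschitz: "\<bar>bump u - bump v\<bar> \<le> \<bar>u - v\<bar>"
  by (auto simp: bump_def max_def min_def)

lemma continuous_bump: "continuous_on A bump"
  unfolding bump_def by (intro continuous_intros)

lemma measurable_bump[measurable]: "bump \<in> borel_measurable borel"
  unfolding bump_def by measurable

definition start_bump :: "'i set \<Rightarrow> real \<Rightarrow> ('i \<Rightarrow> real) \<Rightarrow> ('i \<Rightarrow> real) \<Rightarrow> real" where
  "start_bump I r q x = (\<Prod>p\<in>I. bump (\<bar>x p - q p\<bar> / r))"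

text \<open>Countably many times keep the infimum measurable for the coordinate evaluations, and
  right continuity recovers the others. The infimum of bumps is a bump of the uniform distance. The
  initial value is subtracted so that only increments of the driver enter.\<close>

definition path_bump :: "'i set \<Rightarrow> real \<Rightarrow> real \<Rightarrow> (real \<Rightarrow> 'i \<Rightarrow> real) \<Rightarrow> (real \<Rightarrow> 'i \<Rightarrow> real) \<Rightarrow> real" where
  "path_bump I T r s z = (\<Prod>p\<in>I. INF t\<in>{0..T} \<inter> \<rat>. bump (\<bar>z t p - z 0 p - s t p\<bar> / r))"

lemma start_bump_bounds: "0 \<le> start_bump I r q x" "start_bump I r q x \<le> 1"
  unfolding start_bump_def by (auto intro!: prod_nonneg prod_le_1 bump_bounds)

lemma start_bump_eq_1:
  assumes "0 < r" "\<And>p. p \<in> I \<Longrightarrow> \<bar>x p - q p\<bar> \<le> r"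
  shows "start_bump I r q x = 1"
  unfolding start_bump_def using assms by (intro prod.neutral ballI bump_eq_1) auto

lemma start_bump_pos:
  assumes "0 < start_bump I r q x" "0 < r" "finite I" "p \<in> I"
  shows "\<bar>x p - q p\<bar> < 2 * r"
proof -
  have "bump (\<bar>x p - q p\<bar> / r) \<noteq> 0"
  proof
    assume "bump (\<bar>x p - q p\<bar> / r) = 0"
    then have "start_bump I r q x = 0"
      unfolding start_bump_def using assms(3,4) by (intro prod_zero) auto
    with assms(1) show False by simp
  qed
  then have "0 < bump (\<bar>x p - q p\<bar> / r)" using bump_bounds(1) by (simp add: less_le)
  from bump_pos[OF this] show ?thesis using assms(2) by (simp add: field_simps)
qed

lemma continuous_map_prod_real:
  assumes "finite I" "\<And>i. i \<in> I \<Longrightarrow> continuous_map X euclideanreal (f i)"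
  shows "continuous_map X euclideanreal (\<lambda>x. \<Prod>i\<in>I. f i x)"
  using assms by (induction I) (auto intro: continuous_map_real_mult)

lemma continuous_map_start_bump:
  assumes "finite I" "0 < r"
  shows "continuous_map (product_topology (\<lambda>_. euclideanreal) I) euclideanreal (start_bump I r q)"
proof -
  have "continuous_map (product_topology (\<lambda>_. euclideanreal) I) euclideanreal (\<lambda>x. bump (\<bar>x p - q p\<bar> / r))"
    if "p \<in> I" for p
  proof -
    have "continuous_map euclideanreal euclideanreal (\<lambda>v. bump (\<bar>v - q p\<bar> / r))"
      using assms(2)
      by (auto intro!: continuous_intros continuous_on_compose2[OF continuous_bump[of UNIV]])
    from continuous_map_compose[OF continuous_map_product_coordinates[OF that] this]
    show ?thesis by (simp add: o_def)
  qed
  then show ?thesis unfolding start_bump_def by (intro continuous_map_prod_real assms)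
qed

lemma measurable_start_bump: "start_bump I r q \<in> borel_measurable (PiM I (\<lambda>_. borel))"
  unfolding start_bump_def by measurable

lemma bdd_below_bump: "bdd_below ((\<lambda>t. bump (f t)) ` A)"
  by (rule bdd_belowI2[of _ 0]) (rule bump_bounds)

lemma INF_bump_bounds:
  assumes "A \<noteq> {}"
  shows "0 \<le> (INF t\<in>A. bump (f t))" "(INF t\<in>A. bump (f t)) \<le> 1"
proof -
  show "0 \<le> (INF t\<in>A. bump (f t))" using assms by (intro cINF_greatest bump_bounds)
  obtain a where "a \<in> A" using assms by blast
  then show "(INF t\<in>A. bump (f t)) \<le> 1" by (intro cINF_lower2[OF bdd_below_bump _ bump_bounds(2)])
qed

lemma INF_bump_lipschitz:
  assumes "A \<noteq> {}" "\<And>t. t \<in> A \<Longrightarrow> \<bar>f t - g t\<bar> \<le> e"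
  shows "\<bar>(INF t\<in>A. bump (f t)) - (INF t\<in>A. bump (g t))\<bar> \<le> e"
proof -
  have "(INF t\<in>A. bump (f t)) - e \<le> (INF t\<in>A. bump (g t))"
    if "\<And>t. t \<in> A \<Longrightarrow> \<bar>f t - g t\<bar> \<le> e" for f g :: "'a \<Rightarrow> real"
  proof (rule cINF_greatest[OF assms(1)])
    fix t assume t: "t \<in> A"
    have "(INF t\<in>A. bump (f t)) \<le> bump (f t)" by (rule cINF_lower[OF bdd_below_bump t])
    then show "(INF t\<in>A. bump (f t)) - e \<le> bump (g t)"
      using bump_lipschitz[of "f t" "g t"] that[OF t] by linarith
  qed
  from this[of f g] this[of g f] assms(2) show ?thesis by (auto simp: abs_le_iff abs_minus_commute)
qed

lemma rational_times_nonempty: "0 \<le> T \<Longrightarrow> {0..T} \<inter> \<rat> \<noteq> ({} :: real set)"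
  using Rats_0 by fastforce

lemma path_bump_bounds:
  assumes "0 \<le> T"
  shows "0 \<le> path_bump I T r s z" "path_bump I T r s z \<le> 1"
  unfolding path_bump_def
  using INF_bump_bounds[OF rational_times_nonempty[OF assms]] by (auto intro!: prod_nonneg prod_le_1)

lemma path_bump_eq_1:
  assumes "0 < r" "0 \<le> T" "\<And>t p. 0 \<le> t \<Longrightarrow> t \<le> T \<Longrightarrow> p \<in> I \<Longrightarrow> \<bar>z t p - z 0 p - s t p\<bar> \<le> r"
  shows "path_bump I T r s z = 1"
  unfolding path_bump_def
proof (rule prod.neutral, rule ballI)
  fix p assume p: "p \<in> I"
  have "(INF t\<in>{0..T} \<inter> \<rat>. bump (\<bar>z t p - z 0 p - s t p\<bar> / r)) = (INF t\<in>{0..T} \<inter> \<rat>. 1)"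
    using assms p by (intro INF_cong refl bump_eq_1) auto
  then show "(INF t\<in>{0..T} \<inter> \<rat>. bump (\<bar>z t p - z 0 p - s t p\<bar> / r)) = 1"
    using rational_times_nonempty[OF assms(2)] by simp
qed

text \<open>A positive infimum gives distance below \<open>2 * r\<close> at rational times; right
  continuity extends the bound, no longer strict, to all times before \<open>T\<close>.\<close>

lemma path_bump_pos:
  assumes pos: "0 < path_bump I T r s z" and r: "0 < r" and I: "finite I" "p \<in> I" and T: "T \<in> \<rat>"
    and z: "\<And>t. 0 \<le> t \<Longrightarrow> ((\<lambda>u. z u p) \<longlongrightarrow> z t p) (at_right t)"
    and s: "\<And>t. 0 \<le> t \<Longrightarrow> ((\<lambda>u. s u p) \<longlongrightarrow> s t p) (at_right t)"
    and t: "0 \<le> t" "t \<le> T"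
  shows "\<bar>z t p - z 0 p - s t p\<bar> \<le> 2 * r"
proof (rule ccontr)
  define g where "g u = \<bar>z u p - z 0 p - s u p\<bar>" for u
  assume "\<not> ?thesis"
  then have gt: "2 * r < g t" by (simp add: g_def)
  have ne: "{0..T} \<inter> \<rat> \<noteq> {}" using t by (intro rational_times_nonempty) auto
  have "(INF t\<in>{0..T} \<inter> \<rat>. bump (g t / r)) \<noteq> 0"
  proof
    assume "(INF t\<in>{0..T} \<inter> \<rat>. bump (g t / r)) = 0"
    then have "path_bump I T r s z = 0"
      unfolding path_bump_def g_def by (intro prod_zero I(1) bexI[OF _ I(2)])
    with pos show False by simp
  qed
  then have INF_pos: "0 < (INF t\<in>{0..T} \<inter> \<rat>. bump (g t / r))"
    using INF_bump_bounds(1)[OF ne, of "\<lambda>t. g t / r"] by linarith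
  have rat: "g u < 2 * r" if "0 \<le> u" "u \<le> T" "u \<in> \<rat>" for u
  proof -
    have "(INF t\<in>{0..T} \<inter> \<rat>. bump (g t / r)) \<le> bump (g u / r)"
      by (rule cINF_lower[OF bdd_below_bump]) (use that in auto)
    then have "g u / r < 2" using INF_pos by (intro bump_pos) linarith
    then show ?thesis using r by (simp add: field_simps)
  qed
  \<comment> \<open>The end point has no rational times to its right within \<open>{0..T}\<close>;
    it is covered because \<open>T\<close> itself is rational.\<close>
  have "t \<noteq> T" using rat[of t] t T gt by auto
  then have tT: "t < T" using t by simp
  have "(g \<longlongrightarrow> g t) (at_right t)"
    unfolding g_def using z[OF t(1)] s[OF t(1)] by (intro tendsto_intros)
  then have "\<forall>\<^sub>F u in at_right t. 2 * r < g u" using gt by (rule order_tendstoD(1))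
  then obtain b where b: "b > t" "\<And>u. t < u \<Longrightarrow> u < b \<Longrightarrow> 2 * r < g u"
    unfolding eventually_at_right_field by blast
  obtain u where "u \<in> \<rat>" "t < u" "u < min b T" using Rats_dense_in_real[of t "min b T"] b(1) tT by auto
  then show False using b(2)[of u] rat[of u] t by auto
qed

lemma measurable_path_bump: "path_bump I T r s \<in> borel_measurable (PiM {0..} (\<lambda>_. PiM I (\<lambda>_. borel)))"
  unfolding path_bump_def
proof (intro borel_measurable_prod borel_measurable_cINF bdd_below_bump)
  show "countable ({0..T} \<inter> \<rat>)" by (intro countable_Int2 countable_rat)
  fix p t assume p: "p \<in> I" and t: "t \<in> {0..T} \<inter> \<rat>"
  have coord: "(\<lambda>z. z t p) \<in> borel_measurable (PiM {0::real..} (\<lambda>_. PiM I (\<lambda>_. borel)))" if "0 \<le> t" for t :: real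
    by (rule measurable_compose[of "\<lambda>z. z t" _ "PiM I (\<lambda>_. borel)" "\<lambda>x. x p"])
      (use that p in \<open>auto intro: measurable_component_singleton\<close>)
  have [measurable]: "(\<lambda>z. z t p) \<in> borel_measurable (PiM {0..} (\<lambda>_. PiM I (\<lambda>_. borel)))"
    "(\<lambda>z. z 0 p) \<in> borel_measurable (PiM {0::real..} (\<lambda>_. PiM I (\<lambda>_. borel)))"
    using t by (intro coord; simp)+
  show "(\<lambda>z. bump (\<bar>z t p - z 0 p - s t p\<bar> / r)) \<in> borel_measurable (PiM {0..} (\<lambda>_. PiM I (\<lambda>_. borel)))"
    by measurable
qed

section \<open>Continuity for uniform convergence on compacts, in terms of \<epsilon> and
  \<delta>\<close>

lemma continuous_map_uccI:
  assumes "\<And>x e. x \<in> cadlag_paths I \<Longrightarrow> 0 < e \<Longrightarrow> \<exists>T\<ge>0. \<exists>\<delta>>0. \<forall>y\<in>cadlag_paths I.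
    (\<forall>t\<in>{0..T}. \<forall>p\<in>I. \<bar>y t p - x t p\<bar> < \<delta>) \<longrightarrow> \<bar>F y - F x\<bar> < e"
  shows "continuous_map (ucc_topology I) euclideanreal F"
  unfolding continuous_map_def
proof (intro conjI allI impI)
  fix U :: "real set" assume "openin euclideanreal U"
  then have U: "open U" by simp
  show "openin (ucc_topology I) {x \<in> topspace (ucc_topology I). F x \<in> U}"
    unfolding openin_ucc_topology topspace_ucc_topology
  proof (intro conjI ballI)
    fix x assume x: "x \<in> {x \<in> cadlag_paths I. F x \<in> U}"
    then obtain e where e: "e > 0" "\<And>v. \<bar>v - F x\<bar> < e \<Longrightarrow> v \<in> U"
      using U unfolding open_dist dist_real_def by blast
    obtain T \<delta> where T: "T \<ge> 0" "\<delta> > 0" "\<And>y. y \<in> cadlag_paths I \<Longrightarrow>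
      (\<forall>t\<in>{0..T}. \<forall>p\<in>I. \<bar>y t p - x t p\<bar> < \<delta>) \<Longrightarrow> \<bar>F y - F x\<bar> < e"
      using assms[of x e] x e(1) by blast
    then show "\<exists>T\<ge>0. \<exists>\<delta>>0. \<forall>y\<in>cadlag_paths I. (\<forall>t\<in>{0..T}. \<forall>p\<in>I. \<bar>y t p - x t p\<bar> < \<delta>) \<longrightarrow>
      y \<in> {x \<in> cadlag_paths I. F x \<in> U}"
      using e(2) by (intro exI[of _ T] exI[of _ \<delta>] conjI) auto
  qed auto
qed auto

lemma continuous_map_uccD:
  assumes F: "continuous_map (ucc_topology I) euclideanreal F" and x: "x \<in> cadlag_paths I" and e: "0 < e"
  shows "\<exists>T\<ge>0. \<exists>\<delta>>0. \<forall>y\<in>cadlag_paths I. (\<forall>t\<in>{0..T}. \<forall>p\<in>I. \<bar>y t p - x t p\<bar> < \<delta>) \<longrightarrow> \<bar>F y - F x\<bar> < e"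
proof -
  have "openin (ucc_topology I) {y \<in> cadlag_paths I. F y \<in> ball (F x) e}"
    using openin_continuous_map_preimage[OF F, of "ball (F x) e"] by (simp add: topspace_ucc_topology)
  note op = openin_ucc_topology[THEN iffD1, OF this, THEN conjunct2]
  have "x \<in> {y \<in> cadlag_paths I. F y \<in> ball (F x) e}" using x e by simp
  from bspec[OF op this] obtain T \<delta> where T: "T \<ge> 0" "\<delta> > 0" "\<forall>y\<in>cadlag_paths I.
      (\<forall>t\<in>{0..T}. \<forall>p\<in>I. \<bar>y t p - x t p\<bar> < \<delta>) \<longrightarrow> y \<in> {y \<in> cadlag_paths I. F y \<in> ball (F x) e}"
    by blast
  then show ?thesis by (intro exI[of _ T] exI[of _ \<delta>]) (auto simp: dist_real_def abs_minus_commute)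
qed

lemma continuous_map_INF_bump:
  assumes p: "p \<in> I" and r: "0 < r" and T: "0 \<le> T"
  shows "continuous_map (ucc_topology I) euclideanreal
    (\<lambda>z. INF t\<in>{0..T} \<inter> \<rat>. bump (\<bar>z t p - z 0 p - s t p\<bar> / r))" (is "continuous_map _ _ ?F")
proof (rule continuous_map_uccI)
  fix x and e :: real assume e: "0 < e"
  \<comment> \<open>The path enters at the times \<open>t\<close> and 0, so two errors of
    \<open>e * r / 4\<close> add up, and division by \<open>r\<close> leaves
    \<open>e / 2\<close>.\<close>
  have lip: "\<bar>?F y - ?F x\<bar> < e" if y: "\<forall>t\<in>{0..T}. \<forall>p\<in>I. \<bar>y t p - x t p\<bar> < e * r / 4" for y
  proof -
    have "\<bar>?F y - ?F x\<bar> \<le> e / 2"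
    proof (rule INF_bump_lipschitz[OF rational_times_nonempty[OF T]])
      fix t assume t: "t \<in> {0..T} \<inter> \<rat>"
      have "\<bar>y t p - x t p\<bar> < e * r / 4" "\<bar>y 0 p - x 0 p\<bar> < e * r / 4" using y t p T by auto
      then have "\<bar>\<bar>y t p - y 0 p - s t p\<bar> - \<bar>x t p - x 0 p - s t p\<bar>\<bar> \<le> e * r / 2" by linarith
      then have "\<bar>\<bar>y t p - y 0 p - s t p\<bar> - \<bar>x t p - x 0 p - s t p\<bar>\<bar> / r \<le> e / 2"
        using r by (simp add: field_simps)
      then show "\<bar>\<bar>y t p - y 0 p - s t p\<bar> / r - \<bar>x t p - x 0 p - s t p\<bar> / r\<bar> \<le> e / 2"
        using r by (simp flip: diff_divide_distrib)
    qed
    then show ?thesis using e by linarith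
  qed
  show "\<exists>T\<ge>0. \<exists>\<delta>>0. \<forall>y\<in>cadlag_paths I. (\<forall>t\<in>{0..T}. \<forall>p\<in>I. \<bar>y t p - x t p\<bar> < \<delta>) \<longrightarrow> \<bar>?F y - ?F x\<bar> < e"
  proof (rule exI[of _ T], intro exI[of _ "e * r / 4"] conjI ballI impI)
    fix y assume "\<forall>t\<in>{0..T}. \<forall>p\<in>I. \<bar>y t p - x t p\<bar> < e * r / 4"
    then show "\<bar>?F y - ?F x\<bar> < e" by (rule lip)
  qed (use T e r in auto)
qed

lemma continuous_map_path_bump:
  assumes "finite I" "0 < r" "0 \<le> T"
  shows "continuous_map (ucc_topology I) euclideanreal (path_bump I T r s)"
  unfolding path_bump_def by (intro continuous_map_prod_real continuous_map_INF_bump assms)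

text \<open>Coded by a natural number and a rational list, hence countably many. Beyond the end of
  the list the value is unspecified, but still a function of the integer part, so right continuity
  holds at all times.\<close>

definition step_path :: "nat \<Rightarrow> rat list \<Rightarrow> real \<Rightarrow> real" where
  "step_path m qs t = of_rat (qs ! nat \<lfloor>real m * t\<rfloor>)"

lemma step_path_right_continuous:
  assumes "0 < m"
  shows "(step_path m qs \<longlongrightarrow> step_path m qs t) (at_right t)"
proof (rule tendsto_eventually)
  have "t < (of_int \<lfloor>real m * t\<rfloor> + 1) / real m" using assms by (simp add: field_simps) linarith
  from eventually_at_right_real[OF this]
  show "\<forall>\<^sub>F u in at_right t. step_path m qs u = step_path m qs t"
  proof eventually_elim
    case (elim u)
    have "\<lfloor>real m * u\<rfloor> = \<lfloor>real m * t\<rfloor>"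
    proof (rule floor_unique)
      have "real m * t \<le> real m * u" using elim by (intro mult_left_mono) auto
      then show "of_int \<lfloor>real m * t\<rfloor> \<le> real m * u" by linarith
      show "real m * u < of_int \<lfloor>real m * t\<rfloor> + 1" using elim assms by (simp add: field_simps)
    qed
    then show ?case by (simp add: step_path_def)
  qed
qed

lemma step_path_approximation:
  fixes c :: "real \<Rightarrow> real"
  assumes c: "continuous_on {0..T} c" and r: "0 < r"
  shows "\<exists>m qs. 0 < m \<and> (\<forall>t\<in>{0..T}. \<bar>c t - step_path m qs t\<bar> \<le> r)"
proof -
  have "uniformly_continuous_on {0..T} c" by (rule compact_uniformly_continuous[OF c compact_Icc])
  then obtain d where d: "d > 0" "\<And>u t. u \<in> {0..T} \<Longrightarrow> t \<in> {0..T} \<Longrightarrow> \<bar>u - t\<bar> < d \<Longrightarrow> \<bar>c u - c t\<bar> < r / 2"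
    unfolding uniformly_continuous_on_def dist_real_def using r by (metis half_gt_zero)
  obtain n :: nat where n: "1 / d < real n" using reals_Archimedean2 by blast
  define m where "m = Suc n"
  have "1 / d < real m" using n by (simp add: m_def)
  then have m: "0 < m" "1 / real m < d" using d(1) by (auto simp: m_def field_simps)
  have "\<exists>q :: rat. \<bar>c (real k / real m) - of_rat q\<bar> < r / 2" for k :: nat
  proof -
    obtain q where "q \<in> \<rat>" "c (real k / real m) - r / 2 < q" "q < c (real k / real m) + r / 2"
      using Rats_dense_in_real[of "c (real k / real m) - r / 2" "c (real k / real m) + r / 2"] r by auto
    moreover from this(1) obtain q' where "q = of_rat q'" by (rule Rats_cases)
    ultimately have "\<bar>c (real k / real m) - of_rat q'\<bar> < r / 2" unfolding abs_less_iff by linarith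
    then show ?thesis ..
  qed
  then obtain q :: "nat \<Rightarrow> rat" where q: "\<And>k. \<bar>c (real k / real m) - of_rat (q k)\<bar> < r / 2" by metis
  \<comment> \<open>The successor provides for the index reached at \<open>t = T\<close>
    itself.\<close>
  define qs where "qs = map q [0..<Suc (nat \<lfloor>real m * T\<rfloor>)]"
  show ?thesis
  proof (intro exI[of _ m] exI[of _ qs] conjI ballI m)
    fix t assume t: "t \<in> {0..T}"
    define k where "k = nat \<lfloor>real m * t\<rfloor>"
    have "\<lfloor>real m * t\<rfloor> \<le> \<lfloor>real m * T\<rfloor>" using t by (intro floor_mono mult_left_mono) auto
    then have "k < Suc (nat \<lfloor>real m * T\<rfloor>)" by (simp add: k_def nat_mono)
    then have qk: "qs ! k = q k" unfolding qs_def by (simp del: upt_Suc)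
    have "0 \<le> \<lfloor>real m * t\<rfloor>" using t by simp
    then have "real k = of_int \<lfloor>real m * t\<rfloor>" by (simp add: k_def)
    then have k: "real k \<le> real m * t" "real m * t < real k + 1" by linarith+
    then have "real k / real m \<le> t" "t < (real k + 1) / real m"
      using m(1) by (auto simp: field_simps)
    then have k': "real k / real m \<le> t" "t - real k / real m < 1 / real m"
      by (auto simp: add_divide_distrib)
    have "\<bar>c t - c (real k / real m)\<bar> < r / 2"
      using k' t m by (intro d(2)) auto
    moreover have "step_path m qs t = of_rat (q k)" using qk by (simp add: step_path_def k_def)
    ultimately show "\<bar>c t - step_path m qs t\<bar> \<le> r" using q[of k] by linarith
  qed
qed

section \<open>Centres\<close>

text \<open>Composition with real test functions brings both elements to a common type. The
  preimages of Borel sets are among the independent events and are closed under intersection, so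
  independence passes to the generated \<sigma>-algebras.\<close>

lemma independent_elements_expectation:
  fixes f :: "'b \<Rightarrow> real" and g :: "'c \<Rightarrow> real"
  assumes M: "prob_space M" and ind: "independent_elements M S X T Y"
    and f: "f \<in> borel_measurable S" "\<And>x. \<bar>f x\<bar> \<le> C" and g: "g \<in> borel_measurable T" "\<And>x. \<bar>g x\<bar> \<le> C"
  shows "(\<integral>\<omega>. f (X \<omega>) * g (Y \<omega>) \<partial>M) = (\<integral>\<omega>. f (X \<omega>) \<partial>M) * (\<integral>\<omega>. g (Y \<omega>) \<partial>M)"
proof -
  interpret prob_space M by fact
  have X: "X \<in> M \<rightarrow>\<^sub>M S" and Y: "Y \<in> M \<rightarrow>\<^sub>M T"
    and indep: "indep_set {X -` A \<inter> space M |A. A \<in> sets S} {Y -` A \<inter> space M |A. A \<in> sets T}"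
    using ind by (auto simp: independent_elements_def)
  have fX: "(\<lambda>\<omega>. f (X \<omega>)) \<in> borel_measurable M" by (rule measurable_compose[OF X f(1)])
  have gY: "(\<lambda>\<omega>. g (Y \<omega>)) \<in> borel_measurable M" by (rule measurable_compose[OF Y g(1)])
  have sub: "{(\<lambda>\<omega>. h (V \<omega>)) -` A \<inter> space M |A. A \<in> sets borel} \<subseteq> {V -` A \<inter> space M |A. A \<in> sets R}"
    if "V \<in> M \<rightarrow>\<^sub>M R" "h \<in> borel_measurable R" for V :: "'a \<Rightarrow> 'd" and R and h :: "'d \<Rightarrow> real"
  proof safe
    fix A :: "real set" assume "A \<in> sets borel"
    then have "h -` A \<inter> space R \<in> sets R" using that(2) by (rule measurable_sets[rotated])
    moreover have "(\<lambda>\<omega>. h (V \<omega>)) -` A \<inter> space M = V -` (h -` A \<inter> space R) \<inter> space M"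
      using measurable_space[OF that(1)] by auto
    ultimately show "\<exists>A'. (\<lambda>\<omega>. h (V \<omega>)) -` A \<inter> space M = V -` A' \<inter> space M \<and> A' \<in> sets R" by blast
  qed
  have stable: "Int_stable {h -` A \<inter> space M |A. A \<in> sets borel}" for h :: "'a \<Rightarrow> real"
  proof (rule Int_stableI)
    fix a b assume "a \<in> {h -` A \<inter> space M |A. A \<in> sets borel}" "b \<in> {h -` A \<inter> space M |A. A \<in> sets borel}"
    then obtain A B where AB: "A \<in> sets borel" "B \<in> sets borel" "a = h -` A \<inter> space M" "b = h -` B \<inter> space M"
      by blast
    have "a \<inter> b = h -` (A \<inter> B) \<inter> space M" using AB(3,4) by blast
    moreover have "A \<inter> B \<in> sets borel" using AB(1,2) by (rule sets.Int)
    ultimately show "a \<inter> b \<in> {h -` A \<inter> space M |A. A \<in> sets borel}" by blast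
  qed
  have "indep_set {(\<lambda>\<omega>. f (X \<omega>)) -` A \<inter> space M |A. A \<in> sets borel} {(\<lambda>\<omega>. g (Y \<omega>)) -` A \<inter> space M |A. A \<in> sets borel}"
    unfolding indep_set_def
    by (rule indep_sets_mono_sets[OF indep[unfolded indep_set_def]])
      (use sub[OF X f(1)] sub[OF Y g(1)] in \<open>auto split: bool.split\<close>)
  from indep_set_sigma_sets[OF this stable stable]
  have "indep_var borel (\<lambda>\<omega>. f (X \<omega>)) borel (\<lambda>\<omega>. g (Y \<omega>))"
    unfolding indep_var_eq using fX gY by blast
  then show ?thesis
    by (rule indep_var_lebesgue_integral)
      (use fX gY f(2) g(2) in \<open>auto intro!: integrable_const_bound[of _ C]\<close>)
qed

text \<open>A centre \<open>((T, j), u)\<close> stands for the pairs of a starting point and a driving path that are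
  close, at scale \<open>1 / (j + 1)\<close> and up to time \<open>T\<close>, to the rational point and the rational step path
  coded by \<open>u\<close>.\<close>

type_synonym 'i centre = "(nat \<times> nat) \<times> ('i \<Rightarrow> rat \<times> nat \<times> rat list)"

definition radius :: "'i centre \<Rightarrow> real" where
  "radius c = 1 / real (Suc (snd (fst c)))"

definition centre_point :: "'i centre \<Rightarrow> 'i \<Rightarrow> real" where
  "centre_point c p = of_rat (fst (snd c p))"

definition centre_path :: "'i centre \<Rightarrow> real \<Rightarrow> 'i \<Rightarrow> real" where
  "centre_path c t p = step_path (fst (snd (snd c p))) (snd (snd (snd c p))) t"

definition start_weight :: "'i set \<Rightarrow> 'i centre \<Rightarrow> ('i \<Rightarrow> real) \<Rightarrow> real" where
  "start_weight I c = start_bump I (radius c) (centre_point c)"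

definition path_weight :: "'i set \<Rightarrow> 'i centre \<Rightarrow> (real \<Rightarrow> 'i \<Rightarrow> real) \<Rightarrow> real" where
  "path_weight I c = path_bump I (real (fst (fst c))) (radius c) (centre_path c)"

text \<open>Extensionality outside the finite set \<open>I\<close> is what makes this set countable;
  the positive number of steps per unit time makes the step paths right continuous.\<close>

definition centres :: "'i set \<Rightarrow> 'i centre set" where
  "centres I = UNIV \<times> (I \<rightarrow>\<^sub>E UNIV \<times> {0<..} \<times> UNIV)"

lemma countable_centres: "finite I \<Longrightarrow> countable (centres I)"
  unfolding centres_def by (intro countable_SIGMA countable_PiE) auto

lemma radius_pos: "0 < radius c"
  by (simp add: radius_def)

lemma weight_bounds:
  "0 \<le> start_weight I c x" "start_weight I c x \<le> 1" "0 \<le> path_weight I c z" "path_weight I c z \<le> 1"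
  unfolding start_weight_def path_weight_def by (auto intro: start_bump_bounds path_bump_bounds)

lemma path_weight_increments:
  assumes "\<And>t p. 0 \<le> t \<Longrightarrow> p \<in> I \<Longrightarrow> z t p - z 0 p = z' t p - z' 0 p"
  shows "path_weight I c z = path_weight I c z'"
  unfolding path_weight_def path_bump_def using assms by (intro prod.cong refl INF_cong) auto

text \<open>The gap \<open>m\<close> ranges below the radius, so one value \<open>v\<close> serves
  the limit, where \<open>m = 0\<close>, and all prelimits with \<open>1 / b n\<close> below the
  radius. Right continuity of \<open>z\<close> turns a positive weight, which sees only rational
  times, into closeness at all times.\<close>

definition good_centre ::
  "nat \<Rightarrow> ((real \<Rightarrow> nat \<times> nat \<Rightarrow> real) \<Rightarrow> real) \<Rightarrow> real \<Rightarrow> (nat \<times> nat) centre \<Rightarrow> real \<Rightarrow> bool" where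
  "good_centre N F \<eta> c v \<longleftrightarrow> (\<forall>m z y. reflected N m z y \<and> 0 \<le> m \<and> m < radius c \<and> y \<in> cadlag_paths (tri N) \<and>
     (\<forall>p\<in>tri N. \<forall>t\<ge>0. ((\<lambda>u. z u p) \<longlongrightarrow> z t p) (at_right t)) \<and>
     0 < start_weight (tri N) c (y 0) * path_weight (tri N) c z \<longrightarrow> \<bar>F y - v\<bar> \<le> \<eta>)"

text \<open>The value of the centre is \<open>F\<close> at the given solution. Any solution of
  positive weight has its data near the same centre, hence near those of \<open>y\<close>, and
  stability brings it into the neighbourhood of \<open>y\<close> on which \<open>F\<close> varies by
  less than \<open>\<eta>\<close>.\<close>

lemma good_centre_exists:
  assumes F: "continuous_map (ucc_topology (tri N)) euclideanreal F" and \<eta>: "0 < \<eta>"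
    and y: "y \<in> cadlag_paths (tri N)" and R: "reflected N 0 z y"
    and z: "\<And>p. p \<in> tri N \<Longrightarrow> continuous_on {0..} (\<lambda>t. z t p)"
  shows "\<exists>c\<in>centres (tri N). good_centre N F \<eta> c (F y) \<and> start_weight (tri N) c (y 0) * path_weight (tri N) c z = 1"
proof -
  obtain T0 \<delta> where T0: "T0 \<ge> 0" "\<delta> > 0" "\<And>y'. y' \<in> cadlag_paths (tri N) \<Longrightarrow>
      (\<forall>t\<in>{0..T0}. \<forall>p\<in>tri N. \<bar>y' t p - y t p\<bar> < \<delta>) \<Longrightarrow> \<bar>F y' - F y\<bar> < \<eta>"
    using continuous_map_uccD[OF F y \<eta>] by blast
  obtain T :: nat where T: "T0 \<le> real T" using real_arch_simple by blast
  \<comment> \<open>A positive weight puts the data within \<open>2 * r\<close> of the centre, and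
    those of \<open>y\<close> are within \<open>r\<close>, so they differ by at most
    \<open>3 * r\<close> and the solutions by \<open>5 * N * (3 * r)\<close>. The summand 1 keeps
    the denominator positive for \<open>N = 0\<close>.\<close>
  have "0 < \<delta> / (15 * real N + 1)" using T0(2) by (intro divide_pos_pos) auto
  then obtain j where j: "1 / real (Suc j) < \<delta> / (15 * real N + 1)"
    using nat_approx_posE by blast
  define r where "r = 1 / real (Suc j)"
  have r: "0 < r" "15 * real N * r < \<delta>"
  proof -
    show "0 < r" by (simp add: r_def)
    have "r * (15 * real N + 1) < \<delta>" using j by (simp add: r_def pos_less_divide_eq)
    then show "15 * real N * r < \<delta>" using \<open>0 < r\<close> by (simp add: algebra_simps)
  qed
  have "\<exists>q :: rat. \<bar>y 0 p - of_rat q\<bar> \<le> r" for p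
  proof -
    obtain q where "q \<in> \<rat>" "y 0 p - r < q" "q < y 0 p + r"
      using Rats_dense_in_real[of "y 0 p - r" "y 0 p + r"] r by auto
    moreover from this(1) obtain q' where "q = of_rat q'" by (rule Rats_cases)
    ultimately have "\<bar>y 0 p - of_rat q'\<bar> \<le> r" unfolding abs_le_iff by linarith
    then show ?thesis ..
  qed
  then obtain q :: "nat \<times> nat \<Rightarrow> rat" where q: "\<And>p. \<bar>y 0 p - of_rat (q p)\<bar> \<le> r" by metis
  have "\<forall>p\<in>tri N. \<exists>w. 0 < fst w \<and> (\<forall>t\<in>{0..real T}. \<bar>z t p - z 0 p - step_path (fst w) (snd w) t\<bar> \<le> r)"
  proof
    fix p assume p: "p \<in> tri N"
    have "continuous_on {0..real T} (\<lambda>t. z t p - z 0 p)"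
      by (intro continuous_intros continuous_on_subset[OF z[OF p]]) auto
    from step_path_approximation[OF this r(1)]
    show "\<exists>w. 0 < fst w \<and> (\<forall>t\<in>{0..real T}. \<bar>z t p - z 0 p - step_path (fst w) (snd w) t\<bar> \<le> r)" by simp
  qed
  from bchoice[OF this] obtain w where
    "\<forall>p\<in>tri N. 0 < fst (w p) \<and> (\<forall>t\<in>{0..real T}. \<bar>z t p - z 0 p - step_path (fst (w p)) (snd (w p)) t\<bar> \<le> r)"
    by blast
  then have w: "\<And>p. p \<in> tri N \<Longrightarrow> 0 < fst (w p)"
    "\<And>p t. p \<in> tri N \<Longrightarrow> 0 \<le> t \<Longrightarrow> t \<le> real T \<Longrightarrow> \<bar>z t p - z 0 p - step_path (fst (w p)) (snd (w p)) t\<bar> \<le> r"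
    by auto
  define c where "c = ((T, j), \<lambda>p\<in>tri N. (q p, w p))"
  have rad: "radius c = r" by (simp add: c_def r_def radius_def)
  have pt: "centre_point c p = of_rat (q p)" if "p \<in> tri N" for p using that by (simp add: c_def centre_point_def)
  have pa: "centre_path c t p = step_path (fst (w p)) (snd (w p)) t" if "p \<in> tri N" for p t
    using that by (simp add: c_def centre_path_def)
  have cT: "real (fst (fst c)) = real T" by (simp add: c_def)
  have c_in: "c \<in> centres (tri N)"
    using w(1) by (auto simp: c_def centres_def mem_Times_iff)
  have "start_weight (tri N) c (y 0) = 1"
    unfolding start_weight_def rad using q pt r by (intro start_bump_eq_1) auto
  moreover have "path_weight (tri N) c z = 1"
    unfolding path_weight_def rad cT using w(2) pa r by (intro path_bump_eq_1) auto
  moreover have "good_centre N F \<eta> c (F y)"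
    unfolding good_centre_def
  proof (intro allI impI, elim conjE)
    fix m z' y' assume R': "reflected N m z' y'" and m: "0 \<le> m" "m < radius c" and y': "y' \<in> cadlag_paths (tri N)"
      and z': "\<forall>p\<in>tri N. \<forall>t\<ge>0. ((\<lambda>u. z' u p) \<longlongrightarrow> z' t p) (at_right t)"
      and pos: "0 < start_weight (tri N) c (y' 0) * path_weight (tri N) c z'"
    have pos': "0 < start_weight (tri N) c (y' 0)" "0 < path_weight (tri N) c z'"
      using pos weight_bounds(1)[of "tri N" c "y' 0"] weight_bounds(3)[of "tri N" c z'] by (auto simp: zero_less_mult_iff)
    have start: "\<bar>y' 0 p - y 0 p\<bar> \<le> 3 * r" if p: "p \<in> tri N" for p
      using start_bump_pos[OF pos'(1)[unfolded start_weight_def] radius_pos finite_tri p] q[of p]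
      unfolding rad pt[OF p] by linarith
    have drive: "\<bar>(z' t p - z' 0 p) - (z t p - z 0 p)\<bar> \<le> 3 * r" if "0 \<le> t" "t \<le> real T" "p \<in> tri N" for t p
    proof -
      have "\<bar>z' t p - z' 0 p - centre_path c t p\<bar> \<le> 2 * radius c"
      proof (rule path_bump_pos[OF pos'(2)[unfolded path_weight_def] radius_pos finite_tri that(3)])
        fix t :: real assume "0 \<le> t"
        show "((\<lambda>u. centre_path c u p) \<longlongrightarrow> centre_path c t p) (at_right t)"
          unfolding pa[OF that(3)] by (rule step_path_right_continuous[OF w(1)[OF that(3)]])
      qed (use z' that cT in auto)
      then show ?thesis using w(2)[OF that(3,1,2)] unfolding rad pa[OF that(3)] by linarith
    qed
    have "\<bar>y' t p - y t p\<bar> < \<delta>" if t: "t \<in> {0..T0}" and p: "p \<in> tri N" for t p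
    proof -
      obtain i k where ik: "p = (i, k)" by (cases p)
      have "\<bar>y' t (i, k) - y t (i, k)\<bar> \<le> 5 * real k * (3 * r)"
        by (rule reflected_stable[OF R' R, where T = "real T"])
          (use m rad r start drive t T p ik in auto)
      also have "\<dots> \<le> 5 * real N * (3 * r)"
        using p ik r by (intro mult_right_mono) (auto simp: tri_def)
      also have "\<dots> < \<delta>" using r by simp
      finally show ?thesis by (simp add: ik)
    qed
    then show "\<bar>F y' - F y\<bar> \<le> \<eta>" using T0(3)[OF y'] by force
  qed
  ultimately show ?thesis using c_in by auto
qed

section \<open>The invariance principle\<close>

lemma measurable_prod_path_weight:
  "(\<lambda>z. \<Prod>l\<in>A. path_weight I (e l) z) \<in> borel_measurable (PiM {0..} (\<lambda>_. PiM I (\<lambda>_. borel)))"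
  unfolding path_weight_def by (intro borel_measurable_prod measurable_path_bump)

lemma measurable_prod_start_weight:
  "(\<lambda>x. \<Prod>l\<in>A. start_weight I (e l) x) \<in> borel_measurable (PiM I (\<lambda>_. borel))"
  unfolding start_weight_def by (intro borel_measurable_prod measurable_start_bump)

lemma continuous_map_prod_path_weight:
  assumes "finite I" "finite A"
  shows "continuous_map (ucc_topology I) euclideanreal (\<lambda>z. \<Prod>l\<in>A. path_weight I (e l) z)"
  unfolding path_weight_def
  by (intro continuous_map_prod_real continuous_map_path_bump assms radius_pos) simp

lemma continuous_map_prod_start_weight:
  assumes "finite I" "finite A"
  shows "continuous_map (product_topology (\<lambda>_. euclideanreal) I) euclideanreal (\<lambda>x. \<Prod>l\<in>A. start_weight I (e l) x)"
  unfolding start_weight_def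
  by (intro continuous_map_prod_real continuous_map_start_bump assms radius_pos)

lemma prod_weight_bounds:
  "\<bar>\<Prod>l\<in>A. start_weight I (e l) x\<bar> \<le> 1" "\<bar>\<Prod>l\<in>A. path_weight I (e l) z\<bar> \<le> 1"
  unfolding abs_prod by (auto intro!: prod_le_1 simp: weight_bounds)

lemma space_cadlag_space: "space (cadlag_space I) = cadlag_paths I"
  unfolding cadlag_space_def space_restrict_space
  by (auto simp: cadlag_paths_def space_PiM)

lemma measurable_cadlag_spaceI1:
  "h \<in> borel_measurable (PiM {0..} (\<lambda>_. PiM I (\<lambda>_. borel))) \<Longrightarrow> h \<in> borel_measurable (cadlag_space I)"
  unfolding cadlag_space_def by (rule measurable_restrict_space1)

theorem theorem1:
  fixes N :: nat
    and M :: "nat \<Rightarrow> 'a measure"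
    and X \<X> :: "nat \<Rightarrow> 'a \<Rightarrow> real \<Rightarrow> nat \<times> nat \<Rightarrow> int"
    and a :: "nat \<Rightarrow> real \<Rightarrow> real"
    and b :: "nat \<Rightarrow> real"
    and \<beta> :: "(real \<Rightarrow> nat \<times> nat \<Rightarrow> real) measure"
    and \<mu>\<^sub>0 :: "(nat \<times> nat \<Rightarrow> real) measure"
    and \<Omega> :: "'b measure"
    and W :: "'b \<Rightarrow> real \<Rightarrow> nat \<times> nat \<Rightarrow> real"
  assumes prob: "\<And>n. prob_space (M n)"
    and X_measurable: "\<And>n t p. 0 \<le> t \<Longrightarrow> p \<in> tri N \<Longrightarrow>
          (\<lambda>\<omega>. X n \<omega> t p) \<in> M n \<rightarrow>\<^sub>M count_space UNIV"
    and X_cadlag: "\<And>n \<omega> p. \<omega> \<in> space (M n) \<Longrightarrow> p \<in> tri N \<Longrightarrow> cadlag (\<lambda>t. X n \<omega> t p)"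
    and X_unit_steps: "\<And>n \<omega> p t. \<omega> \<in> space (M n) \<Longrightarrow> p \<in> tri N \<Longrightarrow> 0 < t \<Longrightarrow>
          \<bar>X n \<omega> t p - left_lim (\<lambda>s. X n \<omega> s p) t\<bar> \<le> 1"
    and dynamics: "\<And>n \<omega>. \<omega> \<in> space (M n) \<Longrightarrow> interlacing_dynamics N (X n \<omega>) (\<X> n \<omega>)"
    and initial_indep: "\<And>n. independent_elements (M n)
          (PiM (tri N) (\<lambda>_. count_space UNIV)) (\<lambda>\<omega>. \<lambda>p\<in>tri N. \<X> n \<omega> 0 p)
          (PiM ({(s, t). 0 \<le> s \<and> s \<le> t} \<times> tri N) (\<lambda>_. count_space UNIV))
          (\<lambda>\<omega>. \<lambda>((s, t), p)\<in>{(s, t). 0 \<le> s \<and> s \<le> t} \<times> tri N. X n \<omega> t p - X n \<omega> s p)"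
    and a_continuous: "\<And>n. continuous_on {0..} (a n)"
    and b_pos: "\<And>n. b n > 0"
    and b_lim: "filterlim b at_top sequentially"
    and \<beta>_brownian: "brownian_law (tri N) \<beta>"
    and X_lim: "converges_in_law (ucc_topology (tri N)) (cadlag_space (tri N))
          (\<lambda>n. distr (M n) (cadlag_space (tri N)) (\<lambda>\<omega>. rescaled_path (tri N) (a n) (b n) (X n \<omega>))) \<beta>"
    and \<mu>\<^sub>0_law: "prob_space \<mu>\<^sub>0" "sets \<mu>\<^sub>0 = sets (PiM (tri N) (\<lambda>_. borel))"
    and initial_lim: "converges_in_law (product_topology (\<lambda>_. euclideanreal) (tri N))
          (PiM (tri N) (\<lambda>_. borel))
          (\<lambda>n. distr (M n) (PiM (tri N) (\<lambda>_. borel))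
             (\<lambda>\<omega>. \<lambda>p\<in>tri N. (of_int (\<X> n \<omega> 0 p) - a n 0) / b n)) \<mu>\<^sub>0"
    and W_process: "interlacing_RBM N \<Omega> W"
    and W_initial: "distr \<Omega> (PiM (tri N) (\<lambda>_. borel)) (\<lambda>\<omega>. W \<omega> 0) = \<mu>\<^sub>0"
  shows "converges_in_law (ucc_topology (tri N)) (cadlag_space (tri N))
          (\<lambda>n. distr (M n) (cadlag_space (tri N)) (\<lambda>\<omega>. rescaled_path (tri N) (a n) (b n) (\<X> n \<omega>)))
          (distr \<Omega> (cadlag_space (tri N)) W)"
proof -
  let ?I = "tri N" and ?D = "cadlag_space (tri N)"
  note finI = finite_tri[of N]
  have dyn: "unit_step_dynamics N (X n \<omega>) (\<X> n \<omega>)" if "\<omega> \<in> space (M n)" for n \<omega>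
    using X_cadlag X_unit_steps dynamics that by unfold_locales auto
  define Z where "Z n \<omega> = rescaled_path ?I (a n) (b n) (X n \<omega>)" for n \<omega>
  define Y where "Y n \<omega> = rescaled_path ?I (a n) (b n) (\<X> n \<omega>)" for n \<omega>
  have Z_paths: "Z n \<omega> \<in> cadlag_paths ?I" if "\<omega> \<in> space (M n)" for n \<omega>
    unfolding Z_def by (rule rescaled_path_in_cadlag_paths[OF X_cadlag[OF that] a_continuous b_pos])
  have Y_paths: "Y n \<omega> \<in> cadlag_paths ?I" if "\<omega> \<in> space (M n)" for n \<omega>
    unfolding Y_def
    by (rule rescaled_path_in_cadlag_paths[OF unit_step_dynamics.y_cadlag[OF dyn[OF that]] a_continuous b_pos])
  have \<X>0_measurable: "(\<lambda>\<omega>. \<X> n \<omega> 0 p) \<in> M n \<rightarrow>\<^sub>M count_space UNIV" if "p \<in> ?I" for n p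
  proof -
    have "(\<lambda>\<omega>. \<lambda>p\<in>?I. \<X> n \<omega> 0 p) \<in> M n \<rightarrow>\<^sub>M PiM ?I (\<lambda>_. count_space UNIV)"
      using initial_indep[of n] by (simp add: independent_elements_def)
    from measurable_compose[OF this measurable_component_singleton[OF that]] that show ?thesis by simp
  qed
  have Z_meas: "Z n \<in> M n \<rightarrow>\<^sub>M ?D" for n
    unfolding Z_def
  proof (rule measurable_rescaled_path)
    fix t :: real and p assume "0 \<le> t" "p \<in> ?I"
    note [measurable] = X_measurable[OF this]
    show "(\<lambda>\<omega>. real_of_int (X n \<omega> t p)) \<in> borel_measurable (M n)" by measurable
  qed (use Z_paths in \<open>simp add: Z_def\<close>)
  have Y_meas: "Y n \<in> M n \<rightarrow>\<^sub>M ?D" for n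
    unfolding Y_def
  proof (rule measurable_rescaled_path)
    fix t :: real and p assume *: "0 \<le> t" "p \<in> ?I"
    show "(\<lambda>\<omega>. real_of_int (\<X> n \<omega> t p)) \<in> borel_measurable (M n)"
      by (rule measurable_interlacing_dynamics[OF dyn X_measurable \<X>0_measurable *])
  qed (use Y_paths in \<open>simp add: Y_def\<close>)
  have reflected_Y: "reflected N (1 / b n) (Z n \<omega>) (Y n \<omega>)" if "\<omega> \<in> space (M n)" for n \<omega>
    unfolding Z_def Y_def
    by (rule unit_step_dynamics.reflected_rescaled[OF dyn[OF that] a_continuous b_pos])
  have Z_right: "((\<lambda>u. Z n \<omega> u p) \<longlongrightarrow> Z n \<omega> t p) (at_right t)"
    if "\<omega> \<in> space (M n)" "p \<in> ?I" "0 \<le> t" for n \<omega> p t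
    using Z_paths[OF that(1)] that(2,3) by (auto simp: cadlag_paths_def cadlag_def)
  have Y0: "Y n \<omega> 0 = (\<lambda>p\<in>?I. (of_int (\<X> n \<omega> 0 p) - a n 0) / b n)" for n \<omega>
    by (simp add: Y_def rescaled_path_def)

  obtain B Lm Lp where \<Omega>: "prob_space \<Omega>" and W_meas: "W \<in> \<Omega> \<rightarrow>\<^sub>M ?D"
    and B: "std_brownian_motion \<Omega> ?I B"
    and B_indep: "independent_elements \<Omega>
          (PiM ?I (\<lambda>_. borel)) (\<lambda>\<omega>. W \<omega> 0)
          (PiM ({0..} \<times> ?I) (\<lambda>_. borel)) (\<lambda>\<omega>. \<lambda>(t, p)\<in>{0..} \<times> ?I. B \<omega> t p)"
    and W_AE: "AE \<omega> in \<Omega>.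
           (\<forall>t\<ge>0. W \<omega> t \<in> GTc N) \<and>
           (\<forall>p\<in>?I.
              continuous_on {0..} (\<lambda>t. W \<omega> t p) \<and>
              regulator_path (\<lambda>t. Lm \<omega> t p) \<and> regulator_path (\<lambda>t. Lp \<omega> t p) \<and>
              (\<forall>t\<ge>0. W \<omega> t p = W \<omega> 0 p + B \<omega> t p + Lm \<omega> t p - Lp \<omega> t p)) \<and>
           (\<forall>(i, k)\<in>?I.
              (if i > 1
               then increases_only_on (\<lambda>t. Lm \<omega> t (i, k)) {t. W \<omega> t (i, k) = W \<omega> t (i - 1, k - 1)}
               else \<forall>t\<ge>0. Lm \<omega> t (i, k) = 0) \<and>
              (if i < k
               then increases_only_on (\<lambda>t. Lp \<omega> t (i, k)) {t. W \<omega> t (i, k) = W \<omega> t (i, k - 1)}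
               else \<forall>t\<ge>0. Lp \<omega> t (i, k) = 0))"
    using W_process unfolding interlacing_RBM_def by blast
  interpret \<Omega>: prob_space \<Omega> by (rule \<Omega>)
  \<comment> \<open>Paths of \<open>B\<close> are known to be continuous only almost surely, so
    \<open>V\<close> is a random element of the full product space rather than of the cadlag space.
    The weights are measurable already on that larger space.\<close>
  define V where "V \<omega> = (\<lambda>t\<in>{0..}. \<lambda>p\<in>?I. B \<omega> t p)" for \<omega>
  have V_val: "V \<omega> t p = B \<omega> t p" if "0 \<le> t" "p \<in> ?I" for \<omega> t p using that by (simp add: V_def)
  have B_meas: "(\<lambda>\<omega>. B \<omega> t p) \<in> borel_measurable \<Omega>" if "0 \<le> t" "p \<in> ?I" for t p
    using B that by (simp add: std_brownian_motion_def std_brownian_motion1_def)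
  have V_meas: "V \<in> \<Omega> \<rightarrow>\<^sub>M PiM {0..} (\<lambda>_. PiM ?I (\<lambda>_. borel))"
    unfolding V_def by (intro measurable_restrict B_meas) auto
  have W0_meas: "(\<lambda>\<omega>. W \<omega> 0) \<in> \<Omega> \<rightarrow>\<^sub>M PiM ?I (\<lambda>_. borel)"
    using B_indep by (simp add: independent_elements_def)
  have W_paths: "W \<omega> \<in> cadlag_paths ?I" if "\<omega> \<in> space \<Omega>" for \<omega>
    using measurable_space[OF W_meas that] by (simp add: space_cadlag_space)

  have B_AE: "AE \<omega> in \<Omega>. \<forall>p\<in>?I. continuous_on {0..} (\<lambda>t. B \<omega> t p)"
    using B finI by (intro AE_finite_allI) (auto simp: std_brownian_motion_def std_brownian_motion1_def)
  have limit_good: "AE \<omega> in \<Omega>. \<omega> \<in> space \<Omega> \<and> reflected N 0 (V \<omega>) (W \<omega>) \<and> (\<forall>p\<in>?I. continuous_on {0..} (\<lambda>t. V \<omega> t p))"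
    using W_AE B_AE AE_space
  proof eventually_elim
    case (elim \<omega>)
    note path = elim(1)[THEN conjunct2, THEN conjunct1, rule_format]
    note skorokhod = elim(1)[THEN conjunct2, THEN conjunct2, THEN bspec, unfolded prod.case]
    have "reflected N 0 (V \<omega>) (W \<omega>)"
    proof (rule reflected_continuous[where Lm = "Lm \<omega>" and Lp = "Lp \<omega>"])
      fix p t assume p: "p \<in> ?I" and t: "(0::real) \<le> t"
      show "W \<omega> t p = W \<omega> 0 p + V \<omega> t p + Lm \<omega> t p - Lp \<omega> t p"
        unfolding V_val[OF t p] using path[OF p] t by blast
    next
      fix i k assume "(i, k) \<in> ?I"
      from skorokhod[OF this]
      show "if i > 1
          then increases_only_on (\<lambda>t. Lm \<omega> t (i, k)) {t. W \<omega> t (i, k) = W \<omega> t (i - 1, k - 1)}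
          else \<forall>t\<ge>0. Lm \<omega> t (i, k) = 0"
        "if i < k
          then increases_only_on (\<lambda>t. Lp \<omega> t (i, k)) {t. W \<omega> t (i, k) = W \<omega> t (i, k - 1)}
          else \<forall>t\<ge>0. Lp \<omega> t (i, k) = 0"
        by blast+
    qed (use elim(1) path in blast)+
    moreover have "continuous_on {0..} (\<lambda>t. V \<omega> t p)" if "p \<in> ?I" for p
      using elim(2) that V_val by (subst continuous_on_cong[OF refl, of _ _ "\<lambda>t. B \<omega> t p"]) auto
    ultimately show ?case using elim(3) by blast
  qed

  \<comment> \<open>Independence splits each expectation into a factor for the starting point and
    one for the driver, and each factor converges by one of the two hypotheses on laws.\<close>
  have weights: "(\<lambda>n. \<integral>\<omega>. (\<Prod>l\<in>A. start_weight ?I (e l) (Y n \<omega> 0)) * (\<Prod>l\<in>A. path_weight ?I (e l) (Z n \<omega>)) \<partial>M n)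
      \<longlonglongrightarrow> (\<integral>\<omega>. (\<Prod>l\<in>A. start_weight ?I (e l) (W \<omega> 0)) * (\<Prod>l\<in>A. path_weight ?I (e l) (V \<omega>)) \<partial>\<Omega>)"
    if A: "finite A" for A :: "nat set" and e
  proof -
    define f where "f x = (\<Prod>l\<in>A. start_weight ?I (e l) x)" for x
    define g where "g z = (\<Prod>l\<in>A. path_weight ?I (e l) z)" for z
    have f: "f \<in> borel_measurable (PiM ?I (\<lambda>_. borel))" "\<And>x. \<bar>f x\<bar> \<le> 1"
      "continuous_map (product_topology (\<lambda>_. euclideanreal) ?I) euclideanreal f"
      unfolding f_def using A finI
      by (auto intro: measurable_prod_start_weight prod_weight_bounds continuous_map_prod_start_weight)
    have g: "g \<in> borel_measurable (PiM {0..} (\<lambda>_. PiM ?I (\<lambda>_. borel)))" "\<And>z. \<bar>g z\<bar> \<le> 1"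
      "continuous_map (ucc_topology ?I) euclideanreal g"
      unfolding g_def using A finI
      by (auto intro: measurable_prod_path_weight prod_weight_bounds continuous_map_prod_path_weight)
    have g_incr: "g z = g z'" if "\<And>t p. 0 \<le> t \<Longrightarrow> p \<in> ?I \<Longrightarrow> z t p - z 0 p = z' t p - z' 0 p" for z z'
      unfolding g_def using that by (intro prod.cong refl path_weight_increments)
    have prelimit: "(\<integral>\<omega>. f (Y n \<omega> 0) * g (Z n \<omega>) \<partial>M n) = (\<integral>\<omega>. f (Y n \<omega> 0) \<partial>M n) * (\<integral>\<omega>. g (Z n \<omega>) \<partial>M n)" for n
    proof -
      define f' where "f' u = f (\<lambda>p\<in>?I. (of_int (u p) - a n 0) / b n)" for u :: "nat \<times> nat \<Rightarrow> int"
      \<comment> \<open>Rebuilds the driver from its increments over \<open>[0, t]\<close>. Adding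
        \<open>a n 0\<close> makes the rebuilt path start at 0, and \<open>g\<close> does not see
        that the initial value of \<open>Z\<close> is lost.\<close>
      define g' where "g' v = g (\<lambda>t\<in>{0..}. \<lambda>p\<in>?I. (of_int (v ((0, t), p)) - a n t + a n 0) / b n)"
        for v :: "(real \<times> real) \<times> nat \<times> nat \<Rightarrow> int"
      let ?S = "PiM ?I (\<lambda>_. count_space (UNIV :: int set))"
      let ?T = "PiM ({(s :: real, t). 0 \<le> s \<and> s \<le> t} \<times> ?I) (\<lambda>_. count_space (UNIV :: int set))"
      let ?x = "\<lambda>\<omega>. \<lambda>p\<in>?I. \<X> n \<omega> 0 p"
      let ?z = "\<lambda>\<omega>. \<lambda>((s, t), p)\<in>{(s, t). 0 \<le> s \<and> s \<le> t} \<times> ?I. X n \<omega> t p - X n \<omega> s p"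
      have f'_meas: "f' \<in> borel_measurable ?S"
        unfolding f'_def
      proof (rule measurable_compose[OF _ f(1)], rule measurable_restrict)
        fix p assume "p \<in> ?I"
        then have [measurable]: "(\<lambda>u. u p) \<in> ?S \<rightarrow>\<^sub>M count_space UNIV" by (rule measurable_component_singleton)
        show "(\<lambda>u. (real_of_int (u p) - a n 0) / b n) \<in> borel_measurable ?S" by measurable
      qed
      have g'_meas: "g' \<in> borel_measurable ?T"
        unfolding g'_def
      proof (rule measurable_compose[OF _ g(1)], intro measurable_restrict)
        fix t :: real and p assume "t \<in> {0..}" "p \<in> ?I"
        then have [measurable]: "(\<lambda>v. v ((0, t), p)) \<in> ?T \<rightarrow>\<^sub>M count_space UNIV"
          by (intro measurable_component_singleton) auto
        show "(\<lambda>v. (real_of_int (v ((0, t), p)) - a n t + a n 0) / b n) \<in> borel_measurable ?T" by measurable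
      qed
      have "f (Y n \<omega> 0) = f' (?x \<omega>)" for \<omega>
        unfolding Y0 f'_def by (intro arg_cong[of _ _ f] restrict_ext) simp
      moreover have "g (Z n \<omega>) = g' (?z \<omega>)" for \<omega>
        unfolding g'_def by (rule g_incr) (auto simp: Z_def rescaled_path_def field_simps diff_divide_distrib[symmetric])
      ultimately show ?thesis
        using independent_elements_expectation[OF prob initial_indep f'_meas _ g'_meas, of 1] f(2) g(2)
        unfolding f'_def[symmetric] g'_def[symmetric] by (simp add: f'_def g'_def)
    qed
    have limit: "(\<integral>\<omega>. f (W \<omega> 0) * g (V \<omega>) \<partial>\<Omega>) = (\<integral>\<omega>. f (W \<omega> 0) \<partial>\<Omega>) * (\<integral>\<omega>. g (V \<omega>) \<partial>\<Omega>)"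
    proof -
      define g' where "g' v = g (\<lambda>t\<in>{0..}. \<lambda>p\<in>?I. v (t, p))" for v
      have g'_meas: "g' \<in> borel_measurable (PiM ({0..} \<times> ?I) (\<lambda>_. borel))"
        unfolding g'_def by (rule measurable_compose[OF _ g(1)], intro measurable_restrict measurable_component_singleton) auto
      have "g (V \<omega>) = g' (\<lambda>(t, p)\<in>{0..} \<times> ?I. B \<omega> t p)" for \<omega>
        unfolding g'_def by (rule g_incr) (auto simp: V_def)
      then show ?thesis
        using independent_elements_expectation[OF \<Omega> B_indep f(1) f(2) g'_meas] g(2) by (simp add: g'_def)
    qed
    have "(\<lambda>n. \<integral>\<omega>. f (Y n \<omega> 0) \<partial>M n) \<longlonglongrightarrow> (\<integral>\<omega>. f (W \<omega> 0) \<partial>\<Omega>)"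
    proof -
      have m: "(\<lambda>\<omega>. \<lambda>p\<in>?I. (of_int (\<X> n \<omega> 0 p) - a n 0) / b n) \<in> M n \<rightarrow>\<^sub>M PiM ?I (\<lambda>_. borel)" for n
      proof (rule measurable_restrict)
        fix p assume "p \<in> ?I"
        note [measurable] = \<X>0_measurable[OF this]
        show "(\<lambda>\<omega>. (real_of_int (\<X> n \<omega> 0 p) - a n 0) / b n) \<in> borel_measurable (M n)" by measurable
      qed
      have "(\<lambda>n. \<integral>x. f x \<partial>distr (M n) (PiM ?I (\<lambda>_. borel)) (\<lambda>\<omega>. \<lambda>p\<in>?I. (of_int (\<X> n \<omega> 0 p) - a n 0) / b n))
        \<longlonglongrightarrow> (\<integral>x. f x \<partial>\<mu>\<^sub>0)"
        using initial_lim f unfolding converges_in_law_def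
        by (auto simp: bounded_iff)
      then show ?thesis
        unfolding W_initial[symmetric] integral_distr[OF m f(1)] integral_distr[OF W0_meas f(1)] Y0 .
    qed
    moreover have "(\<lambda>n. \<integral>\<omega>. g (Z n \<omega>) \<partial>M n) \<longlonglongrightarrow> (\<integral>\<omega>. g (V \<omega>) \<partial>\<Omega>)"
    proof -
      have g_D: "g \<in> borel_measurable ?D" by (rule measurable_cadlag_spaceI1[OF g(1)])
      have "(\<lambda>n. \<integral>x. g x \<partial>distr (M n) ?D (Z n)) \<longlonglongrightarrow> (\<integral>x. g x \<partial>\<beta>)"
        using X_lim g(2,3) g_D unfolding converges_in_law_def Z_def
        by (auto simp: bounded_iff)
      \<comment> \<open>The drivers converge to a Brownian law \<open>\<beta>\<close> on the path
        space, while \<open>V\<close> comes from the reflection equations on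
        \<open>\<Omega>\<close>; uniqueness in law on the full product space identifies the
        two.\<close>
      moreover have "(\<integral>x. g x \<partial>\<beta>) = (\<integral>\<omega>. g (V \<omega>) \<partial>\<Omega>)"
      proof -
        let ?P = "PiM {0::real..} (\<lambda>_. PiM ?I (\<lambda>_. borel :: real measure))"
        have \<beta>: "std_brownian_motion \<beta> ?I (\<lambda>x. x)" "sets \<beta> = sets ?D"
          using \<beta>_brownian by (auto simp: brownian_law_def)
        have m: "(\<lambda>x. \<lambda>t\<in>{0..}. \<lambda>p\<in>?I. x t p) \<in> \<beta> \<rightarrow>\<^sub>M ?P"
          using \<beta>(1) by (intro measurable_restrict) (auto simp: std_brownian_motion_def std_brownian_motion1_def)
        have "(\<integral>x. g x \<partial>\<beta>) = (\<integral>x. g (\<lambda>t\<in>{0..}. \<lambda>p\<in>?I. x t p) \<partial>\<beta>)"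
          by (intro Bochner_Integration.integral_cong refl g_incr) auto
        also have "\<dots> = (\<integral>x. g x \<partial>distr \<beta> ?P (\<lambda>x. \<lambda>t\<in>{0..}. \<lambda>p\<in>?I. x t p))"
          by (rule integral_distr[OF m g(1), symmetric])
        also have "\<dots> = (\<integral>x. g x \<partial>distr \<Omega> ?P V)"
          unfolding std_brownian_motion_law_unique[OF \<beta>(1) B] V_def ..
        also have "\<dots> = (\<integral>\<omega>. g (V \<omega>) \<partial>\<Omega>)" by (rule integral_distr[OF V_meas g(1)])
        finally show ?thesis .
      qed
      ultimately show ?thesis by (simp add: integral_distr[OF Z_meas g_D])
    qed
    ultimately have "(\<lambda>n. \<integral>\<omega>. f (Y n \<omega> 0) * g (Z n \<omega>) \<partial>M n) \<longlonglongrightarrow> (\<integral>\<omega>. f (W \<omega> 0) * g (V \<omega>) \<partial>\<Omega>)"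
      unfolding prelimit limit by (rule tendsto_mult)
    then show ?thesis by (simp add: f_def g_def)
  qed

  show ?thesis
    unfolding converges_in_law_def
  proof (intro allI impI, elim conjE)
    fix F :: "(real \<Rightarrow> nat \<times> nat \<Rightarrow> real) \<Rightarrow> real"
    assume F_cont: "continuous_map (ucc_topology ?I) euclideanreal F" and F_meas: "F \<in> borel_measurable ?D"
      and "bounded (F ` topspace (ucc_topology ?I))"
    then obtain C where C: "\<And>y. y \<in> cadlag_paths ?I \<Longrightarrow> \<bar>F y\<bar> \<le> C"
      by (auto simp: bounded_iff topspace_ucc_topology)
    have FY_meas: "(\<lambda>\<omega>. F (Y n \<omega>)) \<in> borel_measurable (M n)" for n
      by (rule measurable_compose[OF Y_meas F_meas])
    have FW_meas: "(\<lambda>\<omega>. F (W \<omega>)) \<in> borel_measurable \<Omega>"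
      by (rule measurable_compose[OF W_meas F_meas])
    have close: "\<forall>\<^sub>F n in sequentially. \<bar>(\<integral>\<omega>. F (Y n \<omega>) \<partial>M n) - (\<integral>\<omega>. F (W \<omega>) \<partial>\<Omega>)\<bar> \<le> 5 * \<eta>" if \<eta>: "0 < \<eta>" for \<eta>
    proof -
      \<comment> \<open>A set of centres and not of solutions, hence countable, although uncountably
        many solutions may attest that its members are good.\<close>
      define G where "G = {c \<in> centres ?I. \<exists>v. good_centre N F \<eta> c v}"
      have G_count: "countable G"
        using countable_centres[OF finI] by (rule countable_subset[rotated]) (auto simp: G_def)
      have cover: "AE \<omega> in \<Omega>. \<omega> \<in> space \<Omega> \<and> reflected N 0 (V \<omega>) (W \<omega>) \<and>
          (\<forall>p\<in>?I. continuous_on {0..} (\<lambda>t. V \<omega> t p)) \<and>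
          (\<exists>c\<in>G. start_weight ?I c (W \<omega> 0) * path_weight ?I c (V \<omega>) = 1)"
        using limit_good
      proof eventually_elim
        case (elim \<omega>)
        then show ?case
          using good_centre_exists[OF F_cont \<eta> W_paths, of \<omega> "V \<omega>"] by (auto simp: G_def)
      qed
      \<comment> \<open>An event of probability one is inhabited. Nonemptiness lets the enumeration
        range over exactly \<open>G\<close>, possibly with repetitions.\<close>
      have "G \<noteq> {}"
        using eventually_happens'[OF \<Omega>.ae_filter_bot cover] by blast
      define e where "e = from_nat_into G"
      have e: "e l \<in> G" for l unfolding e_def by (rule from_nat_into[OF \<open>G \<noteq> {}\<close>])
      have e_surj: "\<exists>l. e l = c" if "c \<in> G" for c
        using from_nat_into_surj[OF G_count that] by (simp add: e_def)
      have "\<exists>v. \<forall>l. good_centre N F \<eta> (e l) (v l)"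
        using e by (intro choice) (auto simp: G_def)
      then obtain v where v: "\<And>l. good_centre N F \<eta> (e l) (v l)" by blast
      define \<phi> where "\<phi> n l \<omega> = start_weight ?I (e l) (Y n \<omega> 0) * path_weight ?I (e l) (Z n \<omega>)" for n l \<omega>
      define \<phi>' where "\<phi>' l \<omega> = start_weight ?I (e l) (W \<omega> 0) * path_weight ?I (e l) (V \<omega>)" for l \<omega>
      show ?thesis
      proof (rule tendsto_expectation_partition[where \<phi> = \<phi> and \<phi>' = \<phi>' and v = v and C = C, OF prob \<Omega>])
        show "\<phi> n l \<in> borel_measurable (M n)" for n l
        proof -
          have "(\<lambda>\<omega>. Y n \<omega> 0) \<in> M n \<rightarrow>\<^sub>M PiM ?I (\<lambda>_. borel)"
            unfolding Y0
          proof (rule measurable_restrict)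
            fix p assume "p \<in> ?I"
            note [measurable] = \<X>0_measurable[OF this]
            show "(\<lambda>\<omega>. (real_of_int (\<X> n \<omega> 0 p) - a n 0) / b n) \<in> borel_measurable (M n)" by measurable
          qed
          from measurable_compose[OF this measurable_start_bump]
          have 1: "(\<lambda>\<omega>. start_weight ?I (e l) (Y n \<omega> 0)) \<in> borel_measurable (M n)" by (simp add: start_weight_def)
          from measurable_compose[OF Z_meas measurable_cadlag_spaceI1[OF measurable_path_bump]]
          have 2: "(\<lambda>\<omega>. path_weight ?I (e l) (Z n \<omega>)) \<in> borel_measurable (M n)" by (simp add: path_weight_def)
          show ?thesis unfolding \<phi>_def by (rule borel_measurable_times[OF 1 2])
        qed
        show "\<phi>' l \<in> borel_measurable \<Omega>" for l
        proof -
          from measurable_compose[OF W0_meas measurable_start_bump]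
          have 1: "(\<lambda>\<omega>. start_weight ?I (e l) (W \<omega> 0)) \<in> borel_measurable \<Omega>" by (simp add: start_weight_def)
          from measurable_compose[OF V_meas measurable_path_bump]
          have 2: "(\<lambda>\<omega>. path_weight ?I (e l) (V \<omega>)) \<in> borel_measurable \<Omega>" by (simp add: path_weight_def)
          show ?thesis unfolding \<phi>'_def by (rule borel_measurable_times[OF 1 2])
        qed
        show "0 \<le> \<phi> n l \<omega> \<and> \<phi> n l \<omega> \<le> 1" for n l \<omega>
          unfolding \<phi>_def by (auto intro!: mult_nonneg_nonneg mult_le_one weight_bounds)
        show "0 \<le> \<phi>' l \<omega> \<and> \<phi>' l \<omega> \<le> 1" for l \<omega>
          unfolding \<phi>'_def by (auto intro!: mult_nonneg_nonneg mult_le_one weight_bounds)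
        show "\<bar>F (Y n \<omega>)\<bar> \<le> C" if "\<omega> \<in> space (M n)" for n \<omega> using C Y_paths that by blast
        show "\<bar>F (W \<omega>)\<bar> \<le> C" if "\<omega> \<in> space \<Omega>" for \<omega> using C W_paths that by blast
        show "\<forall>\<^sub>F n in sequentially. \<forall>\<omega>\<in>space (M n). 0 < \<phi> n l \<omega> \<longrightarrow> \<bar>F (Y n \<omega>) - v l\<bar> \<le> \<eta>" for l
        proof -
          \<comment> \<open>How large \<open>n\<close> must be depends on the radius of the centre,
            so closeness is only eventual for each \<open>l\<close> separately; the truncation to
            finitely many centres makes this enough.\<close>
          have "\<forall>\<^sub>F n in sequentially. 1 / radius (e l) < b n"
            using b_lim by (simp add: filterlim_at_top_dense)
          then show ?thesis
          proof eventually_elim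
            case (elim n)
            then have "1 / b n < radius (e l)"
              using b_pos[of n] radius_pos[of "e l"] by (simp add: field_simps)
            then show ?case
              using v[of l] reflected_Y Y_paths Z_right b_pos[of n] unfolding good_centre_def \<phi>_def
              by (metis less_imp_le zero_le_divide_1_iff)
          qed
        qed
        show "AE \<omega> in \<Omega>. \<forall>l. 0 < \<phi>' l \<omega> \<longrightarrow> \<bar>F (W \<omega>) - v l\<bar> \<le> \<eta>"
          using limit_good
        proof eventually_elim
          case (elim \<omega>)
          show ?case
          proof (intro allI impI)
            fix l assume pos: "0 < \<phi>' l \<omega>"
            have right: "((\<lambda>u. V \<omega> u p) \<longlongrightarrow> V \<omega> t p) (at_right t)" if "p \<in> ?I" "0 \<le> t" for p t
            proof -
              have "((\<lambda>u. V \<omega> u p) \<longlongrightarrow> V \<omega> t p) (at t within {0..})"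
                using elim that by (auto simp: continuous_on)
              then show ?thesis by (rule tendsto_within_subset) (use that in auto)
            qed
            show "\<bar>F (W \<omega>) - v l\<bar> \<le> \<eta>"
              by (rule v[of l, unfolded good_centre_def, rule_format, of 0 "V \<omega>" "W \<omega>"])
                (use elim W_paths right pos radius_pos[of "e l"] in \<open>auto simp: \<phi>'_def\<close>)
          qed
        qed
        show "AE \<omega> in \<Omega>. \<exists>l. \<phi>' l \<omega> = 1"
          using cover
        proof eventually_elim
          case (elim \<omega>)
          then obtain c where "c \<in> G" "start_weight ?I c (W \<omega> 0) * path_weight ?I c (V \<omega>) = 1" by blast
          moreover obtain l where "e l = c" using e_surj[OF \<open>c \<in> G\<close>] by blast
          ultimately show ?case unfolding \<phi>'_def by blast
        qed
        show "(\<lambda>n. \<integral>\<omega>. (\<Prod>l\<in>A. \<phi> n l \<omega>) \<partial>M n) \<longlonglongrightarrow> (\<integral>\<omega>. (\<Prod>l\<in>A. \<phi>' l \<omega>) \<partial>\<Omega>)" if "finite A" for A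
          using weights[of A e, OF that] by (simp add: \<phi>_def \<phi>'_def prod.distrib)
      qed (use FY_meas FW_meas \<eta> in auto)
    qed
    have "(\<lambda>n. \<integral>\<omega>. F (Y n \<omega>) \<partial>M n) \<longlonglongrightarrow> (\<integral>\<omega>. F (W \<omega>) \<partial>\<Omega>)"
    proof (rule tendstoI)
      fix e :: real assume "0 < e"
      \<comment> \<open>With \<open>e / 6\<close> the five errors stay strictly below
        \<open>e\<close>.\<close>
      then have "0 < e / 6" by simp
      from close[OF this] show "\<forall>\<^sub>F n in sequentially. dist (\<integral>\<omega>. F (Y n \<omega>) \<partial>M n) (\<integral>\<omega>. F (W \<omega>) \<partial>\<Omega>) < e"
        by eventually_elim (use \<open>0 < e\<close> in \<open>simp add: dist_real_def\<close>)
    qed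
    then show "(\<lambda>n. \<integral>x. F x \<partial>distr (M n) ?D (\<lambda>\<omega>. rescaled_path ?I (a n) (b n) (\<X> n \<omega>)))
        \<longlonglongrightarrow> (\<integral>x. F x \<partial>distr \<Omega> ?D W)"
      unfolding Y_def[symmetric] integral_distr[OF Y_meas F_meas] integral_distr[OF W_meas F_meas] .
  qed
qed

end
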